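(* Let $(J_2^1(f_2),\dots,J_2^n(f_2))$ be an i.i.d. vector of second order Wiener integrals, let $a=\max_k|a_k|$, and let $b\in(0,1)$. Then $$P\big(|(J_2^1(f_2),\dots,J_2^n(f_2))|_2-2E[|(J_2^1(f_2),\dots,J_2^n(f_2))|_2]\ge x\big)\le e^{-(1-b)\frac xa+K_b},\qquad x>0,$$ and $$P\big(|(J_2^1(f_2),\dots,J_2^n(f_2))|_2-2E[|(J_2^1(f_2),\dots,J_2^n(f_2))|_2]\ge x\big)\le e^{-(1-b)\frac xa},\qquad x\ge\frac{2a}{b}K_{b/2},$$ where $$K_b=-\frac{16\|f_2\|^2_{L^2(\mathbb R_+^2)}}{a^2}\log b-8\|f_2\|^2_{L^2(\mathbb R_+^2)}\left(\frac2{a^2}+\frac1{(E[|J_2(f_2)|])^2}\right)(1-b)+\frac{4\|f_2\|^2_{L^2(\mathbb R_+^2)}}{(E[|J_2(f_2)|])^2}\left(\frac{1-b^2}{b^2}\right).$$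
   Context: For a symmetric $f_2\in L^2(\mathbb R_+^2)$, nonzero, write $f_2=\frac12\sum_{k\ge0}a_k\,h_k\otimes h_k$ (convergence in $L^2(\mathbb R_+^2)$), where $(h_k)_{k\in\mathbb N}$ is an orthonormal basis of $L^2(\mathbb R_+)$ and $(a_k)_{k\in\mathbb N}$ are the (real, square-summable) associated eigenvalues, so $\|f_2\|^2_{L^2(\mathbb R_+^2)}=\frac14\sum_ka_k^2$. The second order Wiener integral with respect to a standard Brownian motion $B$ is $J_2(f_2)=\frac12\sum_{k\ge0}a_k\big((\int_0^\infty h_k(t)\,dB_t)^2-1\big)$ (convergence in $L^2$). $J_2^1(f_2),\dots,J_2^n(f_2)$ are independent copies of $J_2(f_2)$. $|\cdot|_2$ is the Euclidean norm on $\mathbb R^n$. *)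

theory Defs
  imports "HOL-Probability.Probability"
begin

text \<open>Elements of \<open>L\<^sup>2\<close> are represented by measurable functions; equality in \<open>L\<^sup>2\<close> is equality
  almost everywhere.\<close>

definition square_integrable :: "'a measure \<Rightarrow> ('a \<Rightarrow> real) \<Rightarrow> bool" where
  "square_integrable M f \<longleftrightarrow> f \<in> borel_measurable M \<and> integrable M (\<lambda>x. (f x)\<^sup>2)"

definition L2_inner :: "'a measure \<Rightarrow> ('a \<Rightarrow> real) \<Rightarrow> ('a \<Rightarrow> real) \<Rightarrow> real" where
  "L2_inner M f g = (\<integral>x. f x * g x \<partial>M)"

definition L2_norm :: "'a measure \<Rightarrow> ('a \<Rightarrow> real) \<Rightarrow> real" where
  "L2_norm M f = sqrt (L2_inner M f f)"

definition L2_tendsto :: "'a measure \<Rightarrow> (nat \<Rightarrow> 'a \<Rightarrow> real) \<Rightarrow> ('a \<Rightarrow> real) \<Rightarrow> bool" where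
  "L2_tendsto M F f \<longleftrightarrow> (\<forall>n. square_integrable M (F n)) \<and> square_integrable M f \<and>
     (\<lambda>n. L2_norm M (\<lambda>x. F n x - f x)) \<longlonglongrightarrow> 0"

definition L2_orthonormal_basis :: "'a measure \<Rightarrow> (nat \<Rightarrow> 'a \<Rightarrow> real) \<Rightarrow> bool" where
  "L2_orthonormal_basis M h \<longleftrightarrow>
     (\<forall>k. square_integrable M (h k)) \<and>
     (\<forall>j k. L2_inner M (h j) (h k) = (if j = k then 1 else 0)) \<and>
     (\<forall>f. square_integrable M f \<longrightarrow>
        L2_tendsto M (\<lambda>n x. \<Sum>k<n. L2_inner M f (h k) * h k x) f)"

definition half_line :: "real measure" where
  "half_line = restrict_space lborel {0..}"

abbreviation quadrant :: "(real \<times> real) measure" where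
  "quadrant \<equiv> half_line \<Otimes>\<^sub>M half_line"

text \<open>Only the values \<open>B t\<close> with \<open>t \<ge> 0\<close> are relevant.\<close>

locale standard_brownian_motion = prob_space M
  for M :: "'w measure" and B :: "real \<Rightarrow> 'w \<Rightarrow> real" +
  assumes measurable_BM: "\<And>t. t \<ge> 0 \<Longrightarrow> B t \<in> borel_measurable M"
    and BM_start: "AE \<omega> in M. B 0 \<omega> = 0"
    and BM_indep_increments: "\<And>u :: nat \<Rightarrow> real. mono u \<Longrightarrow> 0 \<le> u 0 \<Longrightarrow>
      prob_space.indep_vars M (\<lambda>_. borel) (\<lambda>i \<omega>. B (u (Suc i)) \<omega> - B (u i) \<omega>) UNIV"
    and BM_normal_increments: "\<And>s t. 0 \<le> s \<Longrightarrow> s < t \<Longrightarrow>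
      distributed M lborel (\<lambda>\<omega>. B t \<omega> - B s \<omega>) (\<lambda>x. ennreal (normal_density 0 (sqrt (t - s)) x))"
    and BM_continuous: "AE \<omega> in M. continuous_on {0..} (\<lambda>t. B t \<omega>)"

text \<open>A triple \<open>(c, u, v)\<close> in the list encodes the step \<open>c * indicator {u<..v}\<close>. The intervals
  may overlap.\<close>

definition step_function :: "(real \<times> real \<times> real) list \<Rightarrow> real \<Rightarrow> real" where
  "step_function ss t = (\<Sum>(c, u, v)\<leftarrow>ss. c * indicator {u<..v} t)"

definition step_integral ::
    "(real \<Rightarrow> 'w \<Rightarrow> real) \<Rightarrow> (real \<times> real \<times> real) list \<Rightarrow> 'w \<Rightarrow> real" where
  "step_integral B ss \<omega> = (\<Sum>(c, u, v)\<leftarrow>ss. c * (B v \<omega> - B u \<omega>))"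

text \<open>\<open>Y\<close> is a version of the Wiener integral of \<open>h\<close>: the \<open>L\<^sup>2\<close> limit of the
  integrals of step functions converging to \<open>h\<close> in \<open>L\<^sup>2\<close>. By the isometry property it is
  determined almost surely and does not depend on the approximating sequence.\<close>

definition is_wiener_integral ::
    "'w measure \<Rightarrow> (real \<Rightarrow> 'w \<Rightarrow> real) \<Rightarrow> (real \<Rightarrow> real) \<Rightarrow> ('w \<Rightarrow> real) \<Rightarrow> bool" where
  "is_wiener_integral M B h Y \<longleftrightarrow> (\<exists>ss.
     (\<forall>n. \<forall>(c, u, v) \<in> set (ss n). 0 \<le> u \<and> u \<le> v) \<and>
     L2_tendsto half_line (\<lambda>n. step_function (ss n)) h \<and>
     L2_tendsto M (\<lambda>n. step_integral B (ss n)) Y)"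

definition eigen_expansion ::
    "(real \<times> real \<Rightarrow> real) \<Rightarrow> (nat \<Rightarrow> real \<Rightarrow> real) \<Rightarrow> (nat \<Rightarrow> real) \<Rightarrow> bool" where
  "eigen_expansion f h a \<longleftrightarrow>
     L2_orthonormal_basis half_line h \<and>
     summable (\<lambda>k. (a k)\<^sup>2) \<and>
     L2_tendsto quadrant (\<lambda>n (s, t). 1/2 * (\<Sum>k<n. a k * h k s * h k t)) f"

definition is_second_wiener_integral ::
    "'w measure \<Rightarrow> (real \<Rightarrow> 'w \<Rightarrow> real) \<Rightarrow> (nat \<Rightarrow> real \<Rightarrow> real) \<Rightarrow> (nat \<Rightarrow> real) \<Rightarrow> ('w \<Rightarrow> real) \<Rightarrow> bool"
  where
  "is_second_wiener_integral M B h a J \<longleftrightarrow> (\<exists>W.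
     (\<forall>k. is_wiener_integral M B (h k) (W k)) \<and>
     L2_tendsto M (\<lambda>n \<omega>. 1/2 * (\<Sum>k<n. a k * ((W k \<omega>)\<^sup>2 - 1))) J)"


text \<open>The parameters stand for \<open>r = \<parallel>f\<^sub>2\<parallel>\<close>, \<open>\<alpha> = max\<^sub>k \<bar>a\<^sub>k\<bar>\<close> and \<open>e = E \<bar>J\<^sub>2(f\<^sub>2)\<bar>\<close>.\<close>

definition deviation_const :: "real \<Rightarrow> real \<Rightarrow> real \<Rightarrow> real \<Rightarrow> real" where
  "deviation_const r \<alpha> e b =
     - (16 * r\<^sup>2 / \<alpha>\<^sup>2) * ln b
     - 8 * r\<^sup>2 * (2 / \<alpha>\<^sup>2 + 1 / e\<^sup>2) * (1 - b)
     + 4 * r\<^sup>2 / e\<^sup>2 * ((1 - b\<^sup>2) / b\<^sup>2)"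

end

theory Submission
  imports Defs
begin

text \<open>
  \<open>J\<^sub>2(f\<^sub>2) = 1/2 * (\<Sum>k. a\<^sub>k * (W\<^sub>k\<^sup>2 - 1))\<close> with independent standard normal \<open>W\<^sub>k\<close>. Since
  \<open>W\<^sub>k\<^sup>2 / 2\<close> has the infinitely divisible gamma law with parameter \<open>1/2\<close>, the law of \<open>J\<^sub>2(f\<^sub>2)\<close> is
  infinitely divisible with Levy density \<open>\<Sum>k. exp (- v / a\<^sub>k) / (2 * \<bar>v\<bar>)\<close> over the \<open>k\<close> with
  \<open>a\<^sub>k * v > 0\<close>. Such a law satisfies a modified logarithmic Sobolev inequality with discrete
  gradient: split it into many small independent pieces, tensorize the entropy over them and bound
  the entropy of each piece relative to the value at zero. Tensorizing once more over the \<open>n\<close>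
  coordinates and applying Herbst's argument to \<open>g = max 0 (\<bar>x\<bar>\<^sub>2 - m)\<close>, \<open>m = E \<bar>X\<bar>\<^sub>2\<close>, bounds
  \<open>E (exp (t * (g - E g)))\<close>, and \<open>\<bar>X\<bar>\<^sub>2 - 2 * m \<le> g - E g\<close>. The squared increments of \<open>g\<close> along
  the axes by \<open>v\<close> sum to at most \<open>8 * v\<^sup>2 + 2 * v\<^sup>4 / (E \<bar>J\<^sub>2(f\<^sub>2)\<bar>)\<^sup>2\<close> because \<open>m \<ge> sqrt n * E \<bar>J\<^sub>2(f\<^sub>2)\<bar>\<close>,
  which is where the dimension disappears.
\<close>

section \<open>Entropy\<close>

text \<open>At the origin the squared increments of the Euclidean norm along the axes sum to
  \<open>n * v\<^sup>2\<close>. Cutting the norm off below its mean \<open>m\<close> removes that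
  region; the doubled expectation in the statement is the price. The Sobolev inequality is stated
  only for bounded Lipschitz functions, so the norm is also capped from above, at a level that the
  event does not see. Comparison with the value at zero produces
  \<open>psi y = y * exp y - exp y + 1\<close>. The eigenvalues enter through
  \<open>psi (c * y) \<le> c\<^sup>2 * psi y\<close> for \<open>\<bar>c\<bar> \<le> 1\<close> and
  \<open>0 \<le> y\<close>: the jump density of scale \<open>a k\<close> costs at most
  \<open>(a k)\<^sup>2 / \<alpha>\<^sup>2\<close> times that of the largest scale \<alpha>, and
  these weights sum to \<open>4 * r\<^sup>2 / \<alpha>\<^sup>2\<close>. The jumps of scale \<alpha>
  have an exponential tail of rate \<open>1 / \<alpha>\<close>, so exponents are limited to
  \<open>t * \<alpha> < 1\<close>, and the parameter \<open>b\<close> of the statement is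
  \<open>1 - t * \<alpha>\<close>. Normality and independence of the \<open>W k\<close> come from
  joint characteristic functions of step integrals, because a Wiener integral is given only as a
  limit in the mean square.\<close>

text \<open>Both \<open>f\<close> and \<open>ln f\<close> become bounded, so all integrals in
  \<open>Ent\<close> exist. The bounds hold on the whole type, not just on the space of a measure,
  and therefore survive every substitution.\<close>

definition positive_bounded :: "('a \<Rightarrow> real) \<Rightarrow> bool" where
  "positive_bounded f \<longleftrightarrow> (\<exists>c C. 0 < c \<and> (\<forall>x. c \<le> f x \<and> f x \<le> C))"

definition Ent :: "'a measure \<Rightarrow> ('a \<Rightarrow> real) \<Rightarrow> real" where
  "Ent M f = (\<integral>x. f x * ln (f x) \<partial>M) - (\<integral>x. f x \<partial>M) * ln (\<integral>x. f x \<partial>M)"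

lemma positive_boundedE:
  assumes "positive_bounded f"
  obtains c C where "0 < c" "\<And>x. c \<le> f x" "\<And>x. f x \<le> C" "\<And>x. 0 < f x" "c \<le> C"
  using assms unfolding positive_bounded_def by (metis dual_order.trans order_less_le_trans)

lemma positive_bounded_compose: "positive_bounded f \<Longrightarrow> positive_bounded (\<lambda>x. f (g x))"
  unfolding positive_bounded_def by blast

lemma positive_bounded_exp:
  assumes "\<And>x. \<bar>\<phi> x\<bar> \<le> C"
  shows "positive_bounded (\<lambda>x. exp (\<phi> x))"
  unfolding positive_bounded_def
  by (rule exI[of _ "exp (-C)"], rule exI[of _ "exp C"]) (use assms in \<open>auto simp: abs_le_iff, smt (verit)\<close>)

lemma abs_ln_le_of_between:
  fixes c :: real
  assumes "0 < c" "c \<le> x" "x \<le> C"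
  shows "\<bar>ln x\<bar> \<le> \<bar>ln c\<bar> + \<bar>ln C\<bar>"
proof -
  have "ln c \<le> ln x" "ln x \<le> ln C" using assms by simp_all
  then show ?thesis by linarith
qed

context prob_space
begin

lemma integrable_bounded:
  fixes f :: "'a \<Rightarrow> real"
  assumes "f \<in> borel_measurable M" "\<And>x. x \<in> space M \<Longrightarrow> \<bar>f x\<bar> \<le> C"
  shows "integrable M f"
  by (rule integrable_const_bound[of _ C]) (use assms in auto)

lemma integrable_positive_bounded:
  assumes "f \<in> borel_measurable M" "positive_bounded f"
  shows "integrable M f"
  using assms(2)
proof (rule positive_boundedE)
  fix c C assume "\<And>x. f x \<le> C" "\<And>x. 0 < f x"
  then show ?thesis using assms(1) by (intro integrable_bounded[of _ C]) (auto simp: abs_if less_imp_le dest: less_asym)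
qed

lemma integrable_mult_ln:
  assumes [measurable]: "f \<in> borel_measurable M" "g \<in> borel_measurable M"
    and "positive_bounded f" "positive_bounded g"
  shows "integrable M (\<lambda>x. f x * ln (g x))"
proof -
  obtain c C where f: "0 < c" "\<And>x. c \<le> f x" "\<And>x. f x \<le> C" "\<And>x. 0 < f x" "c \<le> C"
    by (rule positive_boundedE[OF assms(3)]) blast
  obtain d D where g: "0 < d" "\<And>x. d \<le> g x" "\<And>x. g x \<le> D" "\<And>x. 0 < g x" "d \<le> D"
    by (rule positive_boundedE[OF assms(4)]) blast
  show ?thesis
  proof (rule integrable_bounded[of _ "C * (\<bar>ln d\<bar> + \<bar>ln D\<bar>)"])
    fix x
    show "\<bar>f x * ln (g x)\<bar> \<le> C * (\<bar>ln d\<bar> + \<bar>ln D\<bar>)"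
      unfolding abs_mult using f(2,3,4)[of x] f(1,5) abs_ln_le_of_between[OF g(1) g(2,3)[of x]]
      by (intro mult_mono) auto
  qed simp
qed

lemma integral_between:
  assumes [measurable]: "f \<in> borel_measurable M" and "\<And>x. c \<le> f x" "\<And>x. f x \<le> C"
  shows "c \<le> (\<integral>x. f x \<partial>M)" "(\<integral>x. f x \<partial>M) \<le> (C::real)"
proof -
  have i: "integrable M f"
    by (rule integrable_bounded[of _ "\<bar>c\<bar> + \<bar>C\<bar>"])
       (simp, smt (verit) assms(2,3))
  show "c \<le> (\<integral>x. f x \<partial>M)" by (rule integral_ge_const[OF i]) (use assms in auto)
  show "(\<integral>x. f x \<partial>M) \<le> C" by (rule integral_le_const[OF i]) (use assms in auto)
qed

lemma integral_positive_bounded: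
  assumes [measurable]: "f \<in> borel_measurable M" and "positive_bounded f"
  shows "0 < (\<integral>x. f x \<partial>M)"
proof -
  obtain c C where f: "0 < c" "\<And>x. c \<le> f x" "\<And>x. f x \<le> C"
    by (rule positive_boundedE[OF assms(2)]) blast
  show ?thesis using integral_between(1)[OF assms(1) f(2,3)] f(1) by simp
qed

text \<open>The mean of \<open>f\<close> is the optimal constant, and
  \<open>ln x \<le> x - 1\<close> at \<open>x = c / E f\<close> shows that any other
  \<open>c\<close> gives more. A small independent piece uses for \<open>c\<close> the value of the
  function at zero.\<close>

lemma Ent_le_relative:
  assumes [measurable]: "f \<in> borel_measurable M" and f: "positive_bounded f" and c: "0 < c"
  shows "Ent M f \<le> (\<integral>x. f x * ln (f x) - f x * ln c - f x + c \<partial>M)"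
proof -
  let ?m = "\<integral>x. f x \<partial>M"
  have m: "?m > 0" by (rule integral_positive_bounded[OF _ f]) simp
  have i: "integrable M f" "integrable M (\<lambda>x. f x * ln (f x))"
    using f by (auto intro: integrable_positive_bounded integrable_mult_ln)
  have "(\<integral>x. f x * ln (f x) - f x * ln c - f x + c \<partial>M) = (\<integral>x. f x * ln (f x) \<partial>M) - ?m * ln c - ?m + c"
    using i by (simp add: prob_space)
  moreover have "ln (c / ?m) \<le> c / ?m - 1" using m c by (intro ln_le_minus_one) simp
  then have "?m * ln (c / ?m) \<le> ?m * (c / ?m - 1)" using m by (intro mult_left_mono) auto
  then have "?m * (ln c - ln ?m) \<le> c - ?m" using m c by (simp add: ln_div right_diff_distrib)
  ultimately show ?thesis unfolding Ent_def by (simp add: algebra_simps)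
qed

text \<open>The dual variational formula for the entropy, an instance of Gibbs' inequality.
  Tensorization tests a section of \<open>f\<close> against the marginal mean
  \<open>v\<close>.\<close>

lemma integral_mult_ln_le_Ent:
  assumes [measurable]: "f \<in> borel_measurable M" "v \<in> borel_measurable M"
    and f: "positive_bounded f" and v: "positive_bounded v"
  shows "(\<integral>x. f x * (ln (v x) - ln (\<integral>x. v x \<partial>M)) \<partial>M) \<le> Ent M f"
proof -
  let ?m = "\<integral>x. f x \<partial>M" and ?V = "\<integral>x. v x \<partial>M"
  have m: "?m > 0" "?V > 0" by (auto intro!: integral_positive_bounded f v)
  have i: "integrable M f" "integrable M (\<lambda>x. f x * ln (f x))" "integrable M v"
     "integrable M (\<lambda>x. f x * ln (v x))"
    using f v by (auto intro: integrable_positive_bounded integrable_mult_ln)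
  have "(\<integral>x. f x * ln (v x) - f x * ln ?V + f x * ln ?m - f x * ln (f x) \<partial>M)
      \<le> (\<integral>x. v x * (?m / ?V) - f x \<partial>M)"
  proof (rule integral_mono)
    fix x
    have p: "f x > 0" "v x > 0" using f v by (auto elim: positive_boundedE)
    \<comment> \<open>The argument is the quotient of the normalized densities \<open>v / ?V\<close>
      and \<open>f / ?m\<close>; after multiplication by \<open>f x\<close> the right side
      integrates to zero.\<close>
    have "ln (v x * ?m / (?V * f x)) \<le> v x * ?m / (?V * f x) - 1"
      using p m by (intro ln_le_minus_one) simp
    then have "f x * ln (v x * ?m / (?V * f x)) \<le> f x * (v x * ?m / (?V * f x) - 1)"
      using p by (intro mult_left_mono) auto
    moreover have "ln (v x * ?m / (?V * f x)) = ln (v x) + ln ?m - ln ?V - ln (f x)"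
      using p m by (simp add: ln_div ln_mult)
    moreover have "f x * (v x * ?m / (?V * f x) - 1) = v x * (?m / ?V) - f x"
      using p m by (simp add: field_simps)
    ultimately have "f x * (ln (v x) + ln ?m - ln ?V - ln (f x)) \<le> v x * (?m / ?V) - f x" by simp
    then show "f x * ln (v x) - f x * ln ?V + f x * ln ?m - f x * ln (f x) \<le> v x * (?m / ?V) - f x"
      by (simp only: ring_distribs)
  qed (use i in auto)
  also have "\<dots> = 0" using i m by simp
  finally have "(\<integral>x. f x * ln (v x) \<partial>M) - ?m * ln ?V + ?m * ln ?m - (\<integral>x. f x * ln (f x) \<partial>M) \<le> 0"
    using i by simp
  moreover have "(\<integral>x. f x * (ln (v x) - ln ?V) \<partial>M) = (\<integral>x. f x * ln (v x) \<partial>M) - ?m * ln ?V"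
    using i by (simp add: right_diff_distrib)
  ultimately show ?thesis unfolding Ent_def by simp
qed

lemma abs_Ent_le:
  assumes [measurable]: "f \<in> borel_measurable M" and f: "0 < c" "\<And>x. c \<le> f x" "\<And>x. f x \<le> C"
  shows "\<bar>Ent M f\<bar> \<le> 2 * (C * (\<bar>ln c\<bar> + \<bar>ln C\<bar>))"
proof -
  have C: "0 < C" using f(1) f(2,3)[of undefined] by linarith
  let ?B = "C * (\<bar>ln c\<bar> + \<bar>ln C\<bar>)" and ?m = "\<integral>y. f y \<partial>M"
  have m: "c \<le> ?m" "?m \<le> C" using integral_between[OF assms(1) f(2,3)] by auto
  have 1: "\<bar>?m * ln ?m\<bar> \<le> ?B" unfolding abs_mult
    using m f(1) C abs_ln_le_of_between[OF f(1) m] by (intro mult_mono) auto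
  have 2: "\<bar>f y * ln (f y)\<bar> \<le> ?B" for y unfolding abs_mult
    using f(1) f(2,3)[of y] C abs_ln_le_of_between[OF f(1) f(2,3)[of y]] by (intro mult_mono) auto
  have "- ?B \<le> (\<integral>y. f y * ln (f y) \<partial>M)" "(\<integral>y. f y * ln (f y) \<partial>M) \<le> ?B"
    using integral_between[of "\<lambda>y. f y * ln (f y)" "- ?B" ?B] 2 by (auto simp: abs_le_iff minus_le_iff)
  then show ?thesis
    using 1 unfolding Ent_def by linarith
qed

text \<open>As a function of \<open>x\<close> the entropy is bounded by \<open>abs_Ent_le\<close>.
  The map \<open>g\<close> lets one statement serve pairs, sums and coordinate updates.\<close>

lemma integrable_Ent:
  assumes Q: "prob_space Q"
    and f: "(\<lambda>(x, y). f (g x y)) \<in> borel_measurable (M \<Otimes>\<^sub>M Q)" "positive_bounded f"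
  shows "integrable M (\<lambda>x. Ent Q (\<lambda>y. f (g x y)))"
proof -
  interpret Q: prob_space Q by fact
  obtain c C where c: "0 < c" "\<And>x. c \<le> f x" "\<And>x. f x \<le> C"
    by (rule positive_boundedE[OF f(2)]) blast
  note [measurable] = f(1)
  show ?thesis
  proof (rule integrable_bounded)
    show "(\<lambda>x. Ent Q (\<lambda>y. f (g x y))) \<in> borel_measurable M"
      unfolding Ent_def by measurable
    fix x assume [measurable]: "x \<in> space M"
    show "\<bar>Ent Q (\<lambda>y. f (g x y))\<bar> \<le> 2 * (C * (\<bar>ln c\<bar> + \<bar>ln C\<bar>))"
      by (rule Q.abs_Ent_le) (use c in auto)
  qed
qed

end

section \<open>Tensorization of the entropy\<close>

lemma Ent_distr:
  assumes [measurable]: "T \<in> measurable M N" "f \<in> borel_measurable N"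
  shows "Ent (distr M N T) f = Ent M (\<lambda>x. f (T x))"
  unfolding Ent_def by (simp add: integral_distr)

text \<open>By the chain rule the joint entropy is the mean entropy in \<open>y\<close> plus the
  entropy of the marginal \<open>F x = \<integral>y. f (x, y) \<partial>Q\<close>. The latter equals
  the double integral of \<open>f * (ln F - ln (E F))\<close>, which
  \<open>integral_mult_ln_le_Ent\<close> bounds for each fixed \<open>y\<close>.\<close>

lemma Ent_pair_le:
  assumes "prob_space P" "prob_space Q"
    and [measurable]: "f \<in> borel_measurable (P \<Otimes>\<^sub>M Q)" and f: "positive_bounded f"
  shows "Ent (P \<Otimes>\<^sub>M Q) f \<le> (\<integral>x. Ent Q (\<lambda>y. f (x, y)) \<partial>P) + (\<integral>y. Ent P (\<lambda>x. f (x, y)) \<partial>Q)"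
proof -
  interpret P: prob_space P by fact
  interpret Q: prob_space Q by fact
  interpret PQ: pair_prob_space P Q ..
  define F where "F x = (\<integral>y. f (x, y) \<partial>Q)" for x
  obtain c C where c: "0 < c" "\<And>x. c \<le> f x" "\<And>x. f x \<le> C" "\<And>x. 0 < f x" "c \<le> C"
    by (rule positive_boundedE[OF f]) blast
  have [measurable]: "F \<in> borel_measurable P" unfolding F_def by measurable
  have F': "c \<le> F x" "F x \<le> C" if "x \<in> space P" for x
    using Q.integral_between[of "\<lambda>y. f (x, y)" c C] c that by (auto simp: F_def)
  \<comment> \<open>\<open>F\<close> lies between \<open>c\<close> and \<open>C\<close> only on the
    space of \<open>P\<close>, whereas \<open>positive_bounded\<close> speaks of the whole type;
    hence the clamped version.\<close>
  define F1 where "F1 x = max c (min C (F x))" for x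
  have F1: "F1 x = F x" if "x \<in> space P" for x using F'[OF that] by (simp add: F1_def)
  have [measurable]: "F1 \<in> borel_measurable P" unfolding F1_def by measurable
  have pF: "positive_bounded F1" unfolding positive_bounded_def F1_def using c by (intro exI[of _ c] exI[of _ C]) auto
  let ?m = "\<integral>x. F1 x \<partial>P"
  have i: "integrable (P \<Otimes>\<^sub>M Q) f" "integrable (P \<Otimes>\<^sub>M Q) (\<lambda>z. f z * ln (f z))"
    using f by (auto intro: PQ.integrable_positive_bounded PQ.integrable_mult_ln)
  have j: "integrable P F1" "integrable P (\<lambda>x. F1 x * ln (F1 x))"
    using pF by (auto intro: P.integrable_positive_bounded P.integrable_mult_ln)
  have k: "integrable (P \<Otimes>\<^sub>M Q) (\<lambda>z. f z * (ln (F1 (fst z)) - ln ?m))"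
    unfolding right_diff_distrib
    by (intro Bochner_Integration.integrable_diff PQ.integrable_mult_ln positive_bounded_compose[OF pF] f
        integrable_mult_left i(1)) auto
  have m: "(\<integral>z. f z \<partial>(P \<Otimes>\<^sub>M Q)) = ?m"
    using PQ.integral_fst'[OF i(1)] by (simp add: F1 F_def cong: Bochner_Integration.integral_cong)
  have "(\<integral>x. Ent Q (\<lambda>y. f (x, y)) \<partial>P) = (\<integral>x. (\<integral>y. f (x, y) * ln (f (x, y)) \<partial>Q) - F1 x * ln (F1 x) \<partial>P)"
    by (intro Bochner_Integration.integral_cong refl) (simp add: Ent_def F1 F_def)
  also have "\<dots> = (\<integral>z. f z * ln (f z) \<partial>(P \<Otimes>\<^sub>M Q)) - (\<integral>x. F1 x * ln (F1 x) \<partial>P)"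
    using PQ.integral_fst'[OF i(2)] PQ.integrable_fst'[OF i(2)] j by simp
  finally have 1: "(\<integral>x. Ent Q (\<lambda>y. f (x, y)) \<partial>P) = (\<integral>z. f z * ln (f z) \<partial>(P \<Otimes>\<^sub>M Q)) - (\<integral>x. F1 x * ln (F1 x) \<partial>P)" .
  have "(\<integral>x. F1 x * ln (F1 x) \<partial>P) - ?m * ln ?m = (\<integral>x. F1 x * (ln (F1 x) - ln ?m) \<partial>P)"
    using j by (simp add: right_diff_distrib)
  also have "\<dots> = (\<integral>x. (\<integral>y. f (x, y) * (ln (F1 x) - ln ?m) \<partial>Q) \<partial>P)"
    by (intro Bochner_Integration.integral_cong refl) (simp add: F1 F_def)
  also have "\<dots> = (\<integral>y. (\<integral>x. f (x, y) * (ln (F1 x) - ln ?m) \<partial>P) \<partial>Q)"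
    using PQ.Fubini_integral[of "\<lambda>x y. f (x, y) * (ln (F1 x) - ln ?m)"] k by (simp add: split_beta')
  also have "\<dots> \<le> (\<integral>y. Ent P (\<lambda>x. f (x, y)) \<partial>Q)"
  proof (rule integral_mono)
    show "integrable Q (\<lambda>y. \<integral>x. f (x, y) * (ln (F1 x) - ln ?m) \<partial>P)"
      using PQ.integrable_snd[of "\<lambda>x y. f (x, y) * (ln (F1 x) - ln ?m)"] k by (simp add: split_beta')
    show "integrable Q (\<lambda>y. Ent P (\<lambda>x. f (x, y)))"
      by (rule Q.integrable_Ent[OF assms(1) _ f, where g = "\<lambda>y x. (x, y)"]) measurable
    fix y assume [measurable]: "y \<in> space Q"
    show "(\<integral>x. f (x, y) * (ln (F1 x) - ln ?m) \<partial>P) \<le> Ent P (\<lambda>x. f (x, y))"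
      by (rule P.integral_mult_ln_le_Ent) (auto intro: positive_bounded_compose[OF f] pF)
  qed
  finally show ?thesis using 1 m unfolding Ent_def[of "P \<Otimes>\<^sub>M Q"] by simp
qed

text \<open>Induction on the index set with \<open>Ent_pair_le\<close>: coordinate \<open>i\<close>
  is one factor, the remaining ones are the other. The work lies in rewriting iterated integrals
  over the two factors as integrals over the enlarged product.\<close>

lemma Ent_PiM_le:
  fixes \<mu> :: "'i \<Rightarrow> 'a measure"
  assumes \<mu>: "\<And>i. prob_space (\<mu> i)" and "finite I"
    and "f \<in> borel_measurable (PiM I \<mu>)" and "positive_bounded f"
  shows "Ent (PiM I \<mu>) f \<le> (\<Sum>i\<in>I. \<integral>z. Ent (\<mu> i) (\<lambda>u. f (z(i := u))) \<partial>PiM I \<mu>)"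
  using assms(2-)
proof (induction I arbitrary: f rule: finite_induct)
  case empty
  interpret product_prob_space \<mu> "{}::'i set" by (intro product_prob_spaceI \<mu>)
  have "Ent (PiM {} \<mu>) f = 0"
    unfolding Ent_def using empty by (simp add: PiM_empty lebesgue_integral_count_space_finite)
  then show ?case by simp
next
  case (insert i I)
  note [measurable] = insert.prems(1)
  interpret product_prob_space \<mu> I by (intro product_prob_spaceI \<mu>)
  interpret I: prob_space "PiM I \<mu>" by (rule prob_space_PiM[OF \<mu>])
  interpret ii: prob_space "\<mu> i" by (rule \<mu>)
  interpret iI: pair_prob_space "\<mu> i" "PiM I \<mu>" ..
  interpret Ii: prob_space "PiM (insert i I) \<mu>" by (intro prob_space_PiM \<mu>)
  have pb: "positive_bounded (\<lambda>x. f (h x))" for h :: "_ \<Rightarrow> ('i \<Rightarrow> 'a)"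
    using insert.prems(2) by (rule positive_bounded_compose)
  have upd[measurable]: "(\<lambda>(x, z). z(i := x)) \<in> measurable (\<mu> i \<Otimes>\<^sub>M PiM I \<mu>) (PiM (insert i I) \<mu>)"
    unfolding split_beta' by (rule measurable_fun_upd[where J = I]) auto
  have fm: "(\<lambda>(x, z). f (z(i := x))) \<in> borel_measurable (\<mu> i \<Otimes>\<^sub>M PiM I \<mu>)"
    using measurable_compose[OF upd insert.prems(1)] by (simp only: split_beta')
  have eq: "PiM (insert i I) \<mu> = distr (\<mu> i \<Otimes>\<^sub>M PiM I \<mu>) (PiM (insert i I) \<mu>) (\<lambda>(x, z). z(i := x))"
    by (rule distr_pair_PiM_eq_PiM[OF \<mu> \<mu>, symmetric])
  have mj: "(\<lambda>(z, u). f (z(j := u))) \<in> borel_measurable (PiM (insert i I) \<mu> \<Otimes>\<^sub>M \<mu> j)" if "j \<in> insert i I" for j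
    unfolding split_beta'
    by (rule measurable_compose[OF measurable_fun_upd[where J = "insert i I"]]) (use that in \<open>auto simp: insert_absorb\<close>)
  have int: "integrable (PiM (insert i I) \<mu>) (\<lambda>z. Ent (\<mu> j) (\<lambda>u. f (z(j := u))))" if "j \<in> insert i I" for j
    by (rule Ii.integrable_Ent[OF \<mu> mj[OF that] insert.prems(2)])
  have ins: "(\<integral>z. Ent (\<mu> j) (\<lambda>u. f (z(j := u))) \<partial>PiM (insert i I) \<mu>)
      = (\<integral>x. (\<integral>z. Ent (\<mu> j) (\<lambda>u. f ((z(i := x))(j := u))) \<partial>PiM I \<mu>) \<partial>\<mu> i)" if "j \<in> insert i I" for j
  proof -
    let ?E = "\<lambda>z. Ent (\<mu> j) (\<lambda>u. f (z(j := u)))"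
    have "integrable (distr (\<mu> i \<Otimes>\<^sub>M PiM I \<mu>) (PiM (insert i I) \<mu>) (\<lambda>(x, z). z(i := x))) ?E"
      using int[OF that] by (simp flip: eq)
    then have i: "integrable (\<mu> i \<Otimes>\<^sub>M PiM I \<mu>) (\<lambda>(x, z). ?E (z(i := x)))"
      by (subst (asm) integrable_distr_eq) (use int[OF that] in \<open>auto simp: split_beta'\<close>)
    have "(\<integral>z. ?E z \<partial>PiM (insert i I) \<mu>) = (\<integral>p. (\<lambda>(x, z). ?E (z(i := x))) p \<partial>(\<mu> i \<Otimes>\<^sub>M PiM I \<mu>))"
      by (subst eq, subst integral_distr) (use int[OF that] in \<open>auto simp: split_beta'\<close>)
    also have "\<dots> = (\<integral>x. (\<integral>z. ?E (z(i := x)) \<partial>PiM I \<mu>) \<partial>\<mu> i)"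
      using iI.integral_fst'[OF i] by simp
    finally show ?thesis .
  qed
  have intx: "integrable (\<mu> i) (\<lambda>x. \<integral>z. Ent (\<mu> j) (\<lambda>u. f ((z(i := x))(j := u))) \<partial>PiM I \<mu>)" if "j \<in> insert i I" for j
  proof -
    let ?E = "\<lambda>z. Ent (\<mu> j) (\<lambda>u. f (z(j := u)))"
    have "integrable (distr (\<mu> i \<Otimes>\<^sub>M PiM I \<mu>) (PiM (insert i I) \<mu>) (\<lambda>(x, z). z(i := x))) ?E"
      using int[OF that] by (simp flip: eq)
    then have i: "integrable (\<mu> i \<Otimes>\<^sub>M PiM I \<mu>) (\<lambda>(x, z). ?E (z(i := x)))"
      by (subst (asm) integrable_distr_eq) (use int[OF that] in \<open>auto simp: split_beta'\<close>)
    show ?thesis using iI.integrable_fst'[OF i] by simp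
  qed
  have twist: "(z(j := u))(i := x) = (z(i := x))(j := u)" if "j \<in> I" for z :: "'i \<Rightarrow> 'a" and u x j
    using that insert.hyps(2) by (auto simp: fun_upd_twist)
  have "Ent (PiM (insert i I) \<mu>) f = Ent (\<mu> i \<Otimes>\<^sub>M PiM I \<mu>) (\<lambda>(x, z). f (z(i := x)))"
    by (subst eq, subst Ent_distr) (auto simp: split_beta')
  also have "\<dots> \<le> (\<integral>x. Ent (PiM I \<mu>) (\<lambda>z. f (z(i := x))) \<partial>\<mu> i) + (\<integral>z. Ent (\<mu> i) (\<lambda>x. f (z(i := x))) \<partial>PiM I \<mu>)"
    using Ent_pair_le[OF \<mu>[of i] prob_space_PiM[of I, OF \<mu>], of "\<lambda>(x, z). f (z(i := x))"]
       pb[of "\<lambda>(x, z). z(i := x)"] by (simp add: split_beta')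
  \<comment> \<open>The integrand overwrites coordinate \<open>i\<close>, so integrating over that
    coordinate as well changes nothing.\<close>
  also have "(\<integral>z. Ent (\<mu> i) (\<lambda>x. f (z(i := x))) \<partial>PiM I \<mu>) = (\<integral>z. Ent (\<mu> i) (\<lambda>u. f (z(i := u))) \<partial>PiM (insert i I) \<mu>)"
    by (subst ins) (simp_all add: prob_space.prob_space[OF \<mu>])
  also have "(\<integral>x. Ent (PiM I \<mu>) (\<lambda>z. f (z(i := x))) \<partial>\<mu> i)
     \<le> (\<integral>x. (\<Sum>j\<in>I. \<integral>z. Ent (\<mu> j) (\<lambda>u. f ((z(j := u))(i := x))) \<partial>PiM I \<mu>) \<partial>\<mu> i)"
  proof (rule integral_mono)
    fix x assume [measurable]: "x \<in> space (\<mu> i)"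
    show "Ent (PiM I \<mu>) (\<lambda>z. f (z(i := x))) \<le> (\<Sum>j\<in>I. \<integral>z. Ent (\<mu> j) (\<lambda>u. f ((z(j := u))(i := x))) \<partial>PiM I \<mu>)"
      by (rule insert.IH[of "\<lambda>z. f (z(i := x))"]) (simp_all add: pb)
  next
    show "integrable (\<mu> i) (\<lambda>x. Ent (PiM I \<mu>) (\<lambda>z. f (z(i := x))))"
      by (rule prob_space.integrable_Ent[OF \<mu> prob_space_PiM[OF \<mu>] fm insert.prems(2)])
  next
    show "integrable (\<mu> i) (\<lambda>x. \<Sum>j\<in>I. \<integral>z. Ent (\<mu> j) (\<lambda>u. f ((z(j := u))(i := x))) \<partial>PiM I \<mu>)"
      by (intro Bochner_Integration.integrable_sum) (simp add: twist intx)
  qed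
  also have "\<dots> = (\<Sum>j\<in>I. \<integral>z. Ent (\<mu> j) (\<lambda>u. f (z(j := u))) \<partial>PiM (insert i I) \<mu>)"
    using intx by (subst Bochner_Integration.integral_sum) (auto simp: twist ins)
  finally show ?case
    unfolding sum.insert[OF insert.hyps] by (rule ord_le_eq_trans[OF _ add.commute]) (rule add_right_mono)
qed

section \<open>Modified logarithmic Sobolev inequalities\<close>

lemma ennreal_add_le: "ennreal (a + b) \<le> ennreal a + ennreal b"
proof -
  have "ennreal (a + b) \<le> ennreal (max 0 a + max 0 b)" by (intro ennreal_leI) auto
  also have "\<dots> = ennreal (max 0 a) + ennreal (max 0 b)" by (intro ennreal_plus) auto
  also have "\<dots> = ennreal a + ennreal b" by (simp add: max_def ennreal_neg)
  finally show ?thesis .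
qed

lemma ennreal_mult_tendsto:
  fixes f g :: "nat \<Rightarrow> ennreal"
  assumes f: "f \<longlonglongrightarrow> x" "x < \<infinity>" "\<And>n. f n < \<infinity>" and g: "g \<longlonglongrightarrow> y" "y < \<infinity>" "\<And>n. g n < \<infinity>"
  shows "(\<lambda>n. f n * g n) \<longlonglongrightarrow> x * y"
proof -
  have "(\<lambda>n. ennreal (enn2real (f n) * enn2real (g n))) \<longlonglongrightarrow> ennreal (enn2real x * enn2real y)"
    using f g by (intro tendsto_ennrealI tendsto_mult tendsto_enn2real) auto
  then show ?thesis using f g by (simp add: ennreal_mult)
qed

text \<open>\<open>ennreal\<close> cuts negative values to zero, on the left after the integration
  and on the right before it.\<close>

lemma ennreal_integral_le_nn_integral:
  assumes "integrable M f"
  shows "ennreal (\<integral>x. f x \<partial>M) \<le> (\<integral>\<^sup>+x. ennreal (f x) \<partial>M)"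
proof -
  have i: "integrable M (\<lambda>x. max 0 (f x))" using assms by auto
  have "(\<integral>x. f x \<partial>M) \<le> (\<integral>x. max 0 (f x) \<partial>M)" using assms i by (intro integral_mono) auto
  then have "ennreal (\<integral>x. f x \<partial>M) \<le> ennreal (\<integral>x. max 0 (f x) \<partial>M)" by (rule ennreal_leI)
  also have "\<dots> = (\<integral>\<^sup>+x. ennreal (max 0 (f x)) \<partial>M)" using i by (intro nn_integral_eq_integral[symmetric]) auto
  also have "\<dots> = (\<integral>\<^sup>+x. ennreal (f x) \<partial>M)" by (intro nn_integral_cong) (simp add: max_def ennreal_neg)
  finally show ?thesis .
qed

text \<open>A convolution is the image of the product measure under addition, so this is
  \<open>Ent_pair_le\<close> for \<open>f (x + y)\<close>.\<close>

lemma Ent_convolution_le: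
  fixes P Q :: "real measure"
  assumes P: "prob_space P" and Q: "prob_space Q"
    and [measurable_cong]: "sets P = sets borel" "sets Q = sets borel"
    and [measurable]: "f \<in> borel_measurable borel" and f: "positive_bounded f"
  shows "ennreal (Ent (P \<star> Q) f)
    \<le> (\<integral>\<^sup>+x. ennreal (Ent Q (\<lambda>y. f (x + y))) \<partial>P) + (\<integral>\<^sup>+y. ennreal (Ent P (\<lambda>x. f (x + y))) \<partial>Q)"
proof -
  interpret P: prob_space P by fact
  interpret Q: prob_space Q by fact
  have i: "integrable P (\<lambda>x. Ent Q (\<lambda>y. f (x + y)))" "integrable Q (\<lambda>y. Ent P (\<lambda>x. f (x + y)))"
    by (rule P.integrable_Ent[OF Q _ f] Q.integrable_Ent[OF P _ f], measurable)+
  have "Ent (P \<star> Q) f = Ent (P \<Otimes>\<^sub>M Q) (\<lambda>z. f (fst z + snd z))"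
    unfolding convolution_def by (subst Ent_distr) (auto simp: split_beta')
  also have "\<dots> \<le> (\<integral>x. Ent Q (\<lambda>y. f (x + y)) \<partial>P) + (\<integral>y. Ent P (\<lambda>x. f (x + y)) \<partial>Q)"
    using Ent_pair_le[OF P Q, of "\<lambda>z. f (fst z + snd z)"] positive_bounded_compose[OF f, of "\<lambda>z. fst z + snd z"] by simp
  finally have "ennreal (Ent (P \<star> Q) f) \<le> ennreal ((\<integral>x. Ent Q (\<lambda>y. f (x + y)) \<partial>P) + (\<integral>y. Ent P (\<lambda>x. f (x + y)) \<partial>Q))"
    by (rule ennreal_leI)
  also have "\<dots> \<le> ennreal (\<integral>x. Ent Q (\<lambda>y. f (x + y)) \<partial>P) + ennreal (\<integral>y. Ent P (\<lambda>x. f (x + y)) \<partial>Q)"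
    by (rule ennreal_add_le)
  also have "\<dots> \<le> (\<integral>\<^sup>+x. ennreal (Ent Q (\<lambda>y. f (x + y))) \<partial>P) + (\<integral>\<^sup>+y. ennreal (Ent P (\<lambda>x. f (x + y))) \<partial>Q)"
    by (intro add_mono ennreal_integral_le_nn_integral i)
  finally show ?thesis .
qed

section \<open>The function \<open>psi\<close> and the admissible test functions\<close>

text \<open>\<open>exp r * psi (y - r)\<close> is the Bregman divergence of \<open>x * ln x\<close>
  between \<open>exp y\<close> and \<open>exp r\<close>, that is, the integrand of
  \<open>Ent_le_relative\<close> on exponentials.\<close>

definition psi :: "real \<Rightarrow> real" where
  "psi y = y * exp y - exp y + 1"

lemma psi_nonneg: "0 \<le> psi y"
proof -
  have "1 - y \<le> exp (- y)" using exp_ge_add_one_self[of "-y"] by simp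
  then have "(1 - y) * exp y \<le> exp (- y) * exp y" by (rule mult_right_mono) simp
  then show ?thesis by (simp add: psi_def algebra_simps flip: exp_add)
qed

lemma psi_0 [simp]: "psi 0 = 0"
  by (simp add: psi_def)

lemma borel_measurable_psi [measurable]: "psi \<in> borel_measurable borel"
  unfolding psi_def by measurable

lemma continuous_psi: "isCont psi y"
  unfolding psi_def by (intro continuous_intros)

text \<open>The derivative of \<open>psi\<close> at \<open>z\<close> is \<open>z * exp z\<close>, so
  the difference of the two sides has derivative
  \<open>c\<^sup>2 * z * (exp z - exp (c * z))\<close>, which is nonnegative because
  \<open>c * z \<le> z\<close>. Negative \<open>c\<close> is covered. The lemma compares both
  increments with their bound and eigenvalues with the largest one.\<close>

lemma psi_scale_le:
  assumes "\<bar>c\<bar> \<le> 1" "0 \<le> y"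
  shows "psi (c * y) \<le> c\<^sup>2 * psi y"
proof -
  define F where "F y = c\<^sup>2 * psi y - psi (c * y)" for y
  have "F 0 \<le> F y"
  proof (rule DERIV_nonneg_imp_nondecreasing[OF assms(2)])
    fix z :: real assume z: "0 \<le> z" "z \<le> y"
    have "(F has_real_derivative c\<^sup>2 * (z * exp z) - c\<^sup>2 * (z * exp (c * z))) (at z)"
      unfolding F_def psi_def
      by (auto intro!: derivative_eq_intros simp: algebra_simps power2_eq_square)
    moreover have "c * z \<le> z" using z assms(1) by (simp add: mult_left_le_one_le mult_le_cancel_right2 abs_le_iff)
    then have "c\<^sup>2 * (z * exp (c * z)) \<le> c\<^sup>2 * (z * exp z)"
      using z by (intro mult_left_mono) auto
    ultimately show "\<exists>D. (F has_real_derivative D) (at z) \<and> 0 \<le> D" by auto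
  qed
  then show ?thesis by (simp add: F_def)
qed

text \<open>On the interval from \<open>-Y\<close> to \<open>Y\<close>, \<open>psi\<close> stays
  below the parabola with vertex 0 that meets it at \<open>Y\<close>: the scaling lemma with
  \<open>c = y / Y\<close>.\<close>

lemma psi_le_quadratic:
  assumes "\<bar>y\<bar> \<le> Y" "0 < Y"
  shows "psi y \<le> y\<^sup>2 * (psi Y / Y\<^sup>2)"
  using psi_scale_le[of "y / Y" Y] assms by (simp add: power_divide)

text \<open>Boundedness keeps \<open>exp (\<phi> x)\<close> away from 0 and \<infinity>; the
  Lipschitz condition makes \<open>psi\<close> of an increment quadratic in the jump, as integration
  against a Levy density requires.\<close>

definition bounded_lipschitz :: "(real \<Rightarrow> real) \<Rightarrow> bool" where
  "bounded_lipschitz \<phi> \<longleftrightarrow> (\<exists>C. \<forall>x. \<bar>\<phi> x\<bar> \<le> C) \<and> (\<exists>L. L-lipschitz_on UNIV \<phi>)"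

lemma bounded_lipschitzE:
  assumes "bounded_lipschitz \<phi>"
  obtains C L where "\<And>x. \<bar>\<phi> x\<bar> \<le> C" "0 < C" "0 \<le> L" "\<And>x y. \<bar>\<phi> x - \<phi> y\<bar> \<le> L * \<bar>x - y\<bar>"
    "\<phi> \<in> borel_measurable borel" "positive_bounded (\<lambda>x. exp (\<phi> x))" "\<And>x. isCont \<phi> x"
proof -
  obtain C L where *: "\<And>x. \<bar>\<phi> x\<bar> \<le> C" "L-lipschitz_on UNIV \<phi>"
    using assms unfolding bounded_lipschitz_def by blast
  have "continuous_on UNIV \<phi>" using *(2) by (rule lipschitz_on_continuous_on)
  then have "\<And>x. isCont \<phi> x" "\<phi> \<in> borel_measurable borel"
    by (auto simp: continuous_on_eq_continuous_at borel_measurable_continuous_onI)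
  moreover have "positive_bounded (\<lambda>x. exp (\<phi> x))" using *(1) by (rule positive_bounded_exp)
  ultimately show ?thesis
    using that[of "max C 1" L] * unfolding lipschitz_on_def dist_real_def
    by (simp add: le_max_iff_disj)
qed

lemma bounded_lipschitz_affine:
  assumes "bounded_lipschitz \<phi>"
  shows "bounded_lipschitz (\<lambda>x. \<phi> (c * x + d))"
proof -
  obtain C L where *: "\<And>x. \<bar>\<phi> x\<bar> \<le> C" "L-lipschitz_on UNIV \<phi>"
    using assms unfolding bounded_lipschitz_def by blast
  have "(L * \<bar>c\<bar>)-lipschitz_on UNIV (\<lambda>x. \<phi> (c * x + d))"
  proof (rule lipschitz_onI)
    fix x y
    have "\<bar>\<phi> (c * x + d) - \<phi> (c * y + d)\<bar> \<le> L * \<bar>c * x + d - (c * y + d)\<bar>"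
      using *(2) unfolding lipschitz_on_def dist_real_def by blast
    also have "c * x + d - (c * y + d) = c * (x - y)" by (simp add: algebra_simps)
    finally show "dist (\<phi> (c * x + d)) (\<phi> (c * y + d)) \<le> L * \<bar>c\<bar> * dist x y"
      by (simp add: dist_real_def abs_mult)
  qed (use *(2) in \<open>auto simp: lipschitz_on_def\<close>)
  then show ?thesis using *(1) unfolding bounded_lipschitz_def by blast
qed

lemma bounded_lipschitz_shift:
  "bounded_lipschitz \<phi> \<Longrightarrow> bounded_lipschitz (\<lambda>x. \<phi> (d + x))"
  using bounded_lipschitz_affine[of \<phi> 1 d] by (simp add: add.commute)

text \<open>Supplies the dominating function \<open>K * v\<^sup>2\<close>, uniform in the base point
  \<open>x\<close>, for all limit passages in the jump energy.\<close>

lemma psi_increment_le: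
  assumes "bounded_lipschitz \<phi>"
  obtains K where "0 \<le> K" "\<And>x v. psi (\<phi> (x + v) - \<phi> x) \<le> K * v\<^sup>2"
proof -
  obtain C L where *: "\<And>x. \<bar>\<phi> x\<bar> \<le> C" "0 < C" "0 \<le> L" "\<And>x y. \<bar>\<phi> x - \<phi> y\<bar> \<le> L * \<bar>x - y\<bar>"
    by (rule bounded_lipschitzE[OF assms]) blast
  let ?K = "psi (2 * C) / (2 * C)\<^sup>2"
  have K: "0 \<le> ?K" by (simp add: psi_nonneg)
  show ?thesis
  proof
    show "0 \<le> L\<^sup>2 * ?K" using K by (intro mult_nonneg_nonneg) simp_all
    fix x v
    let ?y = "\<phi> (x + v) - \<phi> x"
    have "\<bar>?y\<bar> \<le> 2 * C" using *(1)[of "x + v"] *(1)[of x] by linarith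
    then have "psi ?y \<le> ?y\<^sup>2 * ?K" using *(2) by (intro psi_le_quadratic) auto
    also have "\<bar>?y\<bar> \<le> \<bar>L * v\<bar>" using *(3) *(4)[of "x + v" x] by (simp add: abs_mult)
    then have "?y\<^sup>2 \<le> (L * v)\<^sup>2" by (simp only: abs_le_square_iff)
    then have "?y\<^sup>2 * ?K \<le> (L * v)\<^sup>2 * ?K" using K by (intro mult_right_mono)
    finally show "psi ?y \<le> L\<^sup>2 * ?K * v\<^sup>2" by (simp add: power_mult_distrib mult_ac)
  qed
qed

section \<open>The inequality and its closure properties\<close>

text \<open>The density \<open>l\<close> takes values in \<open>ennreal\<close>, so that an infinite
  sum of densities, one for each eigenvalue, is defined without a convergence argument.\<close>

definition jump_energy :: "(real \<Rightarrow> ennreal) \<Rightarrow> (real \<Rightarrow> real) \<Rightarrow> real \<Rightarrow> ennreal" where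
  "jump_energy l \<phi> x = (\<integral>\<^sup>+v. ennreal (psi (\<phi> (x + v) - \<phi> x)) * l v \<partial>lborel)"

text \<open>Nothing but this inequality ties \<open>l\<close> to \<open>\<mu>\<close>. That
  \<open>l\<close> is the Levy density of the law is realized by construction: a base case for the
  gamma law and closure under convolution, affine maps and limits.\<close>

definition modified_log_sobolev :: "real measure \<Rightarrow> (real \<Rightarrow> ennreal) \<Rightarrow> bool" where
  "modified_log_sobolev \<mu> l \<longleftrightarrow> (\<forall>\<phi>. bounded_lipschitz \<phi> \<longrightarrow>
     ennreal (Ent \<mu> (\<lambda>x. exp (\<phi> x))) \<le> (\<integral>\<^sup>+x. ennreal (exp (\<phi> x)) * jump_energy l \<phi> x \<partial>\<mu>))"

lemma jump_energy_shift: "jump_energy l (\<lambda>x. \<phi> (d + x)) x = jump_energy l \<phi> (d + x)"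
  by (simp add: jump_energy_def add.assoc)

lemma borel_measurable_jump_energy [measurable]:
  assumes [measurable]: "\<phi> \<in> borel_measurable borel" "l \<in> borel_measurable borel"
  shows "jump_energy l \<phi> \<in> borel_measurable borel"
  unfolding jump_energy_def by measurable

text \<open>Levy densities add. Each factor is treated with the other summand frozen, which only
  shifts the test function, and \<open>jump_energy_shift\<close> shows that a shift moves the base
  point alone.\<close>

lemma modified_log_sobolev_convolution:
  assumes P: "prob_space P" and Q: "prob_space Q"
    and [measurable_cong]: "sets P = sets borel" "sets Q = sets borel"
    and [measurable]: "l \<in> borel_measurable borel" "l' \<in> borel_measurable borel"
    and mP: "modified_log_sobolev P l" and mQ: "modified_log_sobolev Q l'"
  shows "modified_log_sobolev (P \<star> Q) (\<lambda>v. l v + l' v)"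
  unfolding modified_log_sobolev_def
proof safe
  fix \<phi> assume \<phi>: "bounded_lipschitz \<phi>"
  have [measurable]: "\<phi> \<in> borel_measurable borel" and pb: "positive_bounded (\<lambda>x. exp (\<phi> x))"
    using \<phi> by (auto elim: bounded_lipschitzE)
  interpret P: prob_space P by fact
  interpret Q: prob_space Q by fact
  let ?J = "\<lambda>l x. ennreal (exp (\<phi> x)) * jump_energy l \<phi> x"
  have "ennreal (Ent (P \<star> Q) (\<lambda>x. exp (\<phi> x)))
     \<le> (\<integral>\<^sup>+x. ennreal (Ent Q (\<lambda>y. exp (\<phi> (x + y)))) \<partial>P) + (\<integral>\<^sup>+y. ennreal (Ent P (\<lambda>x. exp (\<phi> (x + y)))) \<partial>Q)"
    by (rule Ent_convolution_le[OF P Q assms(3,4) _ pb]) measurable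
  also have "\<dots> \<le> (\<integral>\<^sup>+x. (\<integral>\<^sup>+y. ?J l' (x + y) \<partial>Q) \<partial>P) + (\<integral>\<^sup>+y. (\<integral>\<^sup>+x. ?J l (y + x) \<partial>P) \<partial>Q)"
  proof (intro add_mono nn_integral_mono)
    fix x
    show "ennreal (Ent Q (\<lambda>y. exp (\<phi> (x + y)))) \<le> (\<integral>\<^sup>+y. ?J l' (x + y) \<partial>Q)"
      using mQ[unfolded modified_log_sobolev_def, rule_format, OF bounded_lipschitz_shift[OF \<phi>, of x]]
      by (simp add: jump_energy_shift)
    show "ennreal (Ent P (\<lambda>y. exp (\<phi> (y + x)))) \<le> (\<integral>\<^sup>+y. ?J l (x + y) \<partial>P)"
      using mP[unfolded modified_log_sobolev_def, rule_format, OF bounded_lipschitz_shift[OF \<phi>, of x]]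
      by (simp add: jump_energy_shift) (simp add: add.commute)
  qed
  also have "(\<integral>\<^sup>+x. (\<integral>\<^sup>+y. ?J l' (x + y) \<partial>Q) \<partial>P) = (\<integral>\<^sup>+x. ?J l' x \<partial>(P \<star> Q))"
    by (rule nn_integral_convolution[symmetric])
      (simp_all add: assms(3,4) P.finite_measure_axioms Q.finite_measure_axioms)
  also have "(\<integral>\<^sup>+y. (\<integral>\<^sup>+x. ?J l (y + x) \<partial>P) \<partial>Q) = (\<integral>\<^sup>+x. ?J l x \<partial>(Q \<star> P))"
    by (rule nn_integral_convolution[symmetric])
      (simp_all add: assms(3,4) P.finite_measure_axioms Q.finite_measure_axioms)
  also have "(Q \<star> P) = (P \<star> Q)"
    by (rule convolution_commutative) (simp_all add: assms(3,4) P.finite_measure_axioms Q.finite_measure_axioms)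
  also have "(\<integral>\<^sup>+x. ?J l' x \<partial>(P \<star> Q)) + (\<integral>\<^sup>+x. ?J l x \<partial>(P \<star> Q)) = (\<integral>\<^sup>+x. ?J l' x + ?J l x \<partial>(P \<star> Q))"
    by (rule nn_integral_add[symmetric]) auto
  also have "\<dots> = (\<integral>\<^sup>+x. ?J (\<lambda>v. l v + l' v) x \<partial>(P \<star> Q))"
    by (intro nn_integral_cong)
       (simp add: jump_energy_def distrib_left nn_integral_add add.commute)
  finally show "ennreal (Ent (P \<star> Q) (\<lambda>x. exp (\<phi> x))) \<le> (\<integral>\<^sup>+x. ?J (\<lambda>v. l v + l' v) x \<partial>(P \<star> Q))" .
qed

text \<open>Scaling by \<open>c\<close> pushes the jump density forward under
  \<open>v \<mapsto> c * v\<close>, whence the quotient by \<bar>c\<bar>; the translation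
  \<open>d\<close> creates no jumps.\<close>

lemma modified_log_sobolev_affine:
  assumes [measurable_cong]: "sets \<mu> = sets borel" and [measurable]: "l \<in> borel_measurable borel"
    and m: "modified_log_sobolev \<mu> l" and c: "c \<noteq> 0"
  shows "modified_log_sobolev (distr \<mu> borel (\<lambda>x. c * x + d)) (\<lambda>v. l (v / c) / ennreal \<bar>c\<bar>)"
  unfolding modified_log_sobolev_def
proof safe
  fix \<phi> assume \<phi>: "bounded_lipschitz \<phi>"
  have [measurable]: "\<phi> \<in> borel_measurable borel" using \<phi> by (auto elim: bounded_lipschitzE)
  have eq: "jump_energy l (\<lambda>x. \<phi> (c * x + d)) x = jump_energy (\<lambda>v. l (v / c) / ennreal \<bar>c\<bar>) \<phi> (c * x + d)" for x
  proof -
    have "jump_energy (\<lambda>v. l (v / c) / ennreal \<bar>c\<bar>) \<phi> (c * x + d)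
        = ennreal \<bar>c\<bar> * (\<integral>\<^sup>+v. ennreal (psi (\<phi> (c * x + d + (0 + c * v)) - \<phi> (c * x + d))) * (l ((0 + c * v) / c) / ennreal \<bar>c\<bar>) \<partial>lborel)"
      unfolding jump_energy_def by (rule nn_integral_real_affine) (use c in auto)
    also have "\<dots> = (\<integral>\<^sup>+v. ennreal \<bar>c\<bar> * (ennreal (psi (\<phi> (c * x + d + (0 + c * v)) - \<phi> (c * x + d))) * (l ((0 + c * v) / c) / ennreal \<bar>c\<bar>)) \<partial>lborel)"
      by (rule nn_integral_cmult[symmetric]) measurable
    also have "\<dots> = jump_energy l (\<lambda>x. \<phi> (c * x + d)) x"
      unfolding jump_energy_def
    proof (intro nn_integral_cong)
      fix v
      have "ennreal \<bar>c\<bar> * (A * (B / ennreal \<bar>c\<bar>)) = A * B" for A B :: ennreal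
      proof -
        have "ennreal \<bar>c\<bar> * (A * (B / ennreal \<bar>c\<bar>)) = A * B * ennreal \<bar>c\<bar> / ennreal \<bar>c\<bar>"
          by (simp add: ennreal_times_divide mult_ac)
        then show ?thesis using c by (simp add: ennreal_mult_divide_eq)
      qed
      moreover have "c * x + d + (0 + c * v) = c * (x + v) + d" "(0 + c * v) / c = v"
        using c by (simp_all add: distrib_left)
      ultimately show "ennreal \<bar>c\<bar> * (ennreal (psi (\<phi> (c * x + d + (0 + c * v)) - \<phi> (c * x + d))) * (l ((0 + c * v) / c) / ennreal \<bar>c\<bar>))
         = ennreal (psi (\<phi> (c * (x + v) + d) - \<phi> (c * x + d))) * l v"
        by (simp only:)
    qed
    finally show ?thesis ..
  qed
  show "ennreal (Ent (distr \<mu> borel (\<lambda>x. c * x + d)) (\<lambda>x. exp (\<phi> x)))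
    \<le> (\<integral>\<^sup>+x. ennreal (exp (\<phi> x)) * jump_energy (\<lambda>v. l (v / c) / ennreal \<bar>c\<bar>) \<phi> x \<partial>distr \<mu> borel (\<lambda>x. c * x + d))"
    using m[unfolded modified_log_sobolev_def, rule_format, OF bounded_lipschitz_affine[OF \<phi>, of c d]]
    by (simp add: Ent_distr nn_integral_distr eq)
qed

lemma modified_log_sobolev_const:
  assumes "prob_space \<mu>"
  shows "modified_log_sobolev (distr \<mu> borel (\<lambda>x. d)) l"
proof -
  interpret prob_space \<mu> by fact
  show ?thesis
    unfolding modified_log_sobolev_def
  proof safe
    fix \<phi> assume \<phi>: "bounded_lipschitz \<phi>"
    have [measurable]: "\<phi> \<in> borel_measurable borel" using \<phi> by (auto elim: bounded_lipschitzE)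
    have "Ent (distr \<mu> borel (\<lambda>x. d)) (\<lambda>x. exp (\<phi> x)) = 0"
      by (subst Ent_distr) (auto simp: Ent_def prob_space)
    then show "ennreal (Ent (distr \<mu> borel (\<lambda>x. d)) (\<lambda>x. exp (\<phi> x)))
      \<le> (\<integral>\<^sup>+x. ennreal (exp (\<phi> x)) * jump_energy l \<phi> x \<partial>distr \<mu> borel (\<lambda>x. d))" by simp
  qed
qed

text \<open>The right side is monotone in the density, so every \<open>k n\<close> is replaced by
  the common bound \<open>l\<close> before the limit. Both sides then converge by dominated
  convergence, where finiteness of the second moment of \<open>l\<close> bounds the jump energy
  uniformly.\<close>

lemma modified_log_sobolev_limit:
  fixes Y :: "nat \<Rightarrow> 'a \<Rightarrow> real"
  assumes M: "prob_space M" and [measurable]: "\<And>n. Y n \<in> borel_measurable M" "Z \<in> borel_measurable M"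
    and lim: "AE \<omega> in M. (\<lambda>n. Y n \<omega>) \<longlonglongrightarrow> Z \<omega>"
    and [measurable]: "\<And>n. k n \<in> borel_measurable borel" "l \<in> borel_measurable borel"
    and kl: "\<And>n v. k n v \<le> l v" and fin: "(\<integral>\<^sup>+v. ennreal (v\<^sup>2) * l v \<partial>lborel) < \<infinity>"
    and m: "\<And>n. modified_log_sobolev (distr M borel (Y n)) (k n)"
  shows "modified_log_sobolev (distr M borel Z) l"
  unfolding modified_log_sobolev_def
proof safe
  fix \<phi> assume \<phi>: "bounded_lipschitz \<phi>"
  interpret prob_space M by fact
  obtain C L where C: "\<And>x. \<bar>\<phi> x\<bar> \<le> C" "0 < C" and [measurable]: "\<phi> \<in> borel_measurable borel"
    and cont: "\<And>x. isCont \<phi> x"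
    by (rule bounded_lipschitzE[OF \<phi>]) blast
  obtain K where K: "0 \<le> K" "\<And>x v. psi (\<phi> (x + v) - \<phi> x) \<le> K * v\<^sup>2"
    by (rule psi_increment_le[OF \<phi>]) blast
  let ?w = "\<lambda>v. ennreal (K * v\<^sup>2) * l v"
  have "(\<integral>\<^sup>+v. ?w v \<partial>lborel) = ennreal K * (\<integral>\<^sup>+v. ennreal (v\<^sup>2) * l v \<partial>lborel)"
    using K(1) by (simp add: ennreal_mult mult.assoc nn_integral_cmult)
  then have fin': "(\<integral>\<^sup>+v. ?w v \<partial>lborel) < \<infinity>"
    using fin by (simp add: ennreal_mult_less_top)
  have le: "jump_energy l \<phi> x \<le> (\<integral>\<^sup>+v. ?w v \<partial>lborel)" for x
    unfolding jump_energy_def using K by (intro nn_integral_mono mult_right_mono ennreal_leI) auto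
  have conv: "(\<lambda>n. jump_energy l \<phi> (y n)) \<longlonglongrightarrow> jump_energy l \<phi> z" if "y \<longlonglongrightarrow> z" for y z
    unfolding jump_energy_def
  proof (rule nn_integral_dominated_convergence[where w = ?w])
    show "AE v in lborel. ennreal (psi (\<phi> (y n + v) - \<phi> (y n))) * l v \<le> ?w v" for n
      using K by (intro AE_I2 mult_right_mono ennreal_leI) auto
    have "AE v in lborel. ?w v \<noteq> \<infinity>" using fin' by (intro nn_integral_PInf_AE) auto
    then show "AE v in lborel. (\<lambda>n. ennreal (psi (\<phi> (y n + v) - \<phi> (y n))) * l v)
        \<longlonglongrightarrow> ennreal (psi (\<phi> (z + v) - \<phi> z)) * l v"
    proof eventually_elim
      fix v assume "?w v \<noteq> \<infinity>"
      have t: "(\<lambda>n. ennreal (psi (\<phi> (y n + v) - \<phi> (y n)))) \<longlonglongrightarrow> ennreal (psi (\<phi> (z + v) - \<phi> z))"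
        by (intro tendsto_ennrealI isCont_tendsto_compose[OF continuous_psi] tendsto_intros
            isCont_tendsto_compose[OF cont] that)
      show "(\<lambda>n. ennreal (psi (\<phi> (y n + v) - \<phi> (y n))) * l v) \<longlonglongrightarrow> ennreal (psi (\<phi> (z + v) - \<phi> z)) * l v"
      \<comment> \<open>Multiplication in \<open>ennreal\<close> is not continuous at zero times
        \<infinity>. Where \<open>l v\<close> is infinite, finiteness of \<open>?w v\<close> forces
        \<open>K * v\<^sup>2 = 0\<close>, so all increments have \<open>psi\<close> equal to
        0.\<close>
      proof (cases "l v = \<infinity>")
        case False
        then show ?thesis
using t by (intro ennreal_mult_tendsto tendsto_const) (auto simp: top.not_eq_extremum)
      next
        case True
        with \<open>?w v \<noteq> \<infinity>\<close> have "K * v\<^sup>2 \<le> 0" by (auto simp: ennreal_mult_eq_top_iff ennreal_eq_0_iff)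
        then have "psi (\<phi> (x + v) - \<phi> x) = 0" for x using K(2)[of x v] psi_nonneg by (metis order.antisym order_trans)
        then show ?thesis by simp
      qed
    qed
  qed (use fin' in auto)
  have conv_int: "(\<lambda>n. \<integral>\<omega>. g (Y n \<omega>) \<partial>M) \<longlonglongrightarrow> (\<integral>\<omega>. g (Z \<omega>) \<partial>M)"
    if g: "\<And>x. isCont g x" "\<And>x. \<bar>g x\<bar> \<le> B" for g :: "real \<Rightarrow> real" and B
  proof (rule integral_dominated_convergence[where w = "\<lambda>_. B"])
    have [measurable]: "g \<in> borel_measurable borel"
      using g(1) by (intro borel_measurable_continuous_onI) (simp add: continuous_at_imp_continuous_on)
    show "(\<lambda>\<omega>. g (Z \<omega>)) \<in> borel_measurable M" "\<And>n. (\<lambda>\<omega>. g (Y n \<omega>)) \<in> borel_measurable M" by measurable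
    show "AE \<omega> in M. (\<lambda>n. g (Y n \<omega>)) \<longlonglongrightarrow> g (Z \<omega>)"
      using lim by eventually_elim (rule isCont_tendsto_compose[OF g(1)])
  qed (use g(2) in auto)
  have e: "\<bar>exp (\<phi> x)\<bar> \<le> exp C" "\<bar>exp (\<phi> x) * \<phi> x\<bar> \<le> exp C * C" for x
    using C(1)[of x] C(2) by (auto simp: abs_mult abs_le_iff intro!: mult_mono)
  have pos: "0 < (\<integral>\<omega>. exp (\<phi> (Z \<omega>)) \<partial>M)"
    by (rule integral_positive_bounded) (auto intro: positive_bounded_exp C)
  have "(\<lambda>n. Ent (distr M borel (Y n)) (\<lambda>x. exp (\<phi> x))) \<longlonglongrightarrow> Ent (distr M borel Z) (\<lambda>x. exp (\<phi> x))"
    unfolding Ent_def using pos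
    by (simp add: integral_distr, intro tendsto_intros conv_int[OF _ e(1)] conv_int[OF _ e(2)])
       (auto intro!: continuous_intros cont)
  then have 1: "(\<lambda>n. ennreal (Ent (distr M borel (Y n)) (\<lambda>x. exp (\<phi> x)))) \<longlonglongrightarrow> ennreal (Ent (distr M borel Z) (\<lambda>x. exp (\<phi> x)))"
    by (rule tendsto_ennrealI)
  have 2: "(\<lambda>n. \<integral>\<^sup>+\<omega>. ennreal (exp (\<phi> (Y n \<omega>))) * jump_energy l \<phi> (Y n \<omega>) \<partial>M)
      \<longlonglongrightarrow> (\<integral>\<^sup>+\<omega>. ennreal (exp (\<phi> (Z \<omega>))) * jump_energy l \<phi> (Z \<omega>) \<partial>M)"
  proof (rule nn_integral_dominated_convergence[where w = "\<lambda>_. ennreal (exp C) * (\<integral>\<^sup>+v. ?w v \<partial>lborel)"])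
    show "AE \<omega> in M. ennreal (exp (\<phi> (Y n \<omega>))) * jump_energy l \<phi> (Y n \<omega>) \<le> ennreal (exp C) * (\<integral>\<^sup>+v. ?w v \<partial>lborel)" for n
      using e(1) le by (intro AE_I2 mult_mono ennreal_leI) auto
    show "(\<integral>\<^sup>+\<omega>. ennreal (exp C) * (\<integral>\<^sup>+v. ?w v \<partial>lborel) \<partial>M) < \<infinity>"
      using fin' by (simp add: emeasure_space_1 ennreal_mult_less_top)
    show "AE \<omega> in M. (\<lambda>n. ennreal (exp (\<phi> (Y n \<omega>))) * jump_energy l \<phi> (Y n \<omega>))
       \<longlonglongrightarrow> ennreal (exp (\<phi> (Z \<omega>))) * jump_energy l \<phi> (Z \<omega>)"
      using lim
    proof eventually_elim
      fix \<omega> assume "(\<lambda>n. Y n \<omega>) \<longlonglongrightarrow> Z \<omega>"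
      then show "(\<lambda>n. ennreal (exp (\<phi> (Y n \<omega>))) * jump_energy l \<phi> (Y n \<omega>))
       \<longlonglongrightarrow> ennreal (exp (\<phi> (Z \<omega>))) * jump_energy l \<phi> (Z \<omega>)"
        using order.strict_trans1[OF le fin']
        by (intro ennreal_mult_tendsto conv tendsto_ennrealI tendsto_exp isCont_tendsto_compose[OF cont]) auto
    qed
  qed measurable
  have 3: "ennreal (Ent (distr M borel (Y n)) (\<lambda>x. exp (\<phi> x)))
      \<le> (\<integral>\<^sup>+\<omega>. ennreal (exp (\<phi> (Y n \<omega>))) * jump_energy l \<phi> (Y n \<omega>) \<partial>M)" for n
  proof -
    have "ennreal (Ent (distr M borel (Y n)) (\<lambda>x. exp (\<phi> x)))
      \<le> (\<integral>\<^sup>+x. ennreal (exp (\<phi> x)) * jump_energy (k n) \<phi> x \<partial>distr M borel (Y n))"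
      using m \<phi> unfolding modified_log_sobolev_def by blast
    also have "\<dots> \<le> (\<integral>\<^sup>+x. ennreal (exp (\<phi> x)) * jump_energy l \<phi> x \<partial>distr M borel (Y n))"
      unfolding jump_energy_def by (intro nn_integral_mono mult_left_mono kl) auto
    finally show ?thesis by (simp add: nn_integral_distr)
  qed
  show "ennreal (Ent (distr M borel Z) (\<lambda>x. exp (\<phi> x)))
      \<le> (\<integral>\<^sup>+x. ennreal (exp (\<phi> x)) * jump_energy l \<phi> x \<partial>distr M borel Z)"
    using LIMSEQ_le[OF 1 2] 3 by (auto simp: nn_integral_distr)
qed

section \<open>Gamma laws\<close>

definition gamma_density :: "real \<Rightarrow> real \<Rightarrow> real" where
  "gamma_density \<theta> x = (if 0 < x then x powr (\<theta> - 1) * exp (- x) / Gamma \<theta> else 0)"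

definition gamma_law :: "real \<Rightarrow> real measure" where
  "gamma_law \<theta> = density lborel (\<lambda>x. ennreal (gamma_density \<theta> x))"

lemma borel_measurable_gamma_density [measurable]: "gamma_density \<theta> \<in> borel_measurable borel"
  unfolding gamma_density_def by measurable

lemma gamma_density_nonneg: "0 < \<theta> \<Longrightarrow> 0 \<le> gamma_density \<theta> x"
  by (auto simp: gamma_density_def intro!: divide_nonneg_nonneg less_imp_le Gamma_real_pos)

lemma sets_gamma_law [simp, measurable_cong]: "sets (gamma_law \<theta>) = sets borel"
  by (simp add: gamma_law_def)

lemma space_gamma_law [simp]: "space (gamma_law \<theta>) = UNIV"
  by (simp add: gamma_law_def)

lemma nn_integral_powr_exp:
  assumes "0 < \<theta>"
  shows "(\<integral>\<^sup>+x. ennreal (if 0 < x then x powr (\<theta> - 1) * exp (- x) else 0) \<partial>lborel) = ennreal (Gamma \<theta>)"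
proof -
  have "(\<integral>\<^sup>+x. ennreal (if 0 < x then x powr (\<theta> - 1) * exp (- x) else 0) \<partial>lborel)
     = (\<integral>\<^sup>+t. ennreal (indicator {0..} t * t powr (\<theta> - 1) / exp t) \<partial>lborel)"
    by (intro nn_integral_cong) (auto simp: indicator_def exp_minus field_simps)
  then show ?thesis using Gamma_conv_nn_integral_real[OF assms] by simp
qed

lemma prob_space_gamma_law:
  assumes "0 < \<theta>"
  shows "prob_space (gamma_law \<theta>)"
proof
  have "(\<integral>\<^sup>+x. ennreal (gamma_density \<theta> x) \<partial>lborel)
      = (\<integral>\<^sup>+x. ennreal (1 / Gamma \<theta>) * ennreal (if 0 < x then x powr (\<theta> - 1) * exp (- x) else 0) \<partial>lborel)"
    using Gamma_real_pos[OF assms] by (intro nn_integral_cong) (simp add: gamma_density_def flip: ennreal_mult'')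
  also have "\<dots> = ennreal (1 / Gamma \<theta>) * ennreal (Gamma \<theta>)"
    by (subst nn_integral_cmult) (simp_all add: nn_integral_powr_exp[OF assms])
  also have "\<dots> = 1"
    using Gamma_real_pos[OF assms] by (simp flip: ennreal_mult'')
  finally show "emeasure (gamma_law \<theta>) (space (gamma_law \<theta>)) = 1"
    by (simp add: gamma_law_def emeasure_density)
qed

text \<open>The substitution \<open>y = x * t\<close> separates \<open>x\<close> from
  \<open>t\<close> and leaves a Beta integral, whose value
  \<open>Gamma a * Gamma b / Gamma (a + b)\<close> exchanges the normalizing constants.\<close>

lemma gamma_law_convolution:
  assumes a: "0 < a" and b: "0 < b"
  shows "(gamma_law a \<star> gamma_law b) = gamma_law (a + b)"
proof -
  have fin: "finite_measure (gamma_law a)" "finite_measure (gamma_law b)"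
    using prob_space_gamma_law a b by (auto simp: prob_space.finite_measure)
  have G: "0 < Gamma a" "0 < Gamma b" "0 < Gamma (a + b)" using a b by (auto intro: Gamma_real_pos)
  have "(\<integral>\<^sup>+y. ennreal (gamma_density a (x - y)) * ennreal (gamma_density b y) \<partial>lborel) = ennreal (gamma_density (a + b) x)" for x
  proof (cases "0 < x")
    case False
    then have *: "ennreal (gamma_density a (x - y)) * ennreal (gamma_density b y) = 0" for y
      by (auto simp: gamma_density_def)
    show ?thesis unfolding * using False by (simp add: gamma_density_def)
  next
    case True
    let ?B = "\<lambda>t. if t \<in> {0..1} then t powr (b - 1) * (1 - t) powr (a - 1) else 0"
    let ?c = "x powr (a + b - 2) * exp (- x) / (Gamma a * Gamma b)"
    have "(\<integral>\<^sup>+y. ennreal (gamma_density a (x - y)) * ennreal (gamma_density b y) \<partial>lborel)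
       = ennreal \<bar>x\<bar> * (\<integral>\<^sup>+t. ennreal (gamma_density a (x - (0 + x * t))) * ennreal (gamma_density b (0 + x * t)) \<partial>lborel)"
      by (rule nn_integral_real_affine) (use True in auto)
    also have "(\<integral>\<^sup>+t. ennreal (gamma_density a (x - (0 + x * t))) * ennreal (gamma_density b (0 + x * t)) \<partial>lborel)
       = (\<integral>\<^sup>+t. ennreal ?c * ennreal (?B t) \<partial>lborel)"
    proof (rule nn_integral_cong_AE)
      have "AE t in lborel. t \<noteq> 0 \<and> t \<noteq> (1::real)"
        using AE_lborel_singleton[of "0::real"] AE_lborel_singleton[of "1::real"] by auto
      then show "AE t in lborel. ennreal (gamma_density a (x - (0 + x * t))) * ennreal (gamma_density b (0 + x * t)) = ennreal ?c * ennreal (?B t)"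
      proof eventually_elim
        fix t :: real assume t: "t \<noteq> 0 \<and> t \<noteq> 1"
        have x1: "x - x * t = x * (1 - t)" and x2: "0 + x * t = x * t" by (simp_all add: algebra_simps)
        show "ennreal (gamma_density a (x - (0 + x * t))) * ennreal (gamma_density b (0 + x * t)) = ennreal ?c * ennreal (?B t)"
        proof (cases "0 < t \<and> t < 1")
          case False
          then have "\<not> (0 < x * (1 - t) \<and> 0 < x * t)" using True by (auto simp: zero_less_mult_iff)
          then have "gamma_density a (x * (1 - t)) = 0 \<or> gamma_density b (x * t) = 0"
            unfolding gamma_density_def by presburger
          moreover have "?B t = 0" using False t by auto
          ultimately show ?thesis unfolding x2 x1 by (elim disjE) (simp_all only: ennreal_0 mult_zero_left mult_zero_right)
        next
          case tt: True
          have pos: "0 < x * (1 - t)" "0 < x * t" using True tt by auto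
          have "gamma_density a (x - (0 + x * t)) * gamma_density b (0 + x * t)
             = (x * (1 - t)) powr (a - 1) * exp (- (x * (1 - t))) / Gamma a * ((x * t) powr (b - 1) * exp (- (x * t)) / Gamma b)"
            unfolding x2 x1 using pos by (simp add: gamma_density_def)
          also have "\<dots> = (x powr (a - 1) * x powr (b - 1)) * (exp (- (x * (1 - t))) * exp (- (x * t))) / (Gamma a * Gamma b) * ?B t"
          proof -
            have "(x * (1 - t)) powr (a - 1) = x powr (a - 1) * (1 - t) powr (a - 1)" "(x * t) powr (b - 1) = x powr (b - 1) * t powr (b - 1)"
              "?B t = t powr (b - 1) * (1 - t) powr (a - 1)"
              using True tt by (auto intro!: powr_mult)
            moreover have "A * B * E / G * (C * D * F / H) = A * C * (E * F) / (G * H) * (D * B)" for A B C D E F G H :: real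
              by simp
            ultimately show ?thesis by (simp only:)
          qed
          also have "x powr (a - 1) * x powr (b - 1) = x powr (a + b - 2)" by (simp flip: powr_add)
          also have "exp (- (x * (1 - t))) * exp (- (x * t)) = exp (- (x * (1 - t)) + - (x * t))" by (rule exp_add[symmetric])
          also have "- (x * (1 - t)) + - (x * t) = - x" by (simp add: algebra_simps)
          finally have *: "gamma_density a (x - (0 + x * t)) * gamma_density b (0 + x * t) = ?c * ?B t" .
          have "ennreal (gamma_density a (x - (0 + x * t))) * ennreal (gamma_density b (0 + x * t))
              = ennreal (gamma_density a (x - (0 + x * t)) * gamma_density b (0 + x * t))"
            by (intro ennreal_mult[symmetric] gamma_density_nonneg a b)
          also have "\<dots> = ennreal ?c * ennreal (?B t)"
            unfolding * using G by (intro ennreal_mult) auto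
          finally show ?thesis .
        qed
      qed
    qed
    also have "\<dots> = ennreal ?c * (\<integral>\<^sup>+t. ennreal (?B t) \<partial>lborel)" by (rule nn_integral_cmult) measurable
    also have "(\<integral>\<^sup>+t. ennreal (?B t) \<partial>lborel) = ennreal (Beta b a)"
      by (rule nn_integral_has_integral_lborel)
         (use has_integral_Beta_real[OF b a] in \<open>simp_all add: has_integral_restrict_UNIV del: atLeastAtMost_iff\<close>)
    also have "ennreal \<bar>x\<bar> * (ennreal ?c * ennreal (Beta b a)) = ennreal (x * (?c * Beta b a))"
    proof -
      have "0 \<le> Beta b a" using G by (auto simp: Beta_def add.commute)
      moreover have "0 \<le> ?c" using G by auto
      ultimately show ?thesis using True by (metis abs_of_pos ennreal_mult less_imp_le mult_nonneg_nonneg)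
    qed
    also have "x * (?c * Beta b a) = gamma_density (a + b) x"
    proof -
      have "x * (?c * Beta b a) = (x * x powr (a + b - 2)) * exp (- x) / Gamma (a + b)"
        using G by (simp add: Beta_def add.commute)
      also have "x * x powr (a + b - 2) = x powr (a + b - 1)"
        using True by (subst powr_mult_base) (auto simp: algebra_simps)
      finally show ?thesis using True by (simp add: gamma_density_def)
    qed
    finally show ?thesis .
  qed
  note * = this
  show ?thesis
    using convolution_density[OF _ _ fin[unfolded gamma_law_def]]
    unfolding gamma_law_def * by simp
qed

section \<open>Entropy of convolution powers\<close>

text \<open>The Dirac mass as zeroth power gives a meaning to the power \<open>n - 1\<close> in the
  entropy bound below also for \<open>n = 1\<close>.\<close>

primrec conv_power :: "real measure \<Rightarrow> nat \<Rightarrow> real measure" where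
  "conv_power Q 0 = return borel 0"
| "conv_power Q (Suc n) = (conv_power Q n \<star> Q)"

lemma sets_conv_power [simp, measurable_cong]: "sets (conv_power Q n) = sets borel"
  by (cases n) auto

lemma prob_space_convolution:
  assumes "prob_space P" "prob_space Q" and [measurable_cong]: "sets P = sets borel" "sets Q = sets borel"
  shows "prob_space (P \<star> Q)"
proof -
  interpret P: prob_space P by fact
  interpret Q: prob_space Q by fact
  interpret PQ: pair_prob_space P Q ..
  show ?thesis unfolding convolution_def by (rule PQ.prob_space_distr) simp
qed

lemma prob_space_conv_power:
  assumes "prob_space Q" "sets Q = sets borel"
  shows "prob_space (conv_power Q n)"
proof (induction n)
  case 0
  show ?case unfolding conv_power.simps by (rule prob_space_return) simp
next
  case (Suc n)
  show ?case unfolding conv_power.simps by (rule prob_space_convolution) (simp_all add: assms Suc)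
qed

lemma return_convolution:
  fixes Q :: "real measure"
  assumes "prob_space Q" and [measurable_cong]: "sets Q = sets borel"
  shows "(return borel 0 \<star> Q) = Q"
proof (rule measure_eqI)
  interpret prob_space Q by fact
  interpret R: prob_space "return borel (0::real)" by (rule prob_space_return) simp
  fix A assume "A \<in> sets (return borel 0 \<star> Q)"
  then have A [measurable]: "A \<in> sets borel" by simp
  have "(\<integral>\<^sup>+x. indicator A x \<partial>(return borel 0 \<star> Q)) = (\<integral>\<^sup>+x. \<integral>\<^sup>+y. indicator A (x + y) \<partial>Q \<partial>return borel 0)"
    by (rule nn_integral_convolution) (auto simp: assms R.finite_measure_axioms finite_measure_axioms)
  also have "\<dots> = (\<integral>\<^sup>+y. indicator A (0 + y) \<partial>Q)" by (rule nn_integral_return) auto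
  finally show "emeasure (return borel 0 \<star> Q) A = emeasure Q A" using assms(2) by simp
qed (use assms in simp)

text \<open>Restricted to positive powers, since the zeroth one is a Dirac mass, which has no
  density.\<close>

lemma conv_power_gamma_law:
  assumes "0 < \<epsilon>"
  shows "conv_power (gamma_law \<epsilon>) (Suc n) = gamma_law (real (Suc n) * \<epsilon>)"
proof (induction n)
  case 0
  then show ?case using assms by (simp add: return_convolution prob_space_gamma_law)
next
  case (Suc n)
  have "conv_power (gamma_law \<epsilon>) (Suc (Suc n)) = (gamma_law (real (Suc n) * \<epsilon>) \<star> gamma_law \<epsilon>)"
    using Suc by simp
  also have "\<dots> = gamma_law (real (Suc n) * \<epsilon> + \<epsilon>)"
    using assms by (intro gamma_law_convolution) auto
  finally show ?case by (simp add: algebra_simps)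
qed

text \<open>\<open>Ent_le_relative\<close> with the constant \<open>exp r\<close>; the integrand
  there is exactly \<open>exp r * psi (\<phi> u - r)\<close>.\<close>

lemma Ent_exp_le_psi:
  assumes Q: "prob_space Q" and [measurable]: "\<phi> \<in> borel_measurable Q" and b: "\<And>x. \<bar>\<phi> x\<bar> \<le> C"
  shows "ennreal (Ent Q (\<lambda>u. exp (\<phi> u))) \<le> (\<integral>\<^sup>+u. ennreal (exp r * psi (\<phi> u - r)) \<partial>Q)"
proof -
  interpret prob_space Q by fact
  have pb: "positive_bounded (\<lambda>u. exp (\<phi> u))" using b by (rule positive_bounded_exp)
  have eq: "exp (\<phi> u) * ln (exp (\<phi> u)) - exp (\<phi> u) * ln (exp r) - exp (\<phi> u) + exp r = exp r * psi (\<phi> u - r)" for u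
  proof -
    have "exp r * exp (\<phi> u - r) = exp (\<phi> u)" by (simp flip: exp_add)
    moreover have "exp r * psi (\<phi> u - r) = (\<phi> u - r) * (exp r * exp (\<phi> u - r)) - exp r * exp (\<phi> u - r) + exp r"
      by (simp add: psi_def algebra_simps)
    ultimately show ?thesis by (simp add: algebra_simps)
  qed
  have "integrable Q (\<lambda>u. exp (\<phi> u) * ln (exp (\<phi> u)) - exp (\<phi> u) * ln (exp r) - exp (\<phi> u) + exp r)"
    by (intro Bochner_Integration.integrable_diff Bochner_Integration.integrable_add integrable_mult_ln
        integrable_mult_left integrable_positive_bounded pb positive_bounded_exp[of "\<lambda>_. r" "\<bar>r\<bar>"]) auto
  then have i: "integrable Q (\<lambda>u. exp r * psi (\<phi> u - r))" by (simp only: eq)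
  have "Ent Q (\<lambda>u. exp (\<phi> u)) \<le> (\<integral>u. exp r * psi (\<phi> u - r) \<partial>Q)"
    using Ent_le_relative[OF _ pb, of "exp r"] by (simp only: eq) simp
  then have "ennreal (Ent Q (\<lambda>u. exp (\<phi> u))) \<le> ennreal (\<integral>u. exp r * psi (\<phi> u - r) \<partial>Q)" by (rule ennreal_leI)
  also have "\<dots> \<le> (\<integral>\<^sup>+u. ennreal (exp r * psi (\<phi> u - r)) \<partial>Q)"
    by (rule ennreal_integral_le_nn_integral[OF i])
  finally show ?thesis .
qed

text \<open>Each of the \<open>n\<close> summands is compared with its own value zero, given the sum
  \<open>s\<close> of the others, which has the law of the power \<open>n - 1\<close>. By
  exchangeability all summands contribute the same amount.\<close>

lemma Ent_conv_power_le:
  fixes Q :: "real measure"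
  assumes Q: "prob_space Q" and [measurable_cong]: "sets Q = sets borel"
    and "\<phi> \<in> borel_measurable borel" and "\<And>x. \<bar>\<phi> x\<bar> \<le> C"
  shows "ennreal (Ent (conv_power Q n) (\<lambda>u. exp (\<phi> u)))
     \<le> of_nat n * (\<integral>\<^sup>+s. (\<integral>\<^sup>+u. ennreal (exp (\<phi> s) * psi (\<phi> (s + u) - \<phi> s)) \<partial>Q) \<partial>conv_power Q (n - 1))"
  using assms(3,4)
proof (induction n arbitrary: \<phi>)
  case 0
  then show ?case by (simp add: Ent_def integral_return)
next
  case (Suc n)
  note [measurable] = Suc.prems(1)
  interpret Q: prob_space Q by fact
  interpret P: prob_space "conv_power Q n" by (rule prob_space_conv_power) fact+
  interpret P': prob_space "conv_power Q (n - 1)" by (rule prob_space_conv_power) fact+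
  define A where "A s = (\<integral>\<^sup>+u. ennreal (exp (\<phi> s) * psi (\<phi> (s + u) - \<phi> s)) \<partial>Q)" for s
  have [measurable]: "A \<in> borel_measurable borel" unfolding A_def by measurable
  have "ennreal (Ent (conv_power Q (Suc n)) (\<lambda>u. exp (\<phi> u)))
     \<le> (\<integral>\<^sup>+x. ennreal (Ent Q (\<lambda>y. exp (\<phi> (x + y)))) \<partial>conv_power Q n)
     + (\<integral>\<^sup>+y. ennreal (Ent (conv_power Q n) (\<lambda>x. exp (\<phi> (x + y)))) \<partial>Q)"
    unfolding conv_power.simps
    by (rule Ent_convolution_le[OF P.prob_space_axioms Q _ assms(2)])
       (auto intro!: positive_bounded_exp Suc.prems(2))
  also have "\<dots> \<le> (\<integral>\<^sup>+s. A s \<partial>conv_power Q n) + (\<integral>\<^sup>+y. of_nat n * (\<integral>\<^sup>+s. A (y + s) \<partial>conv_power Q (n - 1)) \<partial>Q)"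
  \<comment> \<open>The last summand is compared with zero, that is, with the reference value
    \<open>\<phi> x\<close>; the induction hypothesis handles the others, for the test function
    shifted by the last summand.\<close>
  proof (intro add_mono nn_integral_mono)
    fix x
    show "ennreal (Ent Q (\<lambda>y. exp (\<phi> (x + y)))) \<le> A x"
      unfolding A_def by (rule Ent_exp_le_psi[OF Q, of "\<lambda>y. \<phi> (x + y)" C]) (auto simp: Suc.prems(2))
    show "ennreal (Ent (conv_power Q n) (\<lambda>y. exp (\<phi> (y + x)))) \<le> of_nat n * (\<integral>\<^sup>+s. A (x + s) \<partial>conv_power Q (n - 1))"
      using Suc.IH[of "\<lambda>y. \<phi> (y + x)"] Suc.prems(2) unfolding A_def by (simp add: ac_simps)
  qed
  also have "(\<integral>\<^sup>+y. of_nat n * (\<integral>\<^sup>+s. A (y + s) \<partial>conv_power Q (n - 1)) \<partial>Q) = of_nat n * (\<integral>\<^sup>+s. A s \<partial>conv_power Q n)"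
  \<comment> \<open>For \<open>n = 0\<close> the factor \<open>of_nat n\<close> removes the term, so
    the truncated \<open>n - 1\<close> is harmless; otherwise the free summand completes the power
    \<open>n - 1\<close> to the power \<open>n\<close>.\<close>
  proof (cases n)
    case (Suc m)
    interpret Pm: prob_space "conv_power Q m" by (rule prob_space_conv_power) fact+
    have "(\<integral>\<^sup>+y. (\<integral>\<^sup>+s. A (y + s) \<partial>conv_power Q m) \<partial>Q) = (\<integral>\<^sup>+s. A s \<partial>(Q \<star> conv_power Q m))"
      by (rule nn_integral_convolution[symmetric])
         (use Suc P'.finite_measure_axioms in \<open>auto simp: assms(2) Q.finite_measure_axioms\<close>)
    also have "(Q \<star> conv_power Q m) = (conv_power Q m \<star> Q)"
      by (rule convolution_commutative)
         (use Suc P'.finite_measure_axioms in \<open>auto simp: assms(2) Q.finite_measure_axioms\<close>)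
    finally have *: "(\<integral>\<^sup>+y. (\<integral>\<^sup>+s. A (y + s) \<partial>conv_power Q m) \<partial>Q) = (\<integral>\<^sup>+s. A s \<partial>(conv_power Q m \<star> Q))" .
    have "(\<lambda>y. \<integral>\<^sup>+s. A (y + s) \<partial>conv_power Q m) \<in> borel_measurable Q" by measurable
    from nn_integral_cmult[OF this] show ?thesis unfolding Suc conv_power.simps *[symmetric] by simp
  next
    case 0
    show ?thesis unfolding 0 by simp
  qed
  also have "(\<integral>\<^sup>+s. A s \<partial>conv_power Q n) + of_nat n * (\<integral>\<^sup>+s. A s \<partial>conv_power Q n) = of_nat (Suc n) * (\<integral>\<^sup>+s. A s \<partial>conv_power Q n)"
    by (simp add: distrib_right)
  finally show ?case unfolding A_def diff_Suc_1 .
qed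

text \<open>The Levy density of \<open>c\<close> times a gamma variable with parameter
  \<open>1/2\<close>. Jumps have the sign of \<open>c\<close>, and \<open>c = 0\<close> gives the
  zero density.\<close>

definition gamma_jump :: "real \<Rightarrow> real \<Rightarrow> ennreal" where
  "gamma_jump c v = ennreal (if 0 < c * v then exp (- v / c) / (2 * \<bar>v\<bar>) else 0)"

lemma borel_measurable_gamma_jump [measurable]: "gamma_jump c \<in> borel_measurable borel"
  unfolding gamma_jump_def by measurable

text \<open>Substituting \<open>v = c * u\<close> brings every scale, of either sign, to the single
  density \<open>exp (- u) / (2 * u)\<close> on the positive half line.\<close>

lemma nn_integral_gamma_jump:
  assumes [measurable]: "F \<in> borel_measurable borel" and c: "c \<noteq> 0"
  shows "(\<integral>\<^sup>+v. F v * gamma_jump c v \<partial>lborel)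
    = (\<integral>\<^sup>+u. F (c * u) * ennreal (if 0 < u then exp (- u) / (2 * u) else 0) \<partial>lborel)"
proof -
  have "(\<integral>\<^sup>+v. F v * gamma_jump c v \<partial>lborel)
    = ennreal \<bar>c\<bar> * (\<integral>\<^sup>+u. F (0 + c * u) * gamma_jump c (0 + c * u) \<partial>lborel)"
    by (rule nn_integral_real_affine) (use c in auto)
  also have "\<dots> = (\<integral>\<^sup>+u. ennreal \<bar>c\<bar> * (F (0 + c * u) * gamma_jump c (0 + c * u)) \<partial>lborel)"
    by (rule nn_integral_cmult[symmetric]) measurable
  also have "\<dots> = (\<integral>\<^sup>+u. F (c * u) * ennreal (if 0 < u then exp (- u) / (2 * u) else 0) \<partial>lborel)"
  proof (rule nn_integral_cong)
    fix u
    have "0 < c * c" using c not_real_square_gt_zero by blast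
    then have iff: "0 < c * (c * u) \<longleftrightarrow> 0 < u"
      unfolding mult.assoc[symmetric] zero_less_mult_iff[of "c * c"] by auto
    have "ennreal \<bar>c\<bar> * gamma_jump c (c * u) = ennreal (\<bar>c\<bar> * (if 0 < u then exp (- u) / (2 * \<bar>c * u\<bar>) else 0))"
      unfolding gamma_jump_def iff using c by (simp add: ennreal_mult)
    also have "\<bar>c\<bar> * (if 0 < u then exp (- u) / (2 * \<bar>c * u\<bar>) else 0) = (if 0 < u then exp (- u) / (2 * u) else 0)"
      using c by (simp add: abs_mult)
    finally have eq: "ennreal \<bar>c\<bar> * gamma_jump c (c * u) = ennreal (if 0 < u then exp (- u) / (2 * u) else 0)" .
    show "ennreal \<bar>c\<bar> * (F (0 + c * u) * gamma_jump c (0 + c * u))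
      = F (c * u) * ennreal (if 0 < u then exp (- u) / (2 * u) else 0)"
      unfolding add_0 mult.left_commute[of "ennreal \<bar>c\<bar>"] eq ..
  qed
  finally show ?thesis .
qed

lemma inverse_Gamma_bounded:
  assumes "x \<longlonglongrightarrow> y" "0 < y"
  obtains B where "\<And>n. \<bar>inverse (Gamma (x n))\<bar> \<le> B" "0 \<le> (B::real)" "(\<lambda>n. inverse (Gamma (x n))) \<longlonglongrightarrow> inverse (Gamma y)"
proof -
  have "y \<notin> \<int>\<^sub>\<le>\<^sub>0" using assms(2) by (auto elim!: nonpos_Ints_cases)
  then have l: "(\<lambda>n. inverse (Gamma (x n))) \<longlonglongrightarrow> inverse (Gamma y)"
    using Gamma_real_pos[OF assms(2)] by (intro tendsto_intros assms(1)) auto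
  then have "Bseq (\<lambda>n. inverse (Gamma (x n)))" by (intro convergent_imp_Bseq convergentI)
  then obtain B where "B > 0" "\<And>n. norm (inverse (Gamma (x n))) \<le> B" by (auto elim: BseqE)
  then show ?thesis using that[of B] l by auto
qed

text \<open>An envelope that is uniform in the exponent \<open>e\<close>: below 1 the smaller
  exponent dominates, above 1 the larger one.\<close>

lemma powr_le_powr_add:
  fixes u :: real
  assumes "0 < u" "p \<le> e" "e \<le> q"
  shows "u powr e \<le> u powr p + u powr q"
proof (cases "u < 1")
  case True
  then have "u powr e \<le> u powr p" using assms by (intro powr_mono') auto
  then show ?thesis by (simp add: add_increasing2)
next
  case False
  then have "u powr e \<le> u powr q" using assms by (intro powr_mono) auto
  then show ?thesis by (simp add: add_increasing)
qed

lemma nn_integral_powr_add_exp_finite: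
  assumes "0 < p" "0 < q" "0 \<le> B"
  shows "(\<integral>\<^sup>+x. ennreal (if 0 < x then B * (x powr (p - 1) + x powr (q - 1)) * exp (- x) else 0) \<partial>lborel) < \<infinity>"
proof -
  let ?f = "\<lambda>\<theta> x. if 0 < x then x powr (\<theta> - 1) * exp (- x) else (0::real)"
  have "(\<integral>\<^sup>+x. ennreal (if 0 < x then B * (x powr (p - 1) + x powr (q - 1)) * exp (- x) else 0) \<partial>lborel)
     = (\<integral>\<^sup>+x. ennreal B * (ennreal (?f p x) + ennreal (?f q x)) \<partial>lborel)"
    using assms(3) by (intro nn_integral_cong) (auto simp: algebra_simps simp flip: ennreal_plus ennreal_mult)
  also have "\<dots> = ennreal B * (ennreal (Gamma p) + ennreal (Gamma q))"
    using assms by (simp add: nn_integral_cmult nn_integral_add nn_integral_powr_exp)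
  finally show ?thesis by (simp add: ennreal_mult_less_top)
qed

text \<open>The law splits into \<open>N\<close> independent copies of the gamma law with parameter \<open>1 / (2 * N)\<close>,
  and \<open>N\<close> times the density of the latter converges to the jump density.\<close>

lemma modified_log_sobolev_gamma: "modified_log_sobolev (gamma_law (1 / 2)) (gamma_jump 1)"
  unfolding modified_log_sobolev_def
proof safe
  fix \<phi> assume \<phi>: "bounded_lipschitz \<phi>"
  obtain C L where C: "\<And>x. \<bar>\<phi> x\<bar> \<le> C" "0 < C" and [measurable]: "\<phi> \<in> borel_measurable borel"
    by (rule bounded_lipschitzE[OF \<phi>]) blast
  obtain K where K: "0 \<le> K" "\<And>x v. psi (\<phi> (x + v) - \<phi> x) \<le> K * v\<^sup>2"
    by (rule psi_increment_le[OF \<phi>]) blast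
  \<comment> \<open>The number of pieces is \<open>n + 2\<close>, so that at least one piece remains
    after one is removed and the remaining parameter \<open>1/2 - \<epsilon> n\<close> stays above
    \<open>1/4\<close>.\<close>
  define \<epsilon> where "\<epsilon> n = 1 / (2 * real (n + 2))" for n :: nat
  have \<epsilon>: "0 < \<epsilon> n" "\<epsilon> n \<le> 1 / 4" for n by (auto simp: \<epsilon>_def field_simps)
  have "(\<lambda>n. 1 / 2 * inverse (real (Suc (Suc n)))) \<longlonglongrightarrow> 0"
    by (intro tendsto_mult_right_zero LIMSEQ_Suc[OF LIMSEQ_inverse_real_of_nat])
  then have lim: "\<epsilon> \<longlonglongrightarrow> 0" unfolding \<epsilon>_def by (simp add: field_simps)
  \<comment> \<open>This is \<open>n + 2\<close> times the density of one piece. Since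
    \<open>n + 2 = 1 / (2 * \<epsilon> n)\<close>, the factor turns
    \<open>Gamma (\<epsilon> n)\<close>, which blows up, into
    \<open>Gamma (1 + \<epsilon> n)\<close>, which tends to 1.\<close>
  define J where "J n u = (if 0 < u then u powr (\<epsilon> n - 1) * exp (- u) * inverse (Gamma (1 + \<epsilon> n)) / 2 else 0)" for n u
  have J: "real (n + 2) * gamma_density (\<epsilon> n) u = J n u" for n u
  proof -
    have "\<epsilon> n \<notin> \<int>\<^sub>\<le>\<^sub>0" using \<epsilon>(1)[of n] by (auto elim!: nonpos_Ints_cases)
    then have "Gamma (1 + \<epsilon> n) = \<epsilon> n * Gamma (\<epsilon> n)" using Gamma_plus1[of "\<epsilon> n"] by (simp add: add.commute)
    moreover have "real (n + 2) = inverse (\<epsilon> n) / 2" by (simp add: \<epsilon>_def)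
    ultimately show ?thesis by (simp only: gamma_density_def J_def divide_inverse inverse_mult_distrib mult_ac if_distrib[of "(*) _"]) simp
  qed
  have [measurable]: "J n \<in> borel_measurable borel" for n unfolding J_def by measurable
  have Jpos: "0 \<le> J n u" for n u using J[of n u] gamma_density_nonneg[OF \<epsilon>(1)[of n], of u] by (metis mult_nonneg_nonneg of_nat_0_le_iff)
  have s1: "(\<lambda>n. 1 + \<epsilon> n) \<longlonglongrightarrow> 1" using tendsto_add[OF tendsto_const lim, of 1] by simp
  obtain B where B: "\<And>n. \<bar>inverse (Gamma (1 + \<epsilon> n))\<bar> \<le> B" "0 \<le> B" "(\<lambda>n. inverse (Gamma (1 + \<epsilon> n))) \<longlonglongrightarrow> inverse (Gamma 1)"
    using inverse_Gamma_bounded[OF s1 zero_less_one] by blast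
  have s2: "(\<lambda>n. 1 / 2 - \<epsilon> n) \<longlonglongrightarrow> 1 / 2" using tendsto_diff[OF tendsto_const lim, of "1 / 2"] by simp
  obtain D where D: "\<And>n. \<bar>inverse (Gamma (1 / 2 - \<epsilon> n))\<bar> \<le> D" "0 \<le> D" "(\<lambda>n. inverse (Gamma (1 / 2 - \<epsilon> n))) \<longlonglongrightarrow> inverse (Gamma (1 / 2))"
    using inverse_Gamma_bounded[OF s2 half_gt_zero[OF zero_less_one]] by blast
  define I where "I n s = (\<integral>\<^sup>+u. ennreal (psi (\<phi> (s + u) - \<phi> s)) * ennreal (J n u) \<partial>lborel)" for n s
  have [measurable]: "I n \<in> borel_measurable borel" for n unfolding I_def by measurable
  \<comment> \<open>The bound \<open>K * u\<^sup>2\<close> on \<open>psi\<close> against the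
    envelope \<open>u powr (-1) + u powr 0\<close> of \<open>u powr (\<epsilon> n - 1)\<close>,
    written with the exponents of the gamma integrals for 2 and 3.\<close>
  let ?w = "\<lambda>u. if 0 < u then K * B * (u powr (2 - 1) + u powr (3 - 1)) * exp (- u) else 0"
  have w: "psi (\<phi> (s + u) - \<phi> s) * J n u \<le> ?w u" for n s u
  proof (cases "0 < u")
    case True
    have i: "inverse (Gamma (1 + \<epsilon> n)) \<le> B" using B(1)[of n] by (rule order_trans[OF abs_ge_self])
    have "0 < Gamma (1 + \<epsilon> n)" using \<epsilon>(1)[of n] by (intro Gamma_real_pos) simp
    then have "J n u \<le> u powr (\<epsilon> n - 1) * exp (- u) * inverse (Gamma (1 + \<epsilon> n))"
      using True by (simp add: J_def)
    also have "\<dots> \<le> (u powr (-1) + u powr 0) * exp (- u) * B"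
      using i \<epsilon>[of n] \<open>0 < Gamma (1 + \<epsilon> n)\<close> by (intro mult_mono powr_le_powr_add True) auto
    finally have "psi (\<phi> (s + u) - \<phi> s) * J n u \<le> (K * u\<^sup>2) * ((u powr (-1) + u powr 0) * exp (- u) * B)"
      using K Jpos[of n u] by (intro mult_mono) auto
    also have "\<dots> = K * B * ((u\<^sup>2 * u powr (-1) + u\<^sup>2 * u powr 0) * exp (- u))" by (simp add: algebra_simps)
    also have "u\<^sup>2 * u powr (-1) = u powr (2 - 1)"
      using True by (simp add: powr_minus power2_eq_square)
    also have "u\<^sup>2 * u powr 0 = u powr (3 - 1)" using True by simp
    also have "K * B * ((u powr (2 - 1) + u powr (3 - 1)) * exp (- u)) = ?w u" using True by simp
    finally show ?thesis .
  qed (simp add: J_def)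
  have wfin: "(\<integral>\<^sup>+u. ennreal (?w u) \<partial>lborel) < \<infinity>"
    by (rule nn_integral_powr_add_exp_finite) (use K B in auto)
  have Ilim: "(\<lambda>n. I n s) \<longlonglongrightarrow> jump_energy (gamma_jump 1) \<phi> s" for s
    unfolding I_def jump_energy_def
  proof (rule nn_integral_dominated_convergence[where w = "\<lambda>u. ennreal (?w u)"])
    show "AE u in lborel. ennreal (psi (\<phi> (s + u) - \<phi> s)) * ennreal (J n u) \<le> ennreal (?w u)" for n
      using w by (intro AE_I2) (simp add: psi_nonneg Jpos ennreal_leI flip: ennreal_mult)
    show "AE u in lborel. (\<lambda>n. ennreal (psi (\<phi> (s + u) - \<phi> s)) * ennreal (J n u))
        \<longlonglongrightarrow> ennreal (psi (\<phi> (s + u) - \<phi> s)) * gamma_jump 1 u"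
    proof (intro AE_I2)
      fix u
      have "(\<lambda>n. J n u) \<longlonglongrightarrow> (if 0 < 1 * u then exp (- u / 1) / (2 * \<bar>u\<bar>) else 0)"
      proof (cases "0 < u")
        case True
        have "(\<lambda>n. u powr (\<epsilon> n - 1) * exp (- u) * inverse (Gamma (1 + \<epsilon> n)) / 2)
           \<longlonglongrightarrow> u powr (0 - 1) * exp (- u) * inverse (Gamma 1) / 2"
          using True by (intro tendsto_intros lim B(3)) auto
        then show ?thesis using True by (simp add: J_def powr_neg_one mult.commute[of u 2])
      qed (simp add: J_def)
      then show "(\<lambda>n. ennreal (psi (\<phi> (s + u) - \<phi> s)) * ennreal (J n u))
        \<longlonglongrightarrow> ennreal (psi (\<phi> (s + u) - \<phi> s)) * gamma_jump 1 u"
        unfolding gamma_jump_def by (intro ennreal_tendsto_cmult tendsto_ennrealI) auto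
    qed
  qed (use wfin in auto)
  have Ile: "I n s \<le> (\<integral>\<^sup>+u. ennreal (?w u) \<partial>lborel)" for n s
    unfolding I_def using w by (intro nn_integral_mono) (simp add: psi_nonneg Jpos ennreal_leI flip: ennreal_mult)
  have Jle: "jump_energy (gamma_jump 1) \<phi> s \<le> (\<integral>\<^sup>+u. ennreal (?w u) \<partial>lborel)" for s
    by (rule LIMSEQ_le_const2[OF Ilim]) (use Ile in auto)
  \<comment> \<open>Envelope for the law of the remaining pieces, whose parameter lies between
    \<open>1/4\<close> and \<open>1/2\<close>.\<close>
  let ?v = "\<lambda>s. if 0 < s then D * (s powr (1 / 4 - 1) + s powr (1 / 2 - 1)) * exp (- s) else 0"
  have v: "gamma_density (1 / 2 - \<epsilon> n) s \<le> ?v s" for n s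
  proof (cases "0 < s")
    case True
    have "gamma_density (1 / 2 - \<epsilon> n) s = inverse (Gamma (1 / 2 - \<epsilon> n)) * s powr (1 / 2 - \<epsilon> n - 1) * exp (- s)"
      using True by (simp add: gamma_density_def field_simps)
    also have "\<dots> \<le> D * (s powr (1 / 4 - 1) + s powr (1 / 2 - 1)) * exp (- s)"
      using order_trans[OF abs_ge_self D(1)[of n]] D(2) \<epsilon>[of n] by (intro mult_mono powr_le_powr_add True) auto
    finally show ?thesis using True by simp
  qed (simp add: gamma_density_def)
  have vfin: "(\<integral>\<^sup>+s. ennreal (?v s) \<partial>lborel) < \<infinity>"
    by (rule nn_integral_powr_add_exp_finite) (use D in auto)
  let ?W = "(\<integral>\<^sup>+u. ennreal (?w u) \<partial>lborel)"
  have "(\<lambda>n. \<integral>\<^sup>+s. ennreal (gamma_density (1 / 2 - \<epsilon> n) s) * (ennreal (exp (\<phi> s)) * I n s) \<partial>lborel)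
     \<longlonglongrightarrow> (\<integral>\<^sup>+s. ennreal (gamma_density (1 / 2) s) * (ennreal (exp (\<phi> s)) * jump_energy (gamma_jump 1) \<phi> s) \<partial>lborel)"
  proof (rule nn_integral_dominated_convergence[where w = "\<lambda>s. ennreal (?v s) * (ennreal (exp C) * ?W)"])
    have ew: "ennreal (exp C) * ?W < \<infinity>" using wfin by (simp add: ennreal_mult_less_top)
    show "AE s in lborel. ennreal (gamma_density (1 / 2 - \<epsilon> n) s) * (ennreal (exp (\<phi> s)) * I n s) \<le> ennreal (?v s) * (ennreal (exp C) * ?W)" for n
      using v Ile C(1) by (intro AE_I2 mult_mono ennreal_leI) (auto simp: abs_le_iff)
    show "(\<integral>\<^sup>+s. ennreal (?v s) * (ennreal (exp C) * ?W) \<partial>lborel) < \<infinity>"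
      using vfin ew by (subst nn_integral_multc) (auto simp: ennreal_mult_less_top)
    show "AE s in lborel. (\<lambda>n. ennreal (gamma_density (1 / 2 - \<epsilon> n) s) * (ennreal (exp (\<phi> s)) * I n s))
      \<longlonglongrightarrow> ennreal (gamma_density (1 / 2) s) * (ennreal (exp (\<phi> s)) * jump_energy (gamma_jump 1) \<phi> s)"
    proof (intro AE_I2 ennreal_mult_tendsto ennreal_tendsto_cmult Ilim)
      fix s
      show "(\<lambda>n. ennreal (gamma_density (1 / 2 - \<epsilon> n) s)) \<longlonglongrightarrow> ennreal (gamma_density (1 / 2) s)"
      proof (intro tendsto_ennrealI, cases "0 < s")
        case True
        have "(\<lambda>n. s powr (1 / 2 - \<epsilon> n - 1) * exp (- s) * inverse (Gamma (1 / 2 - \<epsilon> n)))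
          \<longlonglongrightarrow> s powr (1 / 2 - 0 - 1) * exp (- s) * inverse (Gamma (1 / 2))"
          using True by (intro tendsto_intros lim D(3)) auto
        then show "(\<lambda>n. gamma_density (1 / 2 - \<epsilon> n) s) \<longlonglongrightarrow> gamma_density (1 / 2) s"
        proof -
          have gd: "gamma_density \<theta> s = s powr (\<theta> - 1) * exp (- s) * inverse (Gamma \<theta>)" for \<theta>
            unfolding gamma_density_def using True by (simp only: if_True divide_inverse)
          assume "(\<lambda>n. s powr (1 / 2 - \<epsilon> n - 1) * exp (- s) * inverse (Gamma (1 / 2 - \<epsilon> n)))
          \<longlonglongrightarrow> s powr (1 / 2 - 0 - 1) * exp (- s) * inverse (Gamma (1 / 2))"
          then show ?thesis unfolding gd diff_zero .
        qed
      qed (simp add: gamma_density_def)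
      show "ennreal (exp (\<phi> s)) * I n s < \<infinity>" for n
        using order.strict_trans1[OF Ile wfin] by (simp add: ennreal_mult_less_top)
      show "ennreal (exp (\<phi> s)) * jump_energy (gamma_jump 1) \<phi> s < \<infinity>"
        using order.strict_trans1[OF Jle wfin] by (simp add: ennreal_mult_less_top)
    qed (use order.strict_trans1[OF Ile wfin] order.strict_trans1[OF Jle wfin] in auto)
  qed measurable
  then have "(\<lambda>n. \<integral>\<^sup>+s. ennreal (gamma_density (1 / 2 - \<epsilon> n) s) * (ennreal (exp (\<phi> s)) * I n s) \<partial>lborel)
     \<longlonglongrightarrow> (\<integral>\<^sup>+x. ennreal (exp (\<phi> x)) * jump_energy (gamma_jump 1) \<phi> x \<partial>gamma_law (1 / 2))"
    unfolding gamma_law_def by (subst nn_integral_density) auto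
  moreover have "ennreal (Ent (gamma_law (1 / 2)) (\<lambda>x. exp (\<phi> x)))
     \<le> (\<integral>\<^sup>+s. ennreal (gamma_density (1 / 2 - \<epsilon> n) s) * (ennreal (exp (\<phi> s)) * I n s) \<partial>lborel)" for n
  proof -
    let ?Q = "gamma_law (\<epsilon> n)"
    \<comment> \<open>The \<open>n + 2\<close> pieces add up to parameter \<open>1/2\<close>, and
      the \<open>n + 1\<close> pieces left after removing one add up to
      \<open>1/2 - \<epsilon> n\<close>.\<close>
    have 1: "conv_power ?Q (Suc (Suc n)) = gamma_law (1 / 2)"
      unfolding conv_power_gamma_law[OF \<epsilon>(1)] by (rule arg_cong[of _ _ gamma_law]) (simp add: \<epsilon>_def field_simps)
    have 2: "conv_power ?Q (Suc (Suc n) - 1) = gamma_law (1 / 2 - \<epsilon> n)"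
      using conv_power_gamma_law[OF \<epsilon>(1)[of n], of n]
      unfolding diff_Suc_1 by (rule trans) (rule arg_cong[of _ _ gamma_law], simp add: \<epsilon>_def field_simps)
    have in_eq: "(\<integral>\<^sup>+u. ennreal (exp (\<phi> s) * psi (\<phi> (s + u) - \<phi> s)) \<partial>?Q) * of_nat (Suc (Suc n)) = ennreal (exp (\<phi> s)) * I n s" for s
    proof -
      have "(\<integral>\<^sup>+u. ennreal (exp (\<phi> s) * psi (\<phi> (s + u) - \<phi> s)) \<partial>?Q) * of_nat (Suc (Suc n))
        = (\<integral>\<^sup>+u. ennreal (gamma_density (\<epsilon> n) u) * ennreal (exp (\<phi> s) * psi (\<phi> (s + u) - \<phi> s)) * of_nat (Suc (Suc n)) \<partial>lborel)"
        unfolding gamma_law_def by (subst nn_integral_density, simp, simp, subst nn_integral_multc) auto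
      also have "\<dots> = (\<integral>\<^sup>+u. ennreal (exp (\<phi> s)) * (ennreal (psi (\<phi> (s + u) - \<phi> s)) * ennreal (J n u)) \<partial>lborel)"
      proof (intro nn_integral_cong)
        fix u
        let ?d = "gamma_density (\<epsilon> n) u" and ?p = "psi (\<phi> (s + u) - \<phi> s)" and ?e = "exp (\<phi> s)"
        have d: "0 \<le> ?d" by (rule gamma_density_nonneg[OF \<epsilon>(1)])
        have "ennreal ?d * ennreal (?e * ?p) * of_nat (Suc (Suc n)) = ennreal (?d * (?e * ?p) * real (Suc (Suc n)))"
          using d psi_nonneg by (simp add: ennreal_mult ennreal_of_nat_eq_real_of_nat del: of_nat_Suc)
        also have "?d * (?e * ?p) * real (Suc (Suc n)) = ?e * (?p * J n u)"
          using J[of n u] by (simp add: mult_ac)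
        also have "ennreal \<dots> = ennreal ?e * (ennreal ?p * ennreal (J n u))"
          using psi_nonneg Jpos by (simp add: ennreal_mult)
        finally show "ennreal ?d * ennreal (?e * ?p) * of_nat (Suc (Suc n)) = ennreal ?e * (ennreal ?p * ennreal (J n u))" .
      qed
      also have "\<dots> = ennreal (exp (\<phi> s)) * I n s" unfolding I_def by (rule nn_integral_cmult) measurable
      finally show ?thesis .
    qed
    have "ennreal (Ent (gamma_law (1 / 2)) (\<lambda>x. exp (\<phi> x)))
      \<le> of_nat (Suc (Suc n)) * (\<integral>\<^sup>+s. (\<integral>\<^sup>+u. ennreal (exp (\<phi> s) * psi (\<phi> (s + u) - \<phi> s)) \<partial>?Q) \<partial>gamma_law (1 / 2 - \<epsilon> n))"
      using Ent_conv_power_le[OF prob_space_gamma_law[OF \<epsilon>(1)[of n]] sets_gamma_law, where \<phi> = \<phi> and C = C and n = "Suc (Suc n)"] C(1)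
      unfolding 1 2 by simp
    also have "\<dots> = (\<integral>\<^sup>+s. (\<integral>\<^sup>+u. ennreal (exp (\<phi> s) * psi (\<phi> (s + u) - \<phi> s)) \<partial>?Q) * of_nat (Suc (Suc n)) \<partial>gamma_law (1 / 2 - \<epsilon> n))"
      using prob_space_gamma_law[OF \<epsilon>(1)[of n]] by (subst nn_integral_multc) (auto simp: mult.commute intro!: sigma_finite_measure.borel_measurable_nn_integral prob_space_imp_sigma_finite)
    also have "\<dots> = (\<integral>\<^sup>+s. ennreal (gamma_density (1 / 2 - \<epsilon> n) s) * (ennreal (exp (\<phi> s)) * I n s) \<partial>lborel)"
      unfolding in_eq unfolding gamma_law_def[of "1 / 2 - \<epsilon> n"] by (rule nn_integral_density) measurable
    finally show ?thesis .
  qed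
  ultimately show "ennreal (Ent (gamma_law (1 / 2)) (\<lambda>x. exp (\<phi> x)))
     \<le> (\<integral>\<^sup>+x. ennreal (exp (\<phi> x)) * jump_energy (gamma_jump 1) \<phi> x \<partial>gamma_law (1 / 2))"
    by - (rule LIMSEQ_le_const, assumption, blast)
qed

section \<open>Square integrable functions and characteristic functions\<close>

lemma square_integrable_mult:
  assumes "square_integrable M f" "square_integrable M g"
  shows "integrable M (\<lambda>x. f x * g x)"
proof (rule Bochner_Integration.integrable_bound[where f = "\<lambda>x. (f x)\<^sup>2 + (g x)\<^sup>2"])
  show "integrable M (\<lambda>x. (f x)\<^sup>2 + (g x)\<^sup>2)" "(\<lambda>x. f x * g x) \<in> borel_measurable M"
    using assms by (auto simp: square_integrable_def)
  have "\<bar>f x * g x\<bar> \<le> (f x)\<^sup>2 + (g x)\<^sup>2" for x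
  proof -
    have "2 * (\<bar>f x\<bar> * \<bar>g x\<bar>) \<le> (f x)\<^sup>2 + (g x)\<^sup>2"
      using sum_squares_bound[of "\<bar>f x\<bar>" "\<bar>g x\<bar>"] by (simp add: mult.assoc)
    moreover have "0 \<le> \<bar>f x\<bar> * \<bar>g x\<bar>" by simp
    ultimately show ?thesis unfolding abs_mult by linarith
  qed
  then show "AE x in M. norm (f x * g x) \<le> norm ((f x)\<^sup>2 + (g x)\<^sup>2)" by simp
qed

lemma square_integrable_add:
  assumes "square_integrable M f" "square_integrable M g"
  shows "square_integrable M (\<lambda>x. f x + g x)"
proof -
  have "(\<lambda>x. (f x + g x)\<^sup>2) = (\<lambda>x. (f x)\<^sup>2 + (g x)\<^sup>2 + 2 * (f x * g x))"
    by (simp add: fun_eq_iff power2_eq_square algebra_simps)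
  then show ?thesis
    using assms square_integrable_mult[OF assms] by (auto simp: square_integrable_def)
qed

lemma square_integrable_cmult:
  "square_integrable M f \<Longrightarrow> square_integrable M (\<lambda>x. c * f x)"
  by (auto simp: square_integrable_def power_mult_distrib)

lemma square_integrable_diff:
  "square_integrable M f \<Longrightarrow> square_integrable M g \<Longrightarrow> square_integrable M (\<lambda>x. f x - g x)"
  using square_integrable_add[of M f "\<lambda>x. -1 * g x"] square_integrable_cmult[of M g "-1"] by simp

lemma L2_inner_self: "L2_inner M f f = (\<integral>x. (f x)\<^sup>2 \<partial>M)"
  by (simp add: L2_inner_def power2_eq_square)

lemma L2_norm_nonneg [simp]: "0 \<le> L2_norm M f"
  by (simp add: L2_norm_def L2_inner_self)

lemma L2_norm_square: "(L2_norm M f)\<^sup>2 = (\<integral>x. (f x)\<^sup>2 \<partial>M)"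
  by (simp add: L2_norm_def L2_inner_self)

lemma L2_Cauchy_Schwarz:
  assumes f: "square_integrable M f" and g: "square_integrable M g"
  shows "\<bar>L2_inner M f g\<bar> \<le> L2_norm M f * L2_norm M g"
proof -
  let ?a = "L2_inner M f f" and ?b = "L2_inner M f g" and ?c = "L2_inner M g g"
  have i: "integrable M (\<lambda>x. f x * f x)" "integrable M (\<lambda>x. f x * g x)" "integrable M (\<lambda>x. g x * g x)"
    using assms by (auto intro: square_integrable_mult)
  have q: "0 \<le> s\<^sup>2 * ?a - 2 * s * t * ?b + t\<^sup>2 * ?c" for s t
  proof -
    have "0 \<le> (\<integral>x. (s * f x - t * g x)\<^sup>2 \<partial>M)" by simp
    also have "(\<lambda>x. (s * f x - t * g x)\<^sup>2) = (\<lambda>x. s\<^sup>2 * (f x * f x) - 2 * s * t * (f x * g x) + t\<^sup>2 * (g x * g x))"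
      by (simp add: fun_eq_iff power2_eq_square algebra_simps)
    finally show ?thesis using i by (simp add: L2_inner_def)
  qed
  have nn: "0 \<le> ?a" "0 \<le> ?c" by (simp_all add: L2_inner_self)
  have "?b\<^sup>2 \<le> ?a * ?c"
  \<comment> \<open>If \<open>?c = 0\<close>, the quadratic form is affine in \<open>t\<close> at
    \<open>s = 1\<close>, and the chosen \<open>t\<close> makes it \<open>-1\<close>. Otherwise
    \<open>s = ?c\<close> and \<open>t = ?b\<close> give \<open>?c\<close> times the
    discriminant.\<close>
  proof (cases "?c = 0")
    case True
    have "?b = 0"
    proof (rule ccontr)
      assume "?b \<noteq> 0"
      with q[of 1 "(?a + 1) / (2 * ?b)"] True show False by (simp add: field_simps)
    qed
    then show ?thesis using True by simp
  next
    case False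
    with nn have c: "0 < ?c" by simp
    have "0 \<le> ?c\<^sup>2 * ?a - 2 * ?c * ?b * ?b + ?b\<^sup>2 * ?c" by (rule q)
    also have "\<dots> = ?c * (?a * ?c - ?b\<^sup>2)" by (simp add: power2_eq_square algebra_simps)
    finally show ?thesis using c by (simp add: zero_le_mult_iff)
  qed
  then have "sqrt (?b\<^sup>2) \<le> sqrt (?a * ?c)" by (rule real_sqrt_le_mono)
  then show ?thesis by (simp add: L2_norm_def real_sqrt_mult)
qed

lemma L2_inner_tendsto:
  assumes F: "L2_tendsto M F f" and G: "L2_tendsto M G g"
  shows "(\<lambda>n. L2_inner M (F n) (G n)) \<longlonglongrightarrow> L2_inner M f g"
proof -
  let ?F = "\<lambda>n x. F n x - f x" and ?G = "\<lambda>n x. G n x - g x"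
  have s: "square_integrable M (F n)" "square_integrable M (G n)" "square_integrable M f" "square_integrable M g"
    "square_integrable M (?F n)" "square_integrable M (?G n)" for n
    using F G by (auto simp: L2_tendsto_def intro: square_integrable_diff)
  have l: "(\<lambda>n. L2_norm M (?F n)) \<longlonglongrightarrow> 0" "(\<lambda>n. L2_norm M (?G n)) \<longlonglongrightarrow> 0"
    using F G by (auto simp: L2_tendsto_def)
  have eq: "L2_inner M (F n) (G n) - L2_inner M f g
      = L2_inner M (?F n) (?G n) + L2_inner M (?F n) g + L2_inner M f (?G n)" for n
  proof -
    have "L2_inner M (?F n) (?G n) + L2_inner M (?F n) g + L2_inner M f (?G n)
       = (\<integral>x. ?F n x * ?G n x + ?F n x * g x + f x * ?G n x \<partial>M)"
      unfolding L2_inner_def using s by (simp add: square_integrable_mult)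
    also have "\<dots> = (\<integral>x. F n x * G n x - f x * g x \<partial>M)" by (simp add: algebra_simps)
    also have "\<dots> = L2_inner M (F n) (G n) - L2_inner M f g"
      unfolding L2_inner_def using s by (simp add: square_integrable_mult)
    finally show ?thesis ..
  qed
  have "(\<lambda>n. L2_inner M (F n) (G n) - L2_inner M f g) \<longlonglongrightarrow> 0"
  proof (rule Lim_null_comparison)
    show "\<forall>\<^sub>F n in sequentially. norm (L2_inner M (F n) (G n) - L2_inner M f g)
        \<le> L2_norm M (?F n) * L2_norm M (?G n) + L2_norm M (?F n) * L2_norm M g + L2_norm M f * L2_norm M (?G n)"
    proof (intro always_eventually allI)
      fix n
      show "norm (L2_inner M (F n) (G n) - L2_inner M f g)
        \<le> L2_norm M (?F n) * L2_norm M (?G n) + L2_norm M (?F n) * L2_norm M g + L2_norm M f * L2_norm M (?G n)"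
        using L2_Cauchy_Schwarz[OF s(5)[of n] s(6)[of n]] L2_Cauchy_Schwarz[OF s(5)[of n] s(4)]
          L2_Cauchy_Schwarz[OF s(3) s(6)[of n]] unfolding eq real_norm_def by linarith
    qed
    show "(\<lambda>n. L2_norm M (?F n) * L2_norm M (?G n) + L2_norm M (?F n) * L2_norm M g + L2_norm M f * L2_norm M (?G n)) \<longlonglongrightarrow> 0"
      using l by (auto intro!: tendsto_eq_intros)
  qed
  then show ?thesis by (rule LIM_zero_cancel)
qed

text \<open>Cauchy-Schwarz against the constant function 1, which has norm 1 under a probability
  measure.\<close>

lemma (in prob_space) L2_tendsto_L1:
  assumes "L2_tendsto M F f"
  shows "integrable M (F n)" "integrable M f" "(\<lambda>n. \<integral>x. \<bar>F n x - f x\<bar> \<partial>M) \<longlonglongrightarrow> 0"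
proof -
  have one: "square_integrable M (\<lambda>x. 1)" by (simp add: square_integrable_def)
  have n1: "L2_norm M (\<lambda>x. 1) = 1" by (simp add: L2_norm_def L2_inner_def prob_space)
  have s: "square_integrable M (F n)" "square_integrable M f" "square_integrable M (\<lambda>x. F n x - f x)" for n
    using assms by (auto simp: L2_tendsto_def intro: square_integrable_diff)
  show "integrable M (F n)" "integrable M f"
    using square_integrable_mult[OF s(1) one] square_integrable_mult[OF s(2) one] by simp_all
  show "(\<lambda>n. \<integral>x. \<bar>F n x - f x\<bar> \<partial>M) \<longlonglongrightarrow> 0"
  proof (rule Lim_null_comparison)
    show "(\<lambda>n. L2_norm M (\<lambda>x. F n x - f x)) \<longlonglongrightarrow> 0" using assms by (simp add: L2_tendsto_def)
    have "norm (\<integral>x. \<bar>F n x - f x\<bar> \<partial>M) \<le> L2_norm M (\<lambda>x. F n x - f x)" for n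
    proof -
      have "square_integrable M (\<lambda>x. \<bar>F n x - f x\<bar>)" using s(3)[of n] by (auto simp: square_integrable_def)
      from L2_Cauchy_Schwarz[OF this one] have "\<bar>\<integral>x. \<bar>F n x - f x\<bar> \<partial>M\<bar> \<le> L2_norm M (\<lambda>x. \<bar>F n x - f x\<bar>)"
        unfolding n1 by (simp add: L2_inner_def)
      also have "L2_norm M (\<lambda>x. \<bar>F n x - f x\<bar>) = L2_norm M (\<lambda>x. F n x - f x)"
        unfolding L2_norm_def L2_inner_self by simp
      finally show ?thesis unfolding real_norm_def .
    qed
    then show "\<forall>\<^sub>F n in sequentially. norm (\<integral>x. \<bar>F n x - f x\<bar> \<partial>M) \<le> L2_norm M (\<lambda>x. F n x - f x)"
      by simp
  qed
qed

section \<open>Laws and independence from characteristic functions\<close>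

text \<open>The hypothesis at \<open>s = 0\<close> says that \<open>w\<close> has integral
  \<open>c\<close>. For \<open>c > 0\<close>, \<open>w / c\<close> is a probability density under
  which \<open>W\<close> has the characteristic function of \<open>\<mu>\<close>, and Levy's
  uniqueness theorem applies; for \<open>c = 0\<close> the weight vanishes almost
  everywhere.\<close>

lemma (in prob_space) weighted_law_unique:
  assumes [measurable]: "w \<in> borel_measurable M" "W \<in> borel_measurable M"
    and w: "\<And>\<omega>. 0 \<le> w \<omega>" "\<And>\<omega>. w \<omega> \<le> C"
    and \<mu>: "real_distribution \<mu>"
    and cf: "\<And>s. (CLINT \<omega>|M. complex_of_real (w \<omega>) * iexp (s * W \<omega>)) = complex_of_real c * char \<mu> s"
    and [measurable]: "A \<in> sets borel"
  shows "(\<integral>\<omega>. w \<omega> * indicator A (W \<omega>) \<partial>M) = c * measure \<mu> A"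
proof -
  interpret \<mu>: real_distribution \<mu> by fact
  have iw: "integrable M w" by (rule integrable_bounded[of _ C]) (use w in auto)
  have "complex_of_real (\<integral>\<omega>. w \<omega> \<partial>M) = complex_of_real c"
    using cf[of 0] by (simp add: \<mu>.char_zero)
  then have c: "(\<integral>\<omega>. w \<omega> \<partial>M) = c" by (simp only: of_real_eq_iff)
  show ?thesis
  proof (cases "c = 0")
    case True
    then have "AE \<omega> in M. w \<omega> = 0" using integral_nonneg_eq_0_iff_AE[OF iw] c w by simp
    then have "(\<integral>\<omega>. w \<omega> * indicator A (W \<omega>) \<partial>M) = (\<integral>\<omega>. 0 \<partial>M)" by (intro integral_cong_AE) auto
    then show ?thesis using True by simp
  next
    case False
    moreover have "0 \<le> c" unfolding c[symmetric] using w by simp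
    ultimately have c0: "0 < c" by simp
    let ?D = "density M (\<lambda>\<omega>. ennreal (w \<omega> / c))"
    interpret D: prob_space ?D
    proof
      have "emeasure ?D (space ?D) = (\<integral>\<^sup>+\<omega>. ennreal (w \<omega> / c) \<partial>M)" by (simp add: emeasure_density cong: nn_integral_cong)
      also have "\<dots> = ennreal (\<integral>\<omega>. w \<omega> / c \<partial>M)" by (rule nn_integral_eq_integral) (use iw w c0 in auto)
      also have "\<dots> = 1" using c c0 by simp
      finally show "emeasure ?D (space ?D) = 1" .
    qed
    let ?\<nu> = "distr ?D borel W"
    have \<nu>: "real_distribution ?\<nu>" by (rule D.real_distribution_distr) simp
    have "char ?\<nu> = char \<mu>"
    proof
      fix s
      have "char ?\<nu> s = (CLINT \<omega>|?D. iexp (s * W \<omega>))" by (simp add: char_def integral_distr)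
      also have "\<dots> = (CLINT \<omega>|M. (w \<omega> / c) *\<^sub>R iexp (s * W \<omega>))"
        by (rule integral_density) (use w c0 in auto)
      also have "\<dots> = (CLINT \<omega>|M. complex_of_real (1 / c) * (complex_of_real (w \<omega>) * iexp (s * W \<omega>)))"
        by (simp add: scaleR_conv_of_real field_simps)
      also have "\<dots> = complex_of_real (1 / c) * (CLINT \<omega>|M. complex_of_real (w \<omega>) * iexp (s * W \<omega>))"
        by (rule integral_mult_right_zero)
      also have "\<dots> = char \<mu> s" unfolding cf using c0 by simp
      finally show "char ?\<nu> s = char \<mu> s" .
    qed
    then have "?\<nu> = \<mu>" by (rule Levy_uniqueness[OF \<nu> \<mu>])
    then have "measure \<mu> A = measure ?\<nu> A" by simp
    also have "\<dots> = (\<integral>x. indicator A x \<partial>?\<nu>)" by simp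
    also have "\<dots> = (\<integral>\<omega>. indicator A (W \<omega>) \<partial>?D)" by (rule integral_distr) auto
    also have "\<dots> = (\<integral>\<omega>. (w \<omega> / c) *\<^sub>R indicator A (W \<omega>) \<partial>M)" by (rule integral_density) (use w c0 in auto)
    also have "\<dots> = (\<integral>\<omega>. w \<omega> * indicator A (W \<omega>) \<partial>M) / c" by simp
    finally show ?thesis using c0 by simp
  qed
qed

text \<open>Independence from the joint characteristic function, peeling off one coordinate at a time.
  Multiplying \<open>exp (\<i> Z)\<close> into the weight would make it complex, so the weights
  \<open>R\<close>, \<open>R * (1 + cos Z)\<close> and \<open>R * (1 + sin Z)\<close> are used instead.\<close>

lemma (in prob_space) gaussian_peel:
  fixes W :: "nat \<Rightarrow> 'a \<Rightarrow> real"
  assumes [measurable]: "\<And>k. W k \<in> borel_measurable M"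
    and cf: "\<And>c. (CLINT \<omega>|M. iexp (\<Sum>k<K. c k * W k \<omega>)) = complex_of_real (exp (- (\<Sum>k<K. (c k)\<^sup>2) / 2))"
    and A: "\<And>k. A k \<in> sets borel"
  shows "m \<le> K \<Longrightarrow> (CLINT \<omega>|M. complex_of_real (\<Prod>j<m. indicator (A j) (W j \<omega>)) * iexp (\<Sum>k=m..<K. c k * W k \<omega>))
    = complex_of_real ((\<Prod>j<m. measure std_normal_distribution (A j)) * exp (- (\<Sum>k=m..<K. (c k)\<^sup>2) / 2))"
proof (induction m arbitrary: c)
  case 0
  then show ?case using cf[of c] by (simp add: atLeast0LessThan)
next
  case (Suc m)
  note [measurable] = A
  let ?\<gamma> = "std_normal_distribution"
  define R where "R \<omega> = (\<Prod>j<m. indicator (A j) (W j \<omega>) :: real)" for \<omega>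
  define p where "p = (\<Prod>j<m. measure ?\<gamma> (A j))"
  define Z where "Z \<omega> = (\<Sum>k=Suc m..<K. c k * W k \<omega>)" for \<omega>
  define q where "q = exp (- (\<Sum>k=Suc m..<K. (c k)\<^sup>2) / 2)"
  have [measurable]: "R \<in> borel_measurable M" "Z \<in> borel_measurable M" unfolding R_def Z_def by measurable
  have R01: "0 \<le> R \<omega>" "R \<omega> \<le> 1" for \<omega> unfolding R_def by (auto intro!: prod_nonneg prod_le_1 simp: indicator_def)
  have split: "(\<Sum>k=m..<K. f k) = f m + (\<Sum>k=Suc m..<K. f k)" for f :: "nat \<Rightarrow> real"
    using Suc.prems by (subst sum.atLeast_Suc_lessThan) auto
  \<comment> \<open>The induction hypothesis with coefficient \<open>s\<close> at \<open>m\<close>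
    and \<open>r * c k\<close> beyond. Only \<open>r = 0\<close>, \<open>1\<close> and
    \<open>-1\<close> are used: these are the exponentials of which the cosine and sine weights
    consist.\<close>
  have E: "(CLINT \<omega>|M. complex_of_real (R \<omega>) * iexp (s * W m \<omega> + r * Z \<omega>)) = complex_of_real (p * exp (- s\<^sup>2 / 2) * q')"
    if q': "q' = exp (- (\<Sum>k=Suc m..<K. (r * c k)\<^sup>2) / 2)" for s r q'
  proof -
    define d where "d k = (if k = m then s else r * c k)" for k
    have "(CLINT \<omega>|M. complex_of_real (R \<omega>) * iexp (\<Sum>k=m..<K. d k * W k \<omega>)) = complex_of_real (p * exp (- (\<Sum>k=m..<K. (d k)\<^sup>2) / 2))"
      using Suc.IH[of d] Suc.prems unfolding R_def p_def by simp
    moreover have "(\<Sum>k=m..<K. d k * W k \<omega>) = s * W m \<omega> + r * Z \<omega>" for \<omega>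
      unfolding split Z_def sum_distrib_left by (auto simp: d_def mult.assoc intro!: sum.cong)
    moreover have "(\<Sum>k=m..<K. (d k)\<^sup>2) = s\<^sup>2 + (\<Sum>k=Suc m..<K. (r * c k)\<^sup>2)"
      unfolding split by (auto simp: d_def intro!: sum.cong)
    then have "exp (- (\<Sum>k=m..<K. (d k)\<^sup>2) / 2) = exp (- s\<^sup>2 / 2) * q'"
      unfolding q' by (simp add: exp_add[symmetric] add_divide_distrib)
    ultimately show ?thesis by (simp add: mult.assoc)
  qed
  have E0: "(CLINT \<omega>|M. complex_of_real (R \<omega>) * iexp (s * W m \<omega>)) = complex_of_real (p * exp (- s\<^sup>2 / 2))" for s
    using E[of 1 0 s] by simp
  have Ep: "(CLINT \<omega>|M. complex_of_real (R \<omega>) * iexp (s * W m \<omega> + Z \<omega>)) = complex_of_real (p * exp (- s\<^sup>2 / 2) * q)" for s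
    using E[of q 1 s] by (simp add: q_def)
  have Em: "(CLINT \<omega>|M. complex_of_real (R \<omega>) * iexp (s * W m \<omega> - Z \<omega>)) = complex_of_real (p * exp (- s\<^sup>2 / 2) * q)" for s
    using E[of q "-1" s] by (simp add: q_def)
  have i: "integrable M (\<lambda>\<omega>. complex_of_real (R \<omega>) * iexp (s * W m \<omega> + r * Z \<omega>))" for s r
    by (rule integrable_const_bound[of _ 1]) (use R01 in \<open>auto simp: norm_mult\<close>)
  have i0: "integrable M (\<lambda>\<omega>. complex_of_real (R \<omega>) * iexp (s * W m \<omega>))"
    and ip: "integrable M (\<lambda>\<omega>. complex_of_real (R \<omega>) * iexp (s * W m \<omega> + Z \<omega>))"
    and im: "integrable M (\<lambda>\<omega>. complex_of_real (R \<omega>) * iexp (s * W m \<omega> - Z \<omega>))" for s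
    using i[of s 0] i[of s 1] i[of s "-1"] by simp_all
  \<comment> \<open>Euler's formula writes the weighted integrand through the three exponentials
    whose integrals are known.\<close>
  have cosZ: "complex_of_real (R \<omega> * (1 + cos (Z \<omega>))) * iexp (s * W m \<omega>)
     = complex_of_real (R \<omega>) * iexp (s * W m \<omega>) + (complex_of_real (R \<omega>) * iexp (s * W m \<omega> + Z \<omega>)) / 2
       + (complex_of_real (R \<omega>) * iexp (s * W m \<omega> - Z \<omega>)) / 2" for \<omega> s
    by (simp add: cos_exp_eq cos_of_real[symmetric] exp_add exp_diff exp_minus field_simps)
  have sinZ: "complex_of_real (R \<omega> * (1 + sin (Z \<omega>))) * iexp (s * W m \<omega>)
     = complex_of_real (R \<omega>) * iexp (s * W m \<omega>) + (complex_of_real (R \<omega>) * iexp (s * W m \<omega> + Z \<omega>)) / (2 * \<i>)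
       - (complex_of_real (R \<omega>) * iexp (s * W m \<omega> - Z \<omega>)) / (2 * \<i>)" for \<omega> s
    by (simp add: sin_exp_eq sin_of_real[symmetric] exp_add exp_diff exp_minus field_simps)
  note \<gamma> = real_dist_normal_dist
  have chi: "char ?\<gamma> s = complex_of_real (exp (- s\<^sup>2 / 2))" for s
    by (simp add: char_std_normal_distribution)
  have "(\<integral>\<omega>. R \<omega> * indicator (A m) (W m \<omega>) \<partial>M) = p * measure ?\<gamma> (A m)"
  proof (rule weighted_law_unique[where C = 1 and \<mu> = ?\<gamma>])
    show "(CLINT \<omega>|M. complex_of_real (R \<omega>) * iexp (s * W m \<omega>)) = complex_of_real p * char ?\<gamma> s" for s
      using E0[of s] by (simp only: chi of_real_mult)
  qed (use R01 \<gamma> in auto)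
  moreover have "(\<integral>\<omega>. (R \<omega> * (1 + cos (Z \<omega>))) * indicator (A m) (W m \<omega>) \<partial>M) = (p * (1 + q)) * measure ?\<gamma> (A m)"
  proof (rule weighted_law_unique[where C = 2 and \<mu> = ?\<gamma>])
    have c: "0 \<le> 1 + cos (Z \<omega>)" "1 + cos (Z \<omega>) \<le> 2" for \<omega> using cos_ge_minus_one[of "Z \<omega>"] cos_le_one[of "Z \<omega>"] by linarith+
    show "0 \<le> R \<omega> * (1 + cos (Z \<omega>))" "R \<omega> * (1 + cos (Z \<omega>)) \<le> 2" for \<omega>
      using R01[of \<omega>] c[of \<omega>] mult_mono[of "R \<omega>" 1 "1 + cos (Z \<omega>)" 2] by auto
    show "(CLINT \<omega>|M. complex_of_real (R \<omega> * (1 + cos (Z \<omega>))) * iexp (s * W m \<omega>)) = complex_of_real (p * (1 + q)) * char ?\<gamma> s" for s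
    proof -
      have "(CLINT \<omega>|M. complex_of_real (R \<omega> * (1 + cos (Z \<omega>))) * iexp (s * W m \<omega>))
         = (CLINT \<omega>|M. complex_of_real (R \<omega>) * iexp (s * W m \<omega>))
         + (CLINT \<omega>|M. complex_of_real (R \<omega>) * iexp (s * W m \<omega> + Z \<omega>)) / 2
         + (CLINT \<omega>|M. complex_of_real (R \<omega>) * iexp (s * W m \<omega> - Z \<omega>)) / 2"
        unfolding cosZ using i0[of s] ip[of s] im[of s]
        by (simp only: Bochner_Integration.integral_add Bochner_Integration.integrable_add integrable_divide integral_divide_zero)
      also have "\<dots> = complex_of_real (p * (1 + q)) * char ?\<gamma> s"
        unfolding E0 Ep Em chi by (simp add: algebra_simps)
      finally show ?thesis .
    qed
  qed (use \<gamma> in auto)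
  moreover have "(\<integral>\<omega>. (R \<omega> * (1 + sin (Z \<omega>))) * indicator (A m) (W m \<omega>) \<partial>M) = p * measure ?\<gamma> (A m)"
  proof (rule weighted_law_unique[where C = 2 and \<mu> = ?\<gamma>])
    have c: "0 \<le> 1 + sin (Z \<omega>)" "1 + sin (Z \<omega>) \<le> 2" for \<omega> using sin_ge_minus_one[of "Z \<omega>"] sin_le_one[of "Z \<omega>"] by linarith+
    show "0 \<le> R \<omega> * (1 + sin (Z \<omega>))" "R \<omega> * (1 + sin (Z \<omega>)) \<le> 2" for \<omega>
      using R01[of \<omega>] c[of \<omega>] mult_mono[of "R \<omega>" 1 "1 + sin (Z \<omega>)" 2] by auto
    show "(CLINT \<omega>|M. complex_of_real (R \<omega> * (1 + sin (Z \<omega>))) * iexp (s * W m \<omega>)) = complex_of_real p * char ?\<gamma> s" for s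
    proof -
      have "(CLINT \<omega>|M. complex_of_real (R \<omega> * (1 + sin (Z \<omega>))) * iexp (s * W m \<omega>))
         = (CLINT \<omega>|M. complex_of_real (R \<omega>) * iexp (s * W m \<omega>))
         + (CLINT \<omega>|M. complex_of_real (R \<omega>) * iexp (s * W m \<omega> + Z \<omega>)) / (2 * \<i>)
         - (CLINT \<omega>|M. complex_of_real (R \<omega>) * iexp (s * W m \<omega> - Z \<omega>)) / (2 * \<i>)"
        unfolding sinZ using i0[of s] ip[of s] im[of s]
        by (simp only: Bochner_Integration.integral_add Bochner_Integration.integral_diff Bochner_Integration.integrable_add integrable_divide integral_divide_zero)
      also have "\<dots> = complex_of_real p * char ?\<gamma> s"
        unfolding E0 Ep Em chi by simp
      finally show ?thesis .
    qed
  qed (use \<gamma> in auto)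
  moreover have b: "integrable M (\<lambda>\<omega>. R \<omega> * indicator (A m) (W m \<omega>))" "integrable M (\<lambda>\<omega>. R \<omega> * indicator (A m) (W m \<omega>) * cos (Z \<omega>))"
    "integrable M (\<lambda>\<omega>. R \<omega> * indicator (A m) (W m \<omega>) * sin (Z \<omega>))"
    by (rule integrable_bounded[of _ 1]; use R01 in \<open>auto simp: abs_mult indicator_def intro!: mult_le_one\<close>)+
  \<comment> \<open>Subtracting the identity for the weight \<open>R\<close> from the other two
    isolates the cosine and sine integrals, the real and imaginary parts of the integral in the
    claim.\<close>
  ultimately have c: "(\<integral>\<omega>. R \<omega> * indicator (A m) (W m \<omega>) * cos (Z \<omega>) \<partial>M) = p * q * measure ?\<gamma> (A m)"
    and s: "(\<integral>\<omega>. R \<omega> * indicator (A m) (W m \<omega>) * sin (Z \<omega>) \<partial>M) = 0"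
    by (simp_all add: algebra_simps)
  have "(CLINT \<omega>|M. complex_of_real (\<Prod>j<Suc m. indicator (A j) (W j \<omega>)) * iexp (\<Sum>k=Suc m..<K. c k * W k \<omega>))
     = (CLINT \<omega>|M. complex_of_real (R \<omega> * indicator (A m) (W m \<omega>) * cos (Z \<omega>)) + \<i> * complex_of_real (R \<omega> * indicator (A m) (W m \<omega>) * sin (Z \<omega>)))"
    unfolding Z_def[symmetric] by (intro Bochner_Integration.integral_cong refl)
      (simp add: R_def exp_Euler cos_of_real sin_of_real algebra_simps)
  also have "\<dots> = complex_of_real (p * q * measure ?\<gamma> (A m))"
    using b by (subst Bochner_Integration.integral_add) (simp_all only: integrable_of_real integral_complex_of_real integral_mult_right_zero integrable_mult_right c s, simp_all)
  finally show ?case by (simp add: p_def q_def mult_ac)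
qed

section \<open>Wiener integrals\<close>

lemma common_grid_ex:
  assumes "finite T" "\<And>t. t \<in> T \<Longrightarrow> 0 \<le> (t::real)"
  obtains u :: "nat \<Rightarrow> real" and p where "mono u" "0 \<le> u 0" "T \<subseteq> u ` {..p}"
proof -
  \<comment> \<open>The point 0 is added so that the list is nonempty.\<close>
  define xs where "xs = sorted_list_of_set (insert 0 T)"
  have xs: "set xs = insert 0 T" "sorted xs"
    unfolding xs_def using assms(1) by (simp_all only: set_sorted_list_of_set finite_insert sorted_sorted_list_of_set)
  then have ne: "xs \<noteq> []" by auto
  then have len: "0 < length xs" by simp
  \<comment> \<open>Independence of increments is assumed for infinite monotone sequences; past its
    last point the finite grid is continued as a constant.\<close>
  define u where "u i = xs ! min i (length xs - 1)" for i
  show ?thesis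
  proof
    show "mono u" unfolding u_def
    proof (intro monoI sorted_nth_mono[OF xs(2)])
      fix i j :: nat assume "i \<le> j"
      then show "min i (length xs - 1) \<le> min j (length xs - 1)" by (auto simp: min_def)
      show "min j (length xs - 1) < length xs" using len by linarith
    qed
    have "u 0 \<in> set xs" using ne by (auto simp: u_def)
    then show "0 \<le> u 0" using xs(1) assms(2) by auto
    show "T \<subseteq> u ` {..length xs}"
    proof
      fix t assume "t \<in> T"
      then obtain i where "i < length xs" "xs ! i = t" using xs(1) by (metis in_set_conv_nth insertCI)
      then show "t \<in> u ` {..length xs}" by (intro image_eqI[of _ _ i]) (auto simp: u_def min_def)
    qed
  qed
qed

text \<open>Each interval telescopes over the grid cells inside it. The coefficients
  \<open>d\<close> are chosen before \<open>D\<close>, so the same ones represent the step function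
  (with \<open>D\<close> an indicator) and its integral (with \<open>D\<close> a Brownian
  path).\<close>

lemma step_sum_on_grid:
  fixes u :: "nat \<Rightarrow> real"
  assumes "mono u" "\<And>c s t. (c, s, t) \<in> set ss \<Longrightarrow> s \<le> t \<and> s \<in> u ` {..p} \<and> t \<in> u ` {..p}"
  shows "\<exists>d. \<forall>D :: real \<Rightarrow> real. (\<Sum>(c, s, t)\<leftarrow>ss. c * (D t - D s)) = (\<Sum>i<p. d i * (D (u (Suc i)) - D (u i)))"
  using assms(2)
proof (induction ss)
  case Nil
  show ?case by (rule exI[of _ "\<lambda>_. 0"]) simp
next
  case (Cons x ss)
  obtain c s t where x: "x = (c, s, t)" by (metis surj_pair)
  have "\<exists>d. \<forall>D :: real \<Rightarrow> real. (\<Sum>(c, s, t)\<leftarrow>ss. c * (D t - D s)) = (\<Sum>i<p. d i * (D (u (Suc i)) - D (u i)))"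
  proof (rule Cons.IH)
    fix c s t assume "(c, s, t) \<in> set ss"
    then have "(c, s, t) \<in> set (x # ss)" by simp
    then show "s \<le> t \<and> s \<in> u ` {..p} \<and> t \<in> u ` {..p}" by (rule Cons.prems)
  qed
  then obtain d where d: "\<And>D :: real \<Rightarrow> real. (\<Sum>(c, s, t)\<leftarrow>ss. c * (D t - D s)) = (\<Sum>i<p. d i * (D (u (Suc i)) - D (u i)))"
    by blast
  have "s \<le> t" "s \<in> u ` {..p}" "t \<in> u ` {..p}" using Cons.prems[of c s t] x by auto
  then obtain k l where kl: "s = u k" "t = u l" "k \<le> p" "l \<le> p" by auto
  show ?case
  proof (intro exI allI)
    fix D :: "real \<Rightarrow> real"
    let ?d = "\<lambda>i. if k \<le> i \<and> i < l then c else 0"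
    have "(\<Sum>i<p. ?d i * (D (u (Suc i)) - D (u i))) = (\<Sum>i\<in>{k..<l}. c * (D (u (Suc i)) - D (u i)))"
      using kl by (intro sum.mono_neutral_cong_right) auto
    also have "\<dots> = c * (D t - D s)"
    proof (cases "k \<le> l")
      case True
      then show ?thesis
        using sum_Suc_diff'[of k l "\<lambda>i. D (u i)"] by (simp add: kl flip: sum_distrib_left)
    next
      \<comment> \<open>The grid may repeat points, so the index of \<open>s\<close> can exceed that
        of \<open>t\<close>; monotonicity then forces \<open>s = t\<close>, and both sides
        vanish.\<close>
      case False
      then have "t \<le> s" using assms(1) kl by (auto simp: mono_def)
      with \<open>s \<le> t\<close> False show ?thesis by simp
    qed
    finally show "(\<Sum>(c, s, t)\<leftarrow>x # ss. c * (D t - D s)) = (\<Sum>i<p. (d i + ?d i) * (D (u (Suc i)) - D (u i)))"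
      by (simp add: x d distrib_right sum.distrib)
  qed
qed

text \<open>The cells are disjoint, so mixed terms vanish pointwise and the square acts on the
  coefficients.\<close>

lemma integral_sq_grid_step:
  fixes u :: "nat \<Rightarrow> real"
  assumes "mono u" "0 \<le> u 0"
  shows "(\<integral>x. (\<Sum>i<p. d i * indicator {u i<..u (Suc i)} x)\<^sup>2 \<partial>half_line) = (\<Sum>i<p. (d i)\<^sup>2 * (u (Suc i) - u i))"
proof -
  have le: "u i \<le> u (Suc i)" "0 \<le> u i" for i
    using assms by (auto simp: mono_def intro: order_trans[OF assms(2)])
  have sq: "(\<Sum>i<p. d i * indicator {u i<..u (Suc i)} x)\<^sup>2 = (\<Sum>i<p. (d i)\<^sup>2 * indicator {u i<..u (Suc i)} x)" for x
  proof (cases "\<exists>i<p. x \<in> {u i<..u (Suc i)}")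
    case True
    then obtain i where i: "i < p" "x \<in> {u i<..u (Suc i)}" by blast
    have "x \<notin> {u j<..u (Suc j)}" if "j \<noteq> i" for j
    proof (cases "j < i")
      case True
      then have "u (Suc j) \<le> u i" using assms(1) by (auto simp: mono_def)
      then show ?thesis using i by auto
    next
      case False
      then have "u (Suc i) \<le> u j" using assms(1) that by (auto simp: mono_def)
      then show ?thesis using i by auto
    qed
    then have "indicator {u j<..u (Suc j)} x = (if j = i then 1 else 0 :: real)" for j using i by auto
    moreover have "(\<Sum>j<p. f j * (if j = i then 1 else 0)) = f i" for f :: "nat \<Rightarrow> real"
      using i(1) by (subst sum.remove[of _ i]) (auto intro!: sum.neutral)
    ultimately show ?thesis by simp
  next
    case False
    then have "indicator {u i<..u (Suc i)} x = (0::real)" if "i < p" for i using that by auto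
    then show ?thesis by simp
  qed
  have H: "{0..} \<inter> space lborel \<in> sets (lborel :: real measure)" by simp
  have m: "measure half_line {u i<..u (Suc i)} = u (Suc i) - u i" "emeasure half_line {u i<..u (Suc i)} < \<infinity>"
     "{u i<..u (Suc i)} \<in> sets half_line" for i
  proof -
    have s: "{u i<..u (Suc i)} \<subseteq> {0..}" using le(2)[of i] by auto
    show "measure half_line {u i<..u (Suc i)} = u (Suc i) - u i" "emeasure half_line {u i<..u (Suc i)} < \<infinity>"
      unfolding half_line_def using le(1)[of i] by (simp_all add: measure_restrict_space[OF H s] emeasure_restrict_space[OF H s])
    show "{u i<..u (Suc i)} \<in> sets half_line"
      unfolding half_line_def using s by (auto simp: sets_restrict_space_iff)
  qed
  show ?thesis
    unfolding sq using m by (subst Bochner_Integration.integral_sum) (auto intro!: integrable_mult_right integrable_real_indicator)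
qed

section \<open>Characteristic functions of Wiener integrals\<close>

context standard_brownian_motion
begin

lemma measurable_increment:
  assumes "0 \<le> s" "0 \<le> t"
  shows "(\<lambda>\<omega>. B t \<omega> - B s \<omega>) \<in> borel_measurable M"
  using assms measurable_BM by (intro borel_measurable_diff) auto

lemma char_increment:
  assumes "0 \<le> s" "s \<le> t"
  shows "(CLINT \<omega>|M. iexp (r * (B t \<omega> - B s \<omega>))) = complex_of_real (exp (- (r\<^sup>2 * (t - s)) / 2))"
proof (cases "s = t")
  case True
  then show ?thesis by (simp add: prob_space)
next
  case False
  define \<sigma> where "\<sigma> = sqrt (t - s)"
  have st: "s < t" using assms False by simp
  then have \<sigma>: "0 < \<sigma>" "\<sigma>\<^sup>2 = t - s" by (auto simp: \<sigma>_def)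
  let ?X = "\<lambda>\<omega>. B t \<omega> - B s \<omega>" and ?Y = "\<lambda>\<omega>. (B t \<omega> - B s \<omega> - 0) / \<sigma>"
  have [measurable]: "?X \<in> borel_measurable M" using assms by (intro measurable_increment) auto
  have "distributed M lborel ?Y std_normal_density"
    using BM_normal_increments[OF assms(1) st] normal_standard_normal_convert[OF \<sigma>(1), of ?X 0]
    by (simp add: \<sigma>_def)
  then have "distr M lborel ?Y = std_normal_distribution" by (rule distributed_distr_eq_density)
  then have d: "distr M borel ?Y = std_normal_distribution" by (simp cong: distr_cong)
  have "(CLINT \<omega>|M. iexp (r * ?X \<omega>)) = (CLINT \<omega>|M. iexp ((r * \<sigma>) * ?Y \<omega>))"
    using \<sigma> by simp
  also have "\<dots> = char (distr M borel ?Y) (r * \<sigma>)"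
    unfolding char_def by (subst integral_distr) auto
  also have "\<dots> = complex_of_real (exp (- (r * \<sigma>)\<^sup>2 / 2))"
    unfolding d char_std_normal_distribution ..
  finally show ?thesis by (simp only: power_mult_distrib \<sigma>(2))
qed

text \<open>The intervals may overlap, so independence is not directly available. On a common grid
  the integral is a combination of independent increments, and the exponents of their characteristic
  functions add up to the squared norm of the step function.\<close>

lemma char_step_integral:
  assumes ss: "\<forall>(c, u, v) \<in> set ss. 0 \<le> u \<and> u \<le> v"
  shows "(CLINT \<omega>|M. iexp (step_integral B ss \<omega>)) = complex_of_real (exp (- (\<integral>x. (step_function ss x)\<^sup>2 \<partial>half_line) / 2))"
proof -
  let ?T = "(\<lambda>(c, u, v). u) ` set ss \<union> (\<lambda>(c, u, v). v) ` set ss"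
  have ss': "0 \<le> u" "u \<le> v" if "(c, u, v) \<in> set ss" for c u v using that ss by auto
  have T: "0 \<le> t" if "t \<in> ?T" for t
  proof -
    from that obtain c u v where "(c, u, v) \<in> set ss" "t = u \<or> t = v" by auto
    then show ?thesis using ss'[of c u v] by auto
  qed
  obtain u :: "nat \<Rightarrow> real" and p where u: "mono u" "0 \<le> u 0" "?T \<subseteq> u ` {..p}"
  proof -
    have fin: "finite ?T" by simp
    show thesis by (rule common_grid_ex[OF fin T that])
  qed
  have on_grid: "s \<le> t \<and> s \<in> u ` {..p} \<and> t \<in> u ` {..p}" if "(c, s, t) \<in> set ss" for c s t
  proof -
    have "s \<in> ?T" "t \<in> ?T" using that by force+
    then show ?thesis using u(3) ss'(2)[OF that] by blast
  qed
  have "\<exists>d. \<forall>D :: real \<Rightarrow> real. (\<Sum>(c, s, t)\<leftarrow>ss. c * (D t - D s)) = (\<Sum>i<p. d i * (D (u (Suc i)) - D (u i)))"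
  proof (rule step_sum_on_grid[OF u(1)])
    fix c s t assume "(c, s, t) \<in> set ss"
    then show "s \<le> t \<and> s \<in> u ` {..p} \<and> t \<in> u ` {..p}" by (rule on_grid)
  qed
  then obtain d where d: "\<And>D :: real \<Rightarrow> real. (\<Sum>(c, s, t)\<leftarrow>ss. c * (D t - D s)) = (\<Sum>i<p. d i * (D (u (Suc i)) - D (u i)))"
    by blast
  have le: "u i \<le> u (Suc i)" "0 \<le> u i" for i
    using u by (auto simp: mono_def intro: order_trans[OF u(2)])
  have SI: "step_integral B ss \<omega> = (\<Sum>i<p. d i * (B (u (Suc i)) \<omega> - B (u i) \<omega>))" for \<omega>
    unfolding step_integral_def by (rule d[of "\<lambda>t. B t \<omega>"])
  have SF: "step_function ss x = (\<Sum>i<p. d i * indicator {u i<..u (Suc i)} x)" for x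
  proof -
    \<comment> \<open>The increment of \<open>?D\<close> from \<open>s\<close> to \<open>t\<close>
      is the indicator of \<open>{s<..t}\<close> at \<open>x\<close>.\<close>
    let ?D = "\<lambda>r. if x \<le> r then 1 else 0 :: real"
    have "step_function ss x = (\<Sum>(c, s, t)\<leftarrow>ss. c * (?D t - ?D s))"
      unfolding step_function_def using ss
      by (intro arg_cong[where f = sum_list] map_cong refl) (auto simp: indicator_def)
    also have "\<dots> = (\<Sum>i<p. d i * (?D (u (Suc i)) - ?D (u i)))" by (rule d)
    also have "\<dots> = (\<Sum>i<p. d i * indicator {u i<..u (Suc i)} x)"
      using le(1) by (intro sum.cong refl) (auto simp: indicator_def intro: order_trans)
    finally show ?thesis .
  qed
  have [measurable]: "(\<lambda>\<omega>. B (u (Suc i)) \<omega> - B (u i) \<omega>) \<in> borel_measurable M" for i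
    by (intro measurable_increment le)
  let ?X = "\<lambda>i \<omega>. d i * (B (u (Suc i)) \<omega> - B (u i) \<omega>)"
  have "indep_vars (\<lambda>_. borel) (\<lambda>i \<omega>. B (u (Suc i)) \<omega> - B (u i) \<omega>) {..<p}"
    using BM_indep_increments[OF u(1,2)] by (rule indep_vars_subset) simp
  then have ind: "indep_vars (\<lambda>_. borel) ?X {..<p}"
    by (rule indep_vars_compose2[where Y = "\<lambda>i x. d i * x"]) simp
  have "(CLINT \<omega>|M. iexp (step_integral B ss \<omega>)) = char (distr M borel (\<lambda>\<omega>. \<Sum>i<p. ?X i \<omega>)) 1"
    unfolding char_def SI by (subst integral_distr) auto
  also have "\<dots> = (\<Prod>i<p. char (distr M borel (?X i)) 1)" by (rule char_distr_sum[OF ind])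
  also have "\<dots> = (\<Prod>i<p. complex_of_real (exp (- ((d i)\<^sup>2 * (u (Suc i) - u i)) / 2)))"
  proof (intro prod.cong refl)
    fix i
    have "char (distr M borel (?X i)) 1 = (CLINT \<omega>|M. iexp (d i * (B (u (Suc i)) \<omega> - B (u i) \<omega>)))"
      unfolding char_def by (subst integral_distr) auto
    then show "char (distr M borel (?X i)) 1 = complex_of_real (exp (- ((d i)\<^sup>2 * (u (Suc i) - u i)) / 2))"
      using char_increment[OF le(2)[of i] le(1)[of i], of "d i"] by simp
  qed
  also have "\<dots> = complex_of_real (exp (- (\<Sum>i<p. (d i)\<^sup>2 * (u (Suc i) - u i)) / 2))"
    by (simp add: sum_negf sum_divide_distrib flip: of_real_prod exp_sum)
  also have "(\<Sum>i<p. (d i)\<^sup>2 * (u (Suc i) - u i)) = (\<integral>x. (step_function ss x)\<^sup>2 \<partial>half_line)"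
    unfolding SF by (rule integral_sq_grid_step[OF u(1,2), symmetric])
  finally show ?thesis .
qed

end

text \<open>Linear combinations of step functions are encoded by concatenating rescaled lists. The
  abstract \<open>G\<close> covers both the function and its stochastic integral.\<close>

lemma sum_list_concat_scaled:
  fixes G :: "real \<Rightarrow> real \<Rightarrow> real"
  shows "(\<Sum>(x, u, v)\<leftarrow>concat (map (\<lambda>k. map (\<lambda>(x, u, v). (c k * x, u, v)) (f k)) [0..<K]). x * G u v)
    = (\<Sum>k<K. c k * (\<Sum>(x, u, v)\<leftarrow>f k. x * G u v))"
proof (induction K)
  case (Suc K)
  have "(\<Sum>(x, u, v)\<leftarrow>map (\<lambda>(x, u, v). (c K * x, u, v)) l. x * G u v) = c K * (\<Sum>(x, u, v)\<leftarrow>l. x * G u v)" for l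
    by (induction l) (auto simp: algebra_simps)
  then show ?case using Suc by simp
qed simp

text \<open>The map \<open>x \<mapsto> exp (\<i> * x)\<close> is 1-Lipschitz on the real
  line.\<close>

lemma (in prob_space) char_tendsto_L1:
  assumes "\<And>n. integrable M (Y n)" "integrable M Z" "(\<lambda>n. \<integral>\<omega>. \<bar>Y n \<omega> - Z \<omega>\<bar> \<partial>M) \<longlonglongrightarrow> 0"
  shows "(\<lambda>n. CLINT \<omega>|M. iexp (Y n \<omega>)) \<longlonglongrightarrow> (CLINT \<omega>|M. iexp (Z \<omega>))"
proof (rule LIM_zero_cancel, rule Lim_null_comparison)
  show "\<forall>\<^sub>F n in sequentially. norm ((CLINT \<omega>|M. iexp (Y n \<omega>)) - (CLINT \<omega>|M. iexp (Z \<omega>))) \<le> (\<integral>\<omega>. \<bar>Y n \<omega> - Z \<omega>\<bar> \<partial>M)"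
  proof (intro always_eventually allI)
    fix n
    have [measurable]: "Y n \<in> borel_measurable M" "Z \<in> borel_measurable M" using assms(1)[of n] assms(2) by auto
    have i: "integrable M (\<lambda>\<omega>. iexp (Y n \<omega>))" "integrable M (\<lambda>\<omega>. iexp (Z \<omega>))" by (auto intro!: integrable_iexp)
    have b: "norm (iexp x - iexp y) \<le> \<bar>x - y\<bar>" for x y
    proof -
      have "iexp x - iexp y = iexp y * (iexp (x - y) - 1)" by (simp add: algebra_simps flip: exp_add)
      then have "norm (iexp x - iexp y) = norm (iexp (x - y) - 1)" by (simp add: norm_mult del: of_real_diff)
      also have "\<dots> \<le> \<bar>x - y\<bar>" using iexp_approx1[of "x - y" 0] by simp
      finally show ?thesis .
    qed
    have "norm ((CLINT \<omega>|M. iexp (Y n \<omega>)) - (CLINT \<omega>|M. iexp (Z \<omega>))) = norm (CLINT \<omega>|M. iexp (Y n \<omega>) - iexp (Z \<omega>))"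
      using i by simp
    also have "\<dots> \<le> (\<integral>\<omega>. norm (iexp (Y n \<omega>) - iexp (Z \<omega>)) \<partial>M)" by (rule integral_norm_bound)
    also have "\<dots> \<le> (\<integral>\<omega>. \<bar>Y n \<omega> - Z \<omega>\<bar> \<partial>M)"
      using i assms b by (intro integral_mono) auto
    finally show "norm ((CLINT \<omega>|M. iexp (Y n \<omega>)) - (CLINT \<omega>|M. iexp (Z \<omega>))) \<le> (\<integral>\<omega>. \<bar>Y n \<omega> - Z \<omega>\<bar> \<partial>M)" .
  qed
qed (rule assms)

context standard_brownian_motion
begin

text \<open>A linear combination of approximating step integrals is the step integral of one list,
  so \<open>char_step_integral\<close> gives its characteristic function. In the limit the squared
  norm becomes the sum of the \<open>(c k)\<^sup>2\<close> by orthonormality.\<close>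

lemma char_wiener_integrals:
  fixes h :: "nat \<Rightarrow> real \<Rightarrow> real" and c :: "nat \<Rightarrow> real"
  assumes W: "\<And>k. is_wiener_integral M B (h k) (W k)"
    and h: "\<And>j k. L2_inner half_line (h j) (h k) = (if j = k then 1 else 0)"
  shows "(CLINT \<omega>|M. iexp (\<Sum>k<K. c k * W k \<omega>)) = complex_of_real (exp (- (\<Sum>k<K. (c k)\<^sup>2) / 2))"
proof -
  have "\<forall>k. \<exists>ss. (\<forall>n. \<forall>(c, u, v) \<in> set (ss n). 0 \<le> u \<and> u \<le> v) \<and>
     L2_tendsto half_line (\<lambda>n. step_function (ss n)) (h k) \<and> L2_tendsto M (\<lambda>n. step_integral B (ss n)) (W k)"
    using W unfolding is_wiener_integral_def by blast
  from choice[OF this] obtain ss where ss: "\<And>k n. \<forall>(c, u, v) \<in> set (ss k n). 0 \<le> u \<and> u \<le> v"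
    "\<And>k. L2_tendsto half_line (\<lambda>n. step_function (ss k n)) (h k)"
    "\<And>k. L2_tendsto M (\<lambda>n. step_integral B (ss k n)) (W k)"
    by blast
  define S where "S n = concat (map (\<lambda>k. map (\<lambda>(x, u, v). (c k * x, u, v)) (ss k n)) [0..<K])" for n
  have S: "\<forall>(c, u, v) \<in> set (S n). 0 \<le> u \<and> u \<le> v" for n
  proof -
    have "0 \<le> u" "u \<le> v" if "(x, u, v) \<in> set (ss k n)" for x u v k using ss(1)[of k n] that by auto
    then show ?thesis by (auto simp: S_def)
  qed
  have SF: "step_function (S n) x = (\<Sum>k<K. c k * step_function (ss k n) x)" for n x
    unfolding step_function_def S_def by (rule sum_list_concat_scaled[of "\<lambda>u v. indicator {u<..v} x"])
  have SI: "step_integral B (S n) \<omega> = (\<Sum>k<K. c k * step_integral B (ss k n) \<omega>)" for n \<omega>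
    unfolding step_integral_def S_def by (rule sum_list_concat_scaled[of "\<lambda>u v. B v \<omega> - B u \<omega>"])
  have sq: "(\<integral>x. (step_function (S n) x)\<^sup>2 \<partial>half_line)
     = (\<Sum>j<K. \<Sum>k<K. c j * c k * L2_inner half_line (step_function (ss j n)) (step_function (ss k n)))" for n
  proof -
    have "(\<integral>x. (step_function (S n) x)\<^sup>2 \<partial>half_line)
       = (\<integral>x. (\<Sum>j<K. \<Sum>k<K. c j * c k * (step_function (ss j n) x * step_function (ss k n) x)) \<partial>half_line)"
      unfolding SF power2_eq_square sum_product by (simp add: mult_ac)
    also have "\<dots> = (\<Sum>j<K. \<Sum>k<K. c j * c k * L2_inner half_line (step_function (ss j n)) (step_function (ss k n)))"
    proof -
      have i: "integrable half_line (\<lambda>x. step_function (ss j n) x * step_function (ss k n) x)" for j k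
        using ss(2) by (intro square_integrable_mult) (auto simp: L2_tendsto_def)
      show ?thesis unfolding L2_inner_def
        by (simp add: Bochner_Integration.integral_sum Bochner_Integration.integrable_sum i)
    qed
    finally show ?thesis .
  qed
  have "(\<lambda>n. \<integral>x. (step_function (S n) x)\<^sup>2 \<partial>half_line) \<longlonglongrightarrow> (\<Sum>j<K. \<Sum>k<K. c j * c k * L2_inner half_line (h j) (h k))"
    unfolding sq by (intro tendsto_intros L2_inner_tendsto ss(2))
  also have "(\<Sum>j<K. \<Sum>k<K. c j * c k * L2_inner half_line (h j) (h k)) = (\<Sum>k<K. (c k)\<^sup>2)"
    by (simp add: h power2_eq_square if_distrib[of "(*) _"] sum.delta cong: if_cong)
  finally have "(\<lambda>n. complex_of_real (exp (- (\<integral>x. (step_function (S n) x)\<^sup>2 \<partial>half_line) / 2)))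
     \<longlonglongrightarrow> complex_of_real (exp (- (\<Sum>k<K. (c k)\<^sup>2) / 2))"
    by (intro tendsto_intros) auto
  then have 1: "(\<lambda>n. CLINT \<omega>|M. iexp (step_integral B (S n) \<omega>)) \<longlonglongrightarrow> complex_of_real (exp (- (\<Sum>k<K. (c k)\<^sup>2) / 2))"
    unfolding char_step_integral[OF S] .
  note L1 = L2_tendsto_L1[OF ss(3)]
  have "(\<lambda>n. CLINT \<omega>|M. iexp (step_integral B (S n) \<omega>)) \<longlonglongrightarrow> (CLINT \<omega>|M. iexp (\<Sum>k<K. c k * W k \<omega>))"
  proof (rule char_tendsto_L1)
    show i: "integrable M (step_integral B (S n))" for n
      using L1(1) by (simp add: SI[abs_def])
    show j: "integrable M (\<lambda>\<omega>. \<Sum>k<K. c k * W k \<omega>)" using L1(2) by simp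
    show "(\<lambda>n. \<integral>\<omega>. \<bar>step_integral B (S n) \<omega> - (\<Sum>k<K. c k * W k \<omega>)\<bar> \<partial>M) \<longlonglongrightarrow> 0"
    proof (rule Lim_null_comparison)
      show "\<forall>\<^sub>F n in sequentially. norm (\<integral>\<omega>. \<bar>step_integral B (S n) \<omega> - (\<Sum>k<K. c k * W k \<omega>)\<bar> \<partial>M)
          \<le> (\<Sum>k<K. \<bar>c k\<bar> * (\<integral>\<omega>. \<bar>step_integral B (ss k n) \<omega> - W k \<omega>\<bar> \<partial>M))"
      proof (intro always_eventually allI)
        fix n
        have k: "integrable M (\<lambda>\<omega>. \<bar>step_integral B (ss k n) \<omega> - W k \<omega>\<bar>)" for k
          using L1(1,2) by auto
        have "norm (\<integral>\<omega>. \<bar>step_integral B (S n) \<omega> - (\<Sum>k<K. c k * W k \<omega>)\<bar> \<partial>M)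
            = (\<integral>\<omega>. \<bar>step_integral B (S n) \<omega> - (\<Sum>k<K. c k * W k \<omega>)\<bar> \<partial>M)" by simp
        also have "\<dots> \<le> (\<integral>\<omega>. (\<Sum>k<K. \<bar>c k\<bar> * \<bar>step_integral B (ss k n) \<omega> - W k \<omega>\<bar>) \<partial>M)"
        proof (rule integral_mono)
          fix \<omega>
          have "step_integral B (S n) \<omega> - (\<Sum>k<K. c k * W k \<omega>) = (\<Sum>k<K. c k * (step_integral B (ss k n) \<omega> - W k \<omega>))"
            by (simp add: SI right_diff_distrib sum_subtractf)
          then show "\<bar>step_integral B (S n) \<omega> - (\<Sum>k<K. c k * W k \<omega>)\<bar> \<le> (\<Sum>k<K. \<bar>c k\<bar> * \<bar>step_integral B (ss k n) \<omega> - W k \<omega>\<bar>)"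
            by (simp add: sum_abs order_trans[OF sum_abs] abs_mult)
        qed (use i j k in auto)
        also have "\<dots> = (\<Sum>k<K. \<bar>c k\<bar> * (\<integral>\<omega>. \<bar>step_integral B (ss k n) \<omega> - W k \<omega>\<bar> \<partial>M))"
          using k by (subst Bochner_Integration.integral_sum) auto
        finally show "norm (\<integral>\<omega>. \<bar>step_integral B (S n) \<omega> - (\<Sum>k<K. c k * W k \<omega>)\<bar> \<partial>M)
          \<le> (\<Sum>k<K. \<bar>c k\<bar> * (\<integral>\<omega>. \<bar>step_integral B (ss k n) \<omega> - W k \<omega>\<bar> \<partial>M))" .
      qed
      show "(\<lambda>n. \<Sum>k<K. \<bar>c k\<bar> * (\<integral>\<omega>. \<bar>step_integral B (ss k n) \<omega> - W k \<omega>\<bar> \<partial>M)) \<longlonglongrightarrow> 0"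
        using L1(3) by (auto intro!: tendsto_eq_intros)
    qed
  qed
  then show ?thesis using 1 by (rule LIMSEQ_unique)
qed

end

context prob_space
begin

text \<open>Peeling off all coordinates with \<open>gaussian_peel\<close> leaves no exponential
  factor, so rectangle probabilities are products of normal probabilities. Rectangles with a single
  nontrivial side give the marginal law, general ones the independence.\<close>

lemma
  fixes W :: "nat \<Rightarrow> 'a \<Rightarrow> real"
  assumes [measurable]: "\<And>k. W k \<in> borel_measurable M"
    and cf: "\<And>c K. (CLINT \<omega>|M. iexp (\<Sum>k<K. c k * W k \<omega>)) = complex_of_real (exp (- (\<Sum>k<K. (c k)\<^sup>2) / 2))"
  shows std_normal_of_joint_char: "distr M borel (W k) = std_normal_distribution"
    and indep_of_joint_char: "indep_vars (\<lambda>_. borel) W {..<K}"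
proof -
  let ?\<gamma> = std_normal_distribution
  interpret \<gamma>: real_distribution ?\<gamma> by (rule real_dist_normal_dist)
  have joint: "prob {\<omega> \<in> space M. \<forall>j<K. W j \<omega> \<in> A j} = (\<Prod>j<K. measure ?\<gamma> (A j))"
    if A[measurable]: "\<And>k. A k \<in> sets borel" for A K
  proof -
    have "complex_of_real (\<integral>\<omega>. (\<Prod>j<K. indicator (A j) (W j \<omega>)) \<partial>M) = complex_of_real (\<Prod>j<K. measure ?\<gamma> (A j))"
      using gaussian_peel[where A = A and K = K and m = K and c = "\<lambda>_. 0", OF assms(1) cf A]
      by (simp add: integral_complex_of_real del: of_real_prod)
    then have "(\<Prod>j<K. measure ?\<gamma> (A j)) = (\<integral>\<omega>. (\<Prod>j<K. indicator (A j) (W j \<omega>)) \<partial>M)"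
      by (simp only: of_real_eq_iff)
    also have "\<dots> = (\<integral>\<omega>. indicator {\<omega> \<in> space M. \<forall>j<K. W j \<omega> \<in> A j} \<omega> \<partial>M)"
      by (intro Bochner_Integration.integral_cong refl) (auto simp: indicator_def prod_zero_iff)
    finally show ?thesis by simp
  qed
  have joint_emeasure: "emeasure M {\<omega> \<in> space M. \<forall>j<K. W j \<omega> \<in> A j} = ennreal (\<Prod>j<K. measure ?\<gamma> (A j))"
    if "\<And>k. A k \<in> sets borel" for A K
    using joint[of A K, OF that] by (simp add: emeasure_eq_measure)
  show law: "distr M borel (W k) = ?\<gamma>" for k
  proof (rule measure_eqI)
    fix A assume "A \<in> sets (distr M borel (W k))"
    then have A [measurable]: "A \<in> sets borel" by simp
    have "prob {\<omega> \<in> space M. \<forall>j<Suc k. W j \<omega> \<in> (if j = k then A else UNIV)} = (\<Prod>j<Suc k. measure ?\<gamma> (if j = k then A else UNIV))"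
      by (rule joint) auto
    moreover have "{\<omega> \<in> space M. \<forall>j<Suc k. W j \<omega> \<in> (if j = k then A else UNIV)} = W k -` A \<inter> space M" by auto
    moreover have "(\<Prod>j<Suc k. measure ?\<gamma> (if j = k then A else UNIV)) = measure ?\<gamma> A"
      using \<gamma>.prob_space by simp
    ultimately show "emeasure (distr M borel (W k)) A = emeasure ?\<gamma> A"
      by (simp add: emeasure_distr emeasure_eq_measure \<gamma>.emeasure_eq_measure)
  qed simp
  show "indep_vars (\<lambda>_. borel) W {..<K}"
  \<comment> \<open>The characterization of independence by the product law requires a nonempty
    index set.\<close>
  proof (cases "K = 0")
    case True
    then show ?thesis by (simp add: indep_vars_def indep_sets_def)
  next
    case False
    have "distr M (Pi\<^sub>M {..<K} (\<lambda>_. borel)) (\<lambda>x. \<lambda>i\<in>{..<K}. W i x) = Pi\<^sub>M {..<K} (\<lambda>i. distr M borel (W i))"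
    proof -
      interpret product_prob_space "\<lambda>k. distr M borel (W k)" "{..<K}"
        by (intro product_prob_spaceI prob_space_distr) simp
      show ?thesis
      proof (rule PiM_eqI)
        show "sets (distr M (Pi\<^sub>M {..<K} (\<lambda>_. borel)) (\<lambda>x. \<lambda>i\<in>{..<K}. W i x)) = sets (Pi\<^sub>M {..<K} (\<lambda>i. distr M borel (W i)))"
          by (simp cong: sets_PiM_cong)
        fix A assume A: "\<And>i. i \<in> {..<K} \<Longrightarrow> A i \<in> sets (distr M borel (W i))"
        \<comment> \<open>The joint formula expects a Borel set for every index; beyond
          \<open>K\<close> nothing is known about \<open>A\<close>.\<close>
        let ?A = "\<lambda>i. if i < K then A i else UNIV"
        have A': "?A i \<in> sets borel" for i using A[of i] by auto
        have "emeasure (distr M (Pi\<^sub>M {..<K} (\<lambda>_. borel)) (\<lambda>x. \<lambda>i\<in>{..<K}. W i x)) (Pi\<^sub>E {..<K} A)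
           = emeasure M ((\<lambda>x. \<lambda>i\<in>{..<K}. W i x) -` (Pi\<^sub>E {..<K} A) \<inter> space M)"
        proof (rule emeasure_distr)
          show "(\<lambda>x. \<lambda>i\<in>{..<K}. W i x) \<in> measurable M (Pi\<^sub>M {..<K} (\<lambda>_. borel))"
            by (rule measurable_restrict) simp
          show "Pi\<^sub>E {..<K} A \<in> sets (Pi\<^sub>M {..<K} (\<lambda>_. borel))"
            by (rule sets_PiM_I_finite) (use A in simp_all)
        qed
        also have "(\<lambda>x. \<lambda>i\<in>{..<K}. W i x) -` (Pi\<^sub>E {..<K} A) \<inter> space M = {\<omega> \<in> space M. \<forall>j<K. W j \<omega> \<in> ?A j}"
        proof -
          have "(\<lambda>i\<in>{..<K}. W i x) \<in> Pi\<^sub>E {..<K} A \<longleftrightarrow> (\<forall>j<K. W j x \<in> ?A j)" for x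
            unfolding restrict_PiE_iff by (simp add: Ball_def)
          then show ?thesis by blast
        qed
        also have "emeasure M \<dots> = ennreal (\<Prod>j<K. measure ?\<gamma> (?A j))"
          by (rule joint_emeasure) (rule A')
        also have "\<dots> = (\<Prod>i<K. emeasure (distr M borel (W i)) (A i))"
          unfolding law by (simp add: \<gamma>.emeasure_eq_measure prod_ennreal)
        finally show "emeasure (distr M (Pi\<^sub>M {..<K} (\<lambda>_. borel)) (\<lambda>x. \<lambda>i\<in>{..<K}. W i x)) (Pi\<^sub>E {..<K} A)
           = (\<Prod>i\<in>{..<K}. emeasure (distr M borel (W i)) (A i))" .
      qed simp
    qed
    then show ?thesis
      using False by (subst indep_vars_iff_distr_eq_PiM') auto
  qed
qed

end

section \<open>The second Wiener integral\<close>

text \<open>The factor \<open>x\<close> is the derivative of \<open>x\<^sup>2 / 2\<close>, and the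
  factor 2 counts the preimages \<open>x\<close> and \<open>-x\<close>.\<close>

lemma std_normal_density_eq_half_gamma:
  assumes "0 < x"
  shows "gamma_density (1 / 2) (x\<^sup>2 / 2) * x = 2 * std_normal_density x"
proof -
  have "(x\<^sup>2 / 2) powr (1 / 2 - 1) = inverse (sqrt (x\<^sup>2 / 2))"
    using assms by (simp add: powr_minus powr_half_sqrt flip: powr_half_sqrt)
  also have "\<dots> = sqrt 2 / x" using assms by (simp add: real_sqrt_divide)
  finally have p: "(x\<^sup>2 / 2) powr (1 / 2 - 1) = sqrt 2 / x" .
  have "gamma_density (1 / 2) (x\<^sup>2 / 2) * x = sqrt 2 / x * exp (- (x\<^sup>2 / 2)) / sqrt pi * x"
    unfolding gamma_density_def p using assms by (simp add: Gamma_one_half_real)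
  also have "\<dots> = 2 * (exp (- (x\<^sup>2 / 2)) / (sqrt 2 * sqrt pi))"
    using assms by (simp add: field_simps)
  finally show ?thesis by (simp add: normal_density_def real_sqrt_mult)
qed

text \<open>Distribution functions are compared: the event is a symmetric interval, symmetry folds
  it onto the positive half, and the substitution \<open>x\<^sup>2 / 2\<close> turns the doubled
  normal density into the gamma density.\<close>

lemma half_square_normal_law: "distr std_normal_distribution borel (\<lambda>x. x\<^sup>2 / 2) = gamma_law (1 / 2)"
proof (rule cdf_unique)
  let ?\<gamma> = std_normal_distribution
  interpret \<gamma>: real_distribution ?\<gamma> by (rule real_dist_normal_dist)
  interpret D: prob_space "distr ?\<gamma> borel (\<lambda>x. x\<^sup>2 / 2)" by (rule \<gamma>.prob_space_distr) simp
  interpret G: prob_space "gamma_law (1 / 2)" by (rule prob_space_gamma_law) simp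
  show "real_distribution (distr ?\<gamma> borel (\<lambda>x. x\<^sup>2 / 2))" by (rule \<gamma>.real_distribution_distr) simp
  show "real_distribution (gamma_law (1 / 2))" by unfold_locales simp_all
  have "emeasure (distr ?\<gamma> borel (\<lambda>x. x\<^sup>2 / 2)) {..c} = emeasure (gamma_law (1 / 2)) {..c}" for c
  proof (cases "0 \<le> c")
    case False
    have "\<not> x\<^sup>2 / 2 \<le> c" for x :: real using False zero_le_power2[of x] by linarith
    then have "(\<lambda>x. x\<^sup>2 / 2) -` {..c} = {}" by auto
    moreover have "(\<integral>\<^sup>+x. ennreal (gamma_density (1 / 2) x) * indicator {..c} x \<partial>lborel) = (\<integral>\<^sup>+x. 0 \<partial>(lborel :: real measure))"
      using False by (intro nn_integral_cong) (auto simp: gamma_density_def indicator_def)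
    ultimately show ?thesis by (simp add: emeasure_distr gamma_law_def emeasure_density)
  next
    case True
    define r where "r = sqrt (2 * c)"
    have r: "0 \<le> r" "r\<^sup>2 / 2 = c" using True by (auto simp: r_def)
    have set: "(\<lambda>x. x\<^sup>2 / 2) -` {..c} = {- r..r}"
    proof -
      have "x\<^sup>2 / 2 \<le> c \<longleftrightarrow> \<bar>x\<bar> \<le> \<bar>r\<bar>" for x using r(2) by (simp only: abs_le_square_iff) linarith
      then show ?thesis using r(1) by (auto simp: abs_le_iff)
    qed
    let ?I = "\<integral>\<^sup>+x. ennreal (std_normal_density x) * indicator {0..r} x \<partial>lborel"
    have neg: "(\<integral>\<^sup>+x. ennreal (std_normal_density x) * indicator {- r..<0} x \<partial>lborel) = ?I"
    proof -
      have "(\<integral>\<^sup>+x. ennreal (std_normal_density x) * indicator {- r..<0} x \<partial>lborel)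
        = ennreal \<bar>-1\<bar> * (\<integral>\<^sup>+x. ennreal (std_normal_density (0 + (-1) * x)) * indicator {- r..<0} (0 + (-1) * x) \<partial>lborel)"
        by (rule nn_integral_real_affine) simp_all
      also have "\<dots> = (\<integral>\<^sup>+x. ennreal (std_normal_density x) * indicator {0<..r} x \<partial>lborel)"
        by (simp, intro nn_integral_cong) (auto simp: indicator_def normal_density_def)
      also have "\<dots> = ?I"
        using AE_lborel_singleton[of 0] by (intro nn_integral_cong_AE) (auto simp: indicator_def elim!: eventually_mono)
      finally show ?thesis .
    qed
    have "emeasure (distr ?\<gamma> borel (\<lambda>x. x\<^sup>2 / 2)) {..c} = emeasure ?\<gamma> {- r..r}"
      using set by (simp add: emeasure_distr)
    also have "\<dots> = (\<integral>\<^sup>+x. ennreal (std_normal_density x) * indicator {- r..r} x \<partial>lborel)"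
      by (simp add: emeasure_density)
    also have "\<dots> = (\<integral>\<^sup>+x. ennreal (std_normal_density x) * indicator {0..r} x + ennreal (std_normal_density x) * indicator {- r..<0} x \<partial>lborel)"
      using r(1) by (intro nn_integral_cong) (auto simp: indicator_def)
    also have "\<dots> = ?I + ?I" using neg by (simp add: nn_integral_add)
    also have "\<dots> = (\<integral>\<^sup>+x. ennreal (2 * std_normal_density x * indicator {0..r} x) \<partial>lborel)"
      by (subst nn_integral_add[symmetric]) (auto intro!: nn_integral_cong simp: indicator_def simp flip: ennreal_plus)
    also have "\<dots> = (\<integral>\<^sup>+x. ennreal (gamma_density (1 / 2) (x\<^sup>2 / 2) * x * indicator {0..r} x) \<partial>lborel)"
    proof (rule nn_integral_cong_AE)
      show "AE x in lborel. ennreal (2 * std_normal_density x * indicator {0..r} x) = ennreal (gamma_density (1 / 2) (x\<^sup>2 / 2) * x * indicator {0..r} x)"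
        using AE_lborel_singleton[of 0]
      proof eventually_elim
        fix x :: real assume "x \<noteq> 0"
        then show "ennreal (2 * std_normal_density x * indicator {0..r} x) = ennreal (gamma_density (1 / 2) (x\<^sup>2 / 2) * x * indicator {0..r} x)"
          using std_normal_density_eq_half_gamma[of x] by (cases "0 < x") auto
      qed
    qed
    also have "\<dots> = (\<integral>\<^sup>+x. ennreal (gamma_density (1 / 2) x * indicator {0\<^sup>2 / 2..r\<^sup>2 / 2} x) \<partial>lborel)"
    proof (rule nn_integral_substitution[where g = "\<lambda>x. x\<^sup>2 / 2" and g' = "\<lambda>x. x", symmetric])
      show "set_borel_measurable borel {0\<^sup>2 / 2..r\<^sup>2 / 2} (gamma_density (1 / 2))"
        by (simp add: set_borel_measurable_def)
      show "((\<lambda>x. x\<^sup>2 / 2) has_real_derivative x) (at x)" for x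
        by (auto intro!: derivative_eq_intros)
    qed (use r in auto)
    also have "\<dots> = (\<integral>\<^sup>+x. ennreal (gamma_density (1 / 2) x) * indicator {..c} x \<partial>lborel)"
      unfolding r(2) by (intro nn_integral_cong) (auto simp: gamma_density_def indicator_def)
    also have "\<dots> = emeasure (gamma_law (1 / 2)) {..c}"
      by (simp add: gamma_law_def emeasure_density)
    finally show ?thesis .
  qed
  then show "cdf (distr ?\<gamma> borel (\<lambda>x. x\<^sup>2 / 2)) = cdf (gamma_law (1 / 2))"
    by (simp add: fun_eq_iff cdf_def measure_def)
qed

lemma gamma_jump_scale:
  assumes "a \<noteq> 0"
  shows "gamma_jump 1 (v / a) / ennreal \<bar>a\<bar> = gamma_jump a v"
proof (cases "0 < a * v")
  case True
  then have "0 < v / a" by (simp add: zero_less_mult_iff zero_less_divide_iff) blast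
  have "ennreal (exp (- (v / a)) / (2 * \<bar>v / a\<bar>)) / ennreal \<bar>a\<bar> = ennreal (exp (- (v / a)) / (2 * \<bar>v / a\<bar>) / \<bar>a\<bar>)"
    using assms by (intro divide_ennreal) auto
  also have "exp (- (v / a)) / (2 * \<bar>v / a\<bar>) / \<bar>a\<bar> = exp (- v / a) / (2 * \<bar>v\<bar>)"
    using assms by (simp add: abs_divide)
  finally show ?thesis using True \<open>0 < v / a\<close> by (simp add: gamma_jump_def)
next
  case False
  then have "\<not> 0 < v / a" using assms by (auto simp: zero_less_mult_iff zero_less_divide_iff)
  then show ?thesis using False by (simp add: gamma_jump_def)
qed

text \<open>The variable is the affine image \<open>a * y - a / 2\<close> of
  \<open>y = W\<^sup>2 / 2\<close>. The case \<open>a = 0\<close> is a constant and lies outside the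
  affine lemma.\<close>

lemma modified_log_sobolev_chi_square:
  assumes M: "prob_space M" and [measurable]: "W \<in> borel_measurable M"
    and W: "distr M borel W = std_normal_distribution"
  shows "modified_log_sobolev (distr M borel (\<lambda>\<omega>. 1/2 * (a * ((W \<omega>)\<^sup>2 - 1)))) (gamma_jump a)"
proof (cases "a = 0")
  case True
  then show ?thesis using modified_log_sobolev_const[OF M, of 0 "gamma_jump a"] by simp
next
  case False
  have "distr M borel (\<lambda>\<omega>. 1/2 * (a * ((W \<omega>)\<^sup>2 - 1))) = distr (distr (distr M borel W) borel (\<lambda>x. x\<^sup>2 / 2)) borel (\<lambda>x. a * x + - a / 2)"
    by (simp add: distr_distr o_def algebra_simps diff_divide_distrib)
  also have "\<dots> = distr (gamma_law (1 / 2)) borel (\<lambda>x. a * x + - a / 2)"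
    unfolding W half_square_normal_law ..
  finally show ?thesis
    using modified_log_sobolev_affine[OF sets_gamma_law _ modified_log_sobolev_gamma False, of "- a / 2"]
    by (simp add: gamma_jump_scale[OF False])
qed

text \<open>The value is the variance of \<open>1/2 * c * (W\<^sup>2 - 1)\<close> for a standard
  normal \<open>W\<close>. Square-summable eigenvalues therefore give the summed density the finite
  second moment that \<open>modified_log_sobolev_limit\<close> demands.\<close>

lemma nn_integral_square_gamma_jump:
  "(\<integral>\<^sup>+v. ennreal (v\<^sup>2) * gamma_jump c v \<partial>lborel) = ennreal (c\<^sup>2 / 2)"
proof (cases "c = 0")
  case True
  then show ?thesis by (simp add: gamma_jump_def)
next
  case False
  let ?f = "\<lambda>u::real. if 0 < u then u powr (2 - 1) * exp (- u) else 0"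
  have "(\<integral>\<^sup>+v. ennreal (v\<^sup>2) * gamma_jump c v \<partial>lborel)
    = (\<integral>\<^sup>+u. ennreal ((c * u)\<^sup>2) * ennreal (if 0 < u then exp (- u) / (2 * u) else 0) \<partial>lborel)"
    by (rule nn_integral_gamma_jump[OF _ False]) measurable
  also have "\<dots> = (\<integral>\<^sup>+u. ennreal (c\<^sup>2 / 2) * ennreal (?f u) \<partial>lborel)"
  proof (rule nn_integral_cong)
    fix u :: real
    have "(c * u)\<^sup>2 * (if 0 < u then exp (- u) / (2 * u) else 0) = c\<^sup>2 / 2 * ?f u"
      by (simp add: power2_eq_square)
    then show "ennreal ((c * u)\<^sup>2) * ennreal (if 0 < u then exp (- u) / (2 * u) else 0) = ennreal (c\<^sup>2 / 2) * ennreal (?f u)"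
      by (simp flip: ennreal_mult')
  qed
  also have "\<dots> = ennreal (c\<^sup>2 / 2) * ennreal (Gamma 2)"
    by (subst nn_integral_cmult) (simp_all only: nn_integral_powr_exp[of 2] zero_less_numeral, measurable)
  also have "Gamma 2 = (1::real)" using Gamma_fact[of 1, where 'a = real] by simp
  finally show ?thesis by simp
qed

lemma (in standard_brownian_motion) modified_log_sobolev_second_wiener_integral:
  assumes h: "\<And>j k. L2_inner half_line (h j) (h k) = (if j = k then 1 else 0)"
    and a: "summable (\<lambda>k. (a k)\<^sup>2)"
    and J: "is_second_wiener_integral M B h a J"
  shows "modified_log_sobolev (distr M borel J) (\<lambda>v. \<Sum>k. gamma_jump (a k) v)"
proof -
  obtain W where W: "\<And>k. is_wiener_integral M B (h k) (W k)"
    and L: "L2_tendsto M (\<lambda>n \<omega>. 1/2 * (\<Sum>k<n. a k * ((W k \<omega>)\<^sup>2 - 1))) J"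
    using J unfolding is_second_wiener_integral_def by blast
  have [measurable]: "W k \<in> borel_measurable M" for k
    using W[of k] by (auto simp: is_wiener_integral_def L2_tendsto_def square_integrable_def)
  have cf: "(CLINT \<omega>|M. iexp (\<Sum>k<K. c k * W k \<omega>)) = complex_of_real (exp (- (\<Sum>k<K. (c k)\<^sup>2) / 2))" for c K
    by (rule char_wiener_integrals[OF W h])
  have law: "distr M borel (W k) = std_normal_distribution" for k
    by (rule std_normal_of_joint_char[OF _ cf]) measurable
  have ind: "indep_vars (\<lambda>_. borel) W {..<K}" for K
    by (rule indep_of_joint_char[OF _ cf]) measurable
  define X where "X k \<omega> = 1/2 * (a k * ((W k \<omega>)\<^sup>2 - 1))" for k \<omega>
  have [measurable]: "X k \<in> borel_measurable M" for k unfolding X_def by measurable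
  have indX: "indep_vars (\<lambda>_. borel) X {..<K}" for K
    unfolding X_def by (rule indep_vars_compose2[OF ind, of _ "\<lambda>k x. 1/2 * (a k * (x\<^sup>2 - 1))"]) measurable
  have m1: "modified_log_sobolev (distr M borel (X k)) (gamma_jump (a k))" for k
    unfolding X_def by (rule modified_log_sobolev_chi_square[OF prob_space_axioms _ law]) measurable
  have mn: "modified_log_sobolev (distr M borel (\<lambda>\<omega>. \<Sum>k<n. X k \<omega>)) (\<lambda>v. \<Sum>k<n. gamma_jump (a k) v)" for n
  proof (induction n)
    case 0
    then show ?case using modified_log_sobolev_const[OF prob_space_axioms, of 0] by simp
  next
    case (Suc n)
    have "indep_var borel (X n) borel (\<lambda>\<omega>. \<Sum>k<n. X k \<omega>)"
      using indX[of "Suc n"] by (intro indep_vars_sum) (auto simp: lessThan_Suc)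
    then have "distr M borel (\<lambda>\<omega>. X n \<omega> + (\<Sum>k<n. X k \<omega>)) = (distr M borel (X n) \<star> distr M borel (\<lambda>\<omega>. \<Sum>k<n. X k \<omega>))"
      by (rule sum_indep_random_variable) measurable
    moreover have "modified_log_sobolev (distr M borel (X n) \<star> distr M borel (\<lambda>\<omega>. \<Sum>k<n. X k \<omega>)) (\<lambda>v. gamma_jump (a n) v + (\<Sum>k<n. gamma_jump (a k) v))"
      by (rule modified_log_sobolev_convolution) (auto intro!: prob_space_distr m1 Suc)
    ultimately show ?case by (simp add: add.commute)
  qed
  have eq: "(\<lambda>n \<omega>. 1/2 * (\<Sum>k<n. a k * ((W k \<omega>)\<^sup>2 - 1))) = (\<lambda>n \<omega>. \<Sum>k<n. X k \<omega>)"
    by (simp add: X_def fun_eq_iff sum_distrib_left)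
  note L1 = L2_tendsto_L1[OF L[unfolded eq]]
  \<comment> \<open>Mean convergence yields almost sure convergence only along a subsequence, which
    suffices for the limit lemma.\<close>
  obtain r :: "nat \<Rightarrow> nat" where r: "AE \<omega> in M. (\<lambda>n. (\<Sum>k<r n. X k \<omega>) - J \<omega>) \<longlonglongrightarrow> 0"
    using tendsto_L1_AE_subseq[of M "\<lambda>n \<omega>. (\<Sum>k<n. X k \<omega>) - J \<omega>"] L1 by auto
  have [measurable]: "J \<in> borel_measurable M" using L1(2) by auto
  show ?thesis
  proof (rule modified_log_sobolev_limit[OF prob_space_axioms, where Y = "\<lambda>n \<omega>. \<Sum>k<r n. X k \<omega>" and k = "\<lambda>n v. \<Sum>k<r n. gamma_jump (a k) v"])
    show "AE \<omega> in M. (\<lambda>n. \<Sum>k<r n. X k \<omega>) \<longlonglongrightarrow> J \<omega>"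
      using r by eventually_elim (rule LIM_zero_cancel)
    show "(\<Sum>k<r n. gamma_jump (a k) v) \<le> (\<Sum>k. gamma_jump (a k) v)" for n v
      by (rule sum_le_suminf) auto
    have "(\<integral>\<^sup>+v. ennreal (v\<^sup>2) * (\<Sum>k. gamma_jump (a k) v) \<partial>lborel) = (\<Sum>k. \<integral>\<^sup>+v. ennreal (v\<^sup>2) * gamma_jump (a k) v \<partial>lborel)"
      by (subst nn_integral_suminf[symmetric]) (auto simp: ennreal_suminf_cmult)
    also have "\<dots> = (\<Sum>k. ennreal ((a k)\<^sup>2 / 2))" by (simp add: nn_integral_square_gamma_jump)
    also have "\<dots> < \<infinity>"
      using a by (simp add: less_top[symmetric], intro ennreal_suminf_neq_top) (auto intro: summable_divide)
    finally show "(\<integral>\<^sup>+v. ennreal (v\<^sup>2) * (\<Sum>k. gamma_jump (a k) v) \<partial>lborel) < \<infinity>" .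
  qed (use mn in auto)
qed

section \<open>The norm of the kernel in terms of its eigenvalues\<close>

lemma sigma_finite_half_line: "sigma_finite_measure half_line"
  unfolding half_line_def by (rule sigma_finite_measure_restrict_space) (simp_all add: sigma_finite_lborel)

text \<open>By Fubini the functions \<open>h k s * h k t\<close> are orthonormal on the quadrant;
  the factor 4 undoes the square of the \<open>1/2\<close> in the expansion.\<close>

lemma eigen_expansion_norm:
  assumes "eigen_expansion f h a"
  shows "(\<lambda>n. \<Sum>k<n. (a k)\<^sup>2) \<longlonglongrightarrow> 4 * (L2_norm quadrant f)\<^sup>2"
proof -
  interpret H: sigma_finite_measure half_line by (rule sigma_finite_half_line)
  interpret HH: pair_sigma_finite half_line half_line ..
  have h: "\<And>k. square_integrable half_line (h k)" "\<And>j k. L2_inner half_line (h j) (h k) = (if j = k then 1 else 0)"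
    and L: "L2_tendsto quadrant (\<lambda>n (s, t). 1/2 * (\<Sum>k<n. a k * h k s * h k t)) f"
    using assms by (auto simp: eigen_expansion_def L2_orthonormal_basis_def)
  have [measurable]: "h k \<in> borel_measurable half_line" for k using h(1) by (simp add: square_integrable_def)
  let ?g = "\<lambda>j k z. (h j (fst z) * h k (fst z)) * (h j (snd z) * h k (snd z))"
  have ii: "integrable half_line (\<lambda>x. h j x * h k x)" for j k by (intro square_integrable_mult h)
  have i: "integrable quadrant (?g j k)" for j k
  proof (rule HH.Fubini_integrable)
    show "?g j k \<in> borel_measurable quadrant" by measurable
    show "integrable half_line (\<lambda>x. \<integral>y. norm (?g j k (x, y)) \<partial>half_line)"
      using integrable_abs[OF ii[of j k]] by (simp add: abs_mult)
    show "AE x in half_line. integrable half_line (\<lambda>y. ?g j k (x, y))"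
      using ii[of j k] by simp
  qed
  have v: "(\<integral>z. ?g j k z \<partial>quadrant) = (if j = k then 1 else 0)" for j k
  proof -
    have "(\<integral>z. ?g j k z \<partial>quadrant) = (\<integral>x. (\<integral>y. ?g j k (x, y) \<partial>half_line) \<partial>half_line)"
      using HH.integral_fst'[OF i[of j k]] by simp
    also have "\<dots> = L2_inner half_line (h j) (h k) * L2_inner half_line (h j) (h k)"
      unfolding L2_inner_def by simp
    finally show ?thesis by (simp add: h(2))
  qed
  have n: "L2_inner quadrant (\<lambda>(s, t). 1/2 * (\<Sum>k<n. a k * h k s * h k t)) (\<lambda>(s, t). 1/2 * (\<Sum>k<n. a k * h k s * h k t))
      = (\<Sum>k<n. (a k)\<^sup>2) / 4" for n
  proof -
    have "L2_inner quadrant (\<lambda>(s, t). 1/2 * (\<Sum>k<n. a k * h k s * h k t)) (\<lambda>(s, t). 1/2 * (\<Sum>k<n. a k * h k s * h k t))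
      = (\<integral>z. 1/4 * (\<Sum>j<n. \<Sum>k<n. (a j * a k) * ?g j k z) \<partial>quadrant)"
      unfolding L2_inner_def
      by (intro Bochner_Integration.integral_cong refl) (simp add: split_beta sum_product mult_ac)
    also have "\<dots> = 1/4 * (\<Sum>j<n. \<Sum>k<n. (a j * a k) * (\<integral>z. ?g j k z \<partial>quadrant))"
      by (simp add: Bochner_Integration.integral_sum Bochner_Integration.integrable_sum i)
    also have "\<dots> = (\<Sum>k<n. (a k)\<^sup>2) / 4"
      unfolding v by (simp add: power2_eq_square if_distrib[of "(*) _"] sum.delta cong: if_cong)
    finally show ?thesis .
  qed
  have "(\<lambda>n. (\<Sum>k<n. (a k)\<^sup>2) / 4) \<longlonglongrightarrow> L2_inner quadrant f f"
    using L2_inner_tendsto[OF L L] unfolding n .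
  then have "(\<lambda>n. 4 * ((\<Sum>k<n. (a k)\<^sup>2) / 4)) \<longlonglongrightarrow> 4 * L2_inner quadrant f f" by (intro tendsto_intros)
  then show ?thesis by (simp add: L2_norm_square L2_inner_self)
qed

section \<open>Integrals of the jump density and Herbst's argument\<close>

text \<open>Since every \<open>\<bar>D i\<bar>\<close> is at most \<bar>v\<bar>, the parabola
  through the value of \<open>psi\<close> at \<open>s * \<bar>v\<bar>\<close> dominates each term; a
  bound on the sum of squares thus becomes one on the sum of \<open>psi\<close>.\<close>

lemma sum_psi_increments_le:
  fixes D :: "'i::finite \<Rightarrow> real"
  assumes s: "0 < s" and D: "\<And>i. \<bar>D i\<bar> \<le> \<bar>v\<bar>" and sq: "(\<Sum>i\<in>UNIV. (D i)\<^sup>2) \<le> c * v\<^sup>2"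
  shows "(\<Sum>i\<in>UNIV. psi (s * D i)) \<le> c * psi (s * \<bar>v\<bar>)"
proof (cases "v = 0")
  case True
  then have "D i = 0" for i using D[of i] by simp
  then show ?thesis using True by simp
next
  case False
  have "psi (s * D i) \<le> (D i)\<^sup>2 * (psi (s * \<bar>v\<bar>) / v\<^sup>2)" for i
  proof -
    have "psi (s * D i) \<le> (s * D i)\<^sup>2 * (psi (s * \<bar>v\<bar>) / (s * \<bar>v\<bar>)\<^sup>2)"
      using s False D[of i] by (intro psi_le_quadratic) (auto simp: abs_mult)
    also have "\<dots> = (D i)\<^sup>2 * (psi (s * \<bar>v\<bar>) / v\<^sup>2)"
      using s False by (simp add: power_mult_distrib)
    finally show ?thesis .
  qed
  then have "(\<Sum>i\<in>UNIV. psi (s * D i)) \<le> (\<Sum>i\<in>UNIV. (D i)\<^sup>2 * (psi (s * \<bar>v\<bar>) / v\<^sup>2))"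
    by (rule sum_mono)
  also have "\<dots> = (\<Sum>i\<in>UNIV. (D i)\<^sup>2) * (psi (s * \<bar>v\<bar>) / v\<^sup>2)" by (rule sum_distrib_right[symmetric])
  also have "\<dots> \<le> (c * v\<^sup>2) * (psi (s * \<bar>v\<bar>) / v\<^sup>2)"
    by (intro mult_right_mono sq) (simp add: psi_nonneg)
  also have "\<dots> = c * psi (s * \<bar>v\<bar>)" using False by simp
  finally show ?thesis .
qed

lemma has_integral_power_exp:
  assumes "0 < (l::real)"
  shows "has_bochner_integral lborel (\<lambda>x. if 0 < x then x ^ Suc i * exp (- (l * x)) else 0) (fact (Suc i) / l ^ (i + 2))"
proof -
  have "has_bochner_integral lborel (\<lambda>x. erlang_density 0 l x * x ^ Suc i) (fact (0 + Suc i) / (fact 0 * l ^ Suc i))"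
    by (rule has_bochner_integral_nn_integral)
       (use assms nn_integral_erlang_ith_moment[OF assms, of 0 "Suc i"] in \<open>auto simp: erlang_density_def\<close>)
  then have "has_bochner_integral lborel (\<lambda>x. (1 / l) * (erlang_density 0 l x * x ^ Suc i)) ((1 / l) * (fact (0 + Suc i) / (fact 0 * l ^ Suc i)))"
    by (rule has_bochner_integral_mult_right)
  moreover have "(\<lambda>x. (1 / l) * (erlang_density 0 l x * x ^ Suc i)) = (\<lambda>x. if 0 < x then x ^ Suc i * exp (- (l * x)) else 0)"
    using assms by (auto simp: erlang_density_def fun_eq_iff)
  ultimately show ?thesis using assms by (simp add: mult_ac)
qed

text \<open>The contribution of the quartic part of the increment bound. It splits into elementary
  gamma integrals, of which those with rate \<open>1 - \<tau>\<close> converge because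
  \<open>\<tau> < 1\<close>.\<close>

lemma nn_integral_mult_psi_exp:
  assumes "0 \<le> \<tau>" "\<tau> < 1"
  shows "(\<integral>\<^sup>+u. ennreal (if 0 < u then u * psi (\<tau> * u) * exp (- u) else 0) \<partial>lborel)
    = ennreal (2 * \<tau> / (1 - \<tau>) ^ 3 - 1 / (1 - \<tau>)\<^sup>2 + 1)"
proof -
  let ?f = "\<lambda>i l x. if 0 < x then x ^ Suc i * exp (- (l * x)) else (0::real)"
  have l: "0 < 1 - \<tau>" using assms by simp
  have "has_bochner_integral lborel (\<lambda>u. \<tau> * ?f 1 (1 - \<tau>) u - ?f 0 (1 - \<tau>) u + ?f 0 1 u)
     (\<tau> * (fact (Suc 1) / (1 - \<tau>) ^ (1 + 2)) - fact (Suc 0) / (1 - \<tau>) ^ (0 + 2) + fact (Suc 0) / 1 ^ (0 + 2))"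
    by (intro has_bochner_integral_add has_bochner_integral_diff has_bochner_integral_mult_right has_integral_power_exp l) simp_all
  moreover have "\<tau> * ?f 1 (1 - \<tau>) u - ?f 0 (1 - \<tau>) u + ?f 0 1 u = (if 0 < u then u * psi (\<tau> * u) * exp (- u) else 0)" for u
  proof -
    have "exp (- ((1 - \<tau>) * u)) = exp (\<tau> * u) * exp (- u)" by (simp add: left_diff_distrib flip: exp_add)
    then show ?thesis by (simp add: psi_def power2_eq_square algebra_simps)
  qed
  ultimately have "has_bochner_integral lborel (\<lambda>u. if 0 < u then u * psi (\<tau> * u) * exp (- u) else 0)
     (2 * \<tau> / (1 - \<tau>) ^ 3 - 1 / (1 - \<tau>)\<^sup>2 + 1)"
    by (simp add: numeral_eq_Suc mult.commute)
  then show ?thesis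
    by (subst nn_integral_eq_integral) (auto simp: has_bochner_integral_iff psi_nonneg)
qed

text \<open>Integrate \<open>psi (\<tau> * u) / u = (\<integral>\<sigma>=0..\<tau>. \<sigma> * u * exp (\<sigma> * u))\<close> against \<open>exp (- u)\<close>
  by exchanging the integrals.\<close>

lemma nn_integral_psi_exp_divide:
  assumes "0 \<le> \<tau>" "\<tau> < 1"
  shows "(\<integral>\<^sup>+u. ennreal (if 0 < u then psi (\<tau> * u) * exp (- u) / u else 0) \<partial>lborel)
    = ennreal (\<tau> / (1 - \<tau>) + ln (1 - \<tau>))"
proof -
  let ?k = "\<lambda>\<sigma> u. ennreal (if 0 < u then \<sigma> * (u * exp (- ((1 - \<sigma>) * u))) else 0) * indicator {0..\<tau>} \<sigma>"
  have inner: "(\<integral>\<^sup>+\<sigma>. ?k \<sigma> u \<partial>lborel) = ennreal (if 0 < u then psi (\<tau> * u) * exp (- u) / u else 0)" for u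
  proof (cases "0 < u")
    case True
    have "(\<integral>\<^sup>+\<sigma>. ennreal (\<sigma> * (u * exp (- ((1 - \<sigma>) * u)))) * indicator {0..\<tau>} \<sigma> \<partial>lborel)
       = ennreal (psi (\<tau> * u) * exp (- u) / u - psi (0 * u) * exp (- u) / u)"
    proof (rule nn_integral_FTC_Icc)
      fix \<sigma> :: real assume \<sigma>: "\<sigma> \<in> {0..\<tau>}"
      show "((\<lambda>\<sigma>. psi (\<sigma> * u) * exp (- u) / u) has_real_derivative \<sigma> * (u * exp (- ((1 - \<sigma>) * u)))) (at \<sigma>)"
        unfolding psi_def using True
        by (auto intro!: derivative_eq_intros simp: field_simps exp_diff exp_minus)
      show "0 \<le> \<sigma> * (u * exp (- ((1 - \<sigma>) * u)))" using \<sigma> True by simp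
    qed (use assms in auto)
    then show ?thesis using True by simp
  qed simp
  have outer: "(\<integral>\<^sup>+u. ?k \<sigma> u \<partial>lborel) = ennreal (\<sigma> / (1 - \<sigma>)\<^sup>2) * indicator {0..\<tau>} \<sigma>" for \<sigma>
  proof (cases "\<sigma> \<in> {0..\<tau>}")
    case True
    then have "has_bochner_integral lborel (\<lambda>u. \<sigma> * (if 0 < u then u ^ Suc 0 * exp (- ((1 - \<sigma>) * u)) else 0)) (\<sigma> * (fact (Suc 0) / (1 - \<sigma>) ^ (0 + 2)))"
      using assms by (intro has_bochner_integral_mult_right has_integral_power_exp) auto
    then have "(\<integral>\<^sup>+u. ennreal (\<sigma> * (if 0 < u then u ^ Suc 0 * exp (- ((1 - \<sigma>) * u)) else 0)) \<partial>lborel) = ennreal (\<sigma> * (fact (Suc 0) / (1 - \<sigma>) ^ (0 + 2)))"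
      using True by (subst nn_integral_eq_integral) (auto simp: has_bochner_integral_iff)
    then show ?thesis using True by (simp add: if_distrib[of "(*) _"] power2_eq_square cong: if_cong)
  qed simp
  have "(\<integral>\<^sup>+u. ennreal (if 0 < u then psi (\<tau> * u) * exp (- u) / u else 0) \<partial>lborel) = (\<integral>\<^sup>+u. (\<integral>\<^sup>+\<sigma>. ?k \<sigma> u \<partial>lborel) \<partial>lborel)"
    unfolding inner ..
  also have "\<dots> = (\<integral>\<^sup>+\<sigma>. (\<integral>\<^sup>+u. ?k \<sigma> u \<partial>lborel) \<partial>lborel)"
    by (rule lborel_pair.Fubini') measurable
  also have "\<dots> = (\<integral>\<^sup>+\<sigma>. ennreal (\<sigma> / (1 - \<sigma>)\<^sup>2) * indicator {0..\<tau>} \<sigma> \<partial>lborel)"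
    unfolding outer ..
  also have "\<dots> = ennreal ((1 / (1 - \<tau>) + ln (1 - \<tau>)) - (1 / (1 - 0) + ln (1 - 0)))"
  proof (rule nn_integral_FTC_Icc)
    fix \<sigma> :: real assume \<sigma>: "\<sigma> \<in> {0..\<tau>}"
    then have "0 < 1 - \<sigma>" using assms by auto
    then show "((\<lambda>\<sigma>. 1 / (1 - \<sigma>) + ln (1 - \<sigma>)) has_real_derivative \<sigma> / (1 - \<sigma>)\<^sup>2) (at \<sigma>)"
    proof -
      have "((\<lambda>\<sigma>. 1 / (1 - \<sigma>) + ln (1 - \<sigma>)) has_real_derivative 1 / (1 - \<sigma>)\<^sup>2 - 1 / (1 - \<sigma>)) (at \<sigma>)"
        using \<open>0 < 1 - \<sigma>\<close> by (auto intro!: derivative_eq_intros simp: power2_eq_square)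
      moreover have "1 / (1 - \<sigma>)\<^sup>2 - 1 / (1 - \<sigma>) = \<sigma> / (1 - \<sigma>)\<^sup>2"
        using \<open>0 < 1 - \<sigma>\<close> by (simp add: divide_simps) (simp add: power2_eq_square algebra_simps)
      ultimately show ?thesis by simp
    qed
    show "0 \<le> \<sigma> / (1 - \<sigma>)\<^sup>2" using \<sigma> by simp
  qed (use assms in auto)
  also have "(1 / (1 - \<tau>) + ln (1 - \<tau>)) - (1 / (1 - 0) + ln (1 - 0)) = \<tau> / (1 - \<tau>) + ln (1 - \<tau>)"
    using assms by (simp add: field_simps)
  finally show ?thesis .
qed

text \<open>The integral of the increment bound \<open>8 + 2 * v\<^sup>2 / e\<^sup>2\<close> times
  \<open>psi\<close> over the jumps of scale \<alpha>, with \<open>\<tau> = s * \<alpha>\<close>.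
  The density \<open>exp (- u) / (2 * u)\<close> halves the coefficients 8 and
  \<open>2 * \<alpha>\<^sup>2 / e\<^sup>2\<close>.\<close>

definition jump_const :: "real \<Rightarrow> real \<Rightarrow> real \<Rightarrow> real" where
  "jump_const \<alpha> e \<tau> = 4 * (\<tau> / (1 - \<tau>) + ln (1 - \<tau>)) + \<alpha>\<^sup>2 / e\<^sup>2 * (2 * \<tau> / (1 - \<tau>) ^ 3 - 1 / (1 - \<tau>)\<^sup>2 + 1)"

lemma nn_integral_jump_const:
  assumes "0 \<le> \<tau>" "\<tau> < 1"
  shows "(\<integral>\<^sup>+u. ennreal (if 0 < u then (8 + 2 * (\<alpha> * u)\<^sup>2 / e\<^sup>2) * psi (\<tau> * u) * exp (- u) / (2 * u) else 0) \<partial>lborel)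
    = ennreal (jump_const \<alpha> e \<tau>)" and "0 \<le> jump_const \<alpha> e \<tau>"
proof -
  let ?f = "\<lambda>u. if 0 < u then psi (\<tau> * u) * exp (- u) / u else 0"
  let ?g = "\<lambda>u. if 0 < u then u * psi (\<tau> * u) * exp (- u) else 0"
  have pos: "0 \<le> ?f u" "0 \<le> ?g u" for u by (auto simp: psi_nonneg)
  have fg: "0 \<le> \<tau> / (1 - \<tau>) + ln (1 - \<tau>)" "0 \<le> 2 * \<tau> / (1 - \<tau>) ^ 3 - 1 / (1 - \<tau>)\<^sup>2 + 1"
  proof -
    have "1 - 1 / (1 - \<tau>) \<le> ln (1 - \<tau>)" using assms ln_le_minus_one[of "1 / (1 - \<tau>)"] by (simp add: ln_div)
    moreover have "1 - 1 / (1 - \<tau>) = - (\<tau> / (1 - \<tau>))" using assms by (simp add: field_simps)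
    ultimately show "0 \<le> \<tau> / (1 - \<tau>) + ln (1 - \<tau>)" by simp
    have "1 / (1 - \<tau>)\<^sup>2 - 1 = \<tau> * (2 - \<tau>) / (1 - \<tau>)\<^sup>2" using assms by (simp add: divide_simps) (simp add: power2_eq_square algebra_simps)
    also have "\<dots> \<le> \<tau> * 2 / (1 - \<tau>)\<^sup>2" using assms by (intro divide_right_mono mult_left_mono) auto
    also have "\<dots> \<le> \<tau> * 2 / (1 - \<tau>) ^ 3"
      using assms by (intro divide_left_mono power_decreasing) auto
    finally show "0 \<le> 2 * \<tau> / (1 - \<tau>) ^ 3 - 1 / (1 - \<tau>)\<^sup>2 + 1" by (simp add: mult.commute)
  qed
  have em: "ennreal (p * x + q * y) = ennreal p * ennreal x + ennreal q * ennreal y"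
    if "0 \<le> p" "0 \<le> x" "0 \<le> q" "0 \<le> y" for p q x y
    using that by (simp add: ennreal_mult)
  show "0 \<le> jump_const \<alpha> e \<tau>" unfolding jump_const_def
    by (rule add_nonneg_nonneg[OF mult_nonneg_nonneg[OF _ fg(1)] mult_nonneg_nonneg[OF _ fg(2)]]) auto
  have "(\<integral>\<^sup>+u. ennreal (if 0 < u then (8 + 2 * (\<alpha> * u)\<^sup>2 / e\<^sup>2) * psi (\<tau> * u) * exp (- u) / (2 * u) else 0) \<partial>lborel)
     = (\<integral>\<^sup>+u. ennreal 4 * ennreal (?f u) + ennreal (\<alpha>\<^sup>2 / e\<^sup>2) * ennreal (?g u) \<partial>lborel)"
  proof (rule nn_integral_cong)
    fix u :: real
    have "(if 0 < u then (8 + 2 * (\<alpha> * u)\<^sup>2 / e\<^sup>2) * psi (\<tau> * u) * exp (- u) / (2 * u) else 0) = 4 * ?f u + \<alpha>\<^sup>2 / e\<^sup>2 * ?g u"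
      by (cases "e = 0") (simp_all add: field_simps power2_eq_square)
    note split = this
    show "ennreal (if 0 < u then (8 + 2 * (\<alpha> * u)\<^sup>2 / e\<^sup>2) * psi (\<tau> * u) * exp (- u) / (2 * u) else 0)
       = ennreal 4 * ennreal (?f u) + ennreal (\<alpha>\<^sup>2 / e\<^sup>2) * ennreal (?g u)"
      unfolding split by (rule em) (simp_all add: psi_nonneg)
  qed
  also have "\<dots> = ennreal 4 * (\<integral>\<^sup>+u. ennreal (?f u) \<partial>lborel) + ennreal (\<alpha>\<^sup>2 / e\<^sup>2) * (\<integral>\<^sup>+u. ennreal (?g u) \<partial>lborel)"
    by (subst nn_integral_add, measurable, subst (1 2) nn_integral_cmult) auto
  also have "\<dots> = ennreal 4 * ennreal (\<tau> / (1 - \<tau>) + ln (1 - \<tau>)) + ennreal (\<alpha>\<^sup>2 / e\<^sup>2) * ennreal (2 * \<tau> / (1 - \<tau>) ^ 3 - 1 / (1 - \<tau>)\<^sup>2 + 1)"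
    unfolding nn_integral_mult_psi_exp[OF assms] nn_integral_psi_exp_divide[OF assms] ..
  also have "\<dots> = ennreal (jump_const \<alpha> e \<tau>)"
    unfolding jump_const_def by (rule em[symmetric, OF _ fg(1) _ fg(2)]) simp_all
  finally show "(\<integral>\<^sup>+u. ennreal (if 0 < u then (8 + 2 * (\<alpha> * u)\<^sup>2 / e\<^sup>2) * psi (\<tau> * u) * exp (- u) / (2 * u) else 0) \<partial>lborel)
    = ennreal (jump_const \<alpha> e \<tau>)" .
qed

text \<open>After rescaling to a common density, \<open>psi_scale_le\<close> with ratio
  \<open>\<bar>c\<bar> / \<alpha>\<close> extracts the factor
  \<open>c\<^sup>2 / \<alpha>\<^sup>2\<close>, while the polynomial weight is simply enlarged to
  scale \<alpha>.\<close>

lemma nn_integral_psi_gamma_jump_le: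
  assumes c: "\<bar>c\<bar> \<le> \<alpha>" and s: "0 < s" "s * \<alpha> < 1" and \<alpha>: "0 < \<alpha>"
  shows "(\<integral>\<^sup>+v. ennreal ((8 + 2 * v\<^sup>2 / e\<^sup>2) * psi (s * \<bar>v\<bar>)) * gamma_jump c v \<partial>lborel)
     \<le> ennreal (c\<^sup>2 / \<alpha>\<^sup>2 * jump_const \<alpha> e (s * \<alpha>))"
proof (cases "c = 0")
  case True
  then show ?thesis by (simp add: gamma_jump_def)
next
  case False
  let ?h = "\<lambda>u. if 0 < u then (8 + 2 * (\<alpha> * u)\<^sup>2 / e\<^sup>2) * psi (s * \<alpha> * u) * exp (- u) / (2 * u) else 0"
  have a0: "0 \<le> 8 + 2 * (\<alpha> * u)\<^sup>2 / e\<^sup>2" for u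
    by (intro add_nonneg_nonneg divide_nonneg_nonneg) auto
  have h0: "0 \<le> ?h u" for u
    by (auto intro!: divide_nonneg_pos mult_nonneg_nonneg psi_nonneg a0)
  let ?F = "\<lambda>v. (8 + 2 * v\<^sup>2 / e\<^sup>2) * psi (s * \<bar>v\<bar>)" and ?k = "\<lambda>u::real. if 0 < u then exp (- u) / (2 * u) else 0"
  have "(\<integral>\<^sup>+v. ennreal (?F v) * gamma_jump c v \<partial>lborel) = (\<integral>\<^sup>+u. ennreal (?F (c * u)) * ennreal (?k u) \<partial>lborel)"
    by (rule nn_integral_gamma_jump[OF _ False]) measurable
  also have "\<dots> \<le> (\<integral>\<^sup>+u. ennreal (c\<^sup>2 / \<alpha>\<^sup>2) * ennreal (?h u) \<partial>lborel)"
  proof (rule nn_integral_mono)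
    fix u
    show "ennreal (?F (c * u)) * ennreal (?k u) \<le> ennreal (c\<^sup>2 / \<alpha>\<^sup>2) * ennreal (?h u)"
    proof (cases "0 < u")
      case True
      have p: "psi (s * \<bar>c * u\<bar>) \<le> c\<^sup>2 / \<alpha>\<^sup>2 * psi (s * \<alpha> * u)"
      proof -
        have "psi (\<bar>c\<bar> / \<alpha> * (s * \<alpha> * u)) \<le> (\<bar>c\<bar> / \<alpha>)\<^sup>2 * psi (s * \<alpha> * u)"
          using c s \<alpha> True by (intro psi_scale_le) auto
        moreover have "\<bar>c\<bar> / \<alpha> * (s * \<alpha> * u) = s * \<bar>c * u\<bar>" using \<alpha> True by (simp add: abs_mult)
        ultimately show ?thesis by (simp add: power_divide)
      qed
      have q: "8 + 2 * (c * u)\<^sup>2 / e\<^sup>2 \<le> 8 + 2 * (\<alpha> * u)\<^sup>2 / e\<^sup>2"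
      proof -
        have "(c * u)\<^sup>2 \<le> (\<alpha> * u)\<^sup>2" using c True \<alpha> unfolding abs_le_square_iff[symmetric] abs_mult by (intro mult_mono) auto
        then show ?thesis by (simp add: divide_right_mono)
      qed
      have "?F (c * u) \<le> (8 + 2 * (\<alpha> * u)\<^sup>2 / e\<^sup>2) * (c\<^sup>2 / \<alpha>\<^sup>2 * psi (s * \<alpha> * u))"
        using q p a0[of u] by (intro mult_mono) (auto simp: psi_nonneg)
      then have "?F (c * u) * ?k u \<le> (8 + 2 * (\<alpha> * u)\<^sup>2 / e\<^sup>2) * (c\<^sup>2 / \<alpha>\<^sup>2 * psi (s * \<alpha> * u)) * ?k u"
        using True by (intro mult_right_mono) auto
      also have "\<dots> = c\<^sup>2 / \<alpha>\<^sup>2 * ?h u" using True by simp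
      finally have "ennreal (?F (c * u) * ?k u) \<le> ennreal (c\<^sup>2 / \<alpha>\<^sup>2 * ?h u)" by (rule ennreal_leI)
      moreover have "ennreal (?F (c * u) * ?k u) = ennreal (?F (c * u)) * ennreal (?k u)"
        by (rule ennreal_mult'') (use True in auto)
      moreover have "ennreal (c\<^sup>2 / \<alpha>\<^sup>2 * ?h u) = ennreal (c\<^sup>2 / \<alpha>\<^sup>2) * ennreal (?h u)"
        by (rule ennreal_mult) (use h0 in auto)
      ultimately show ?thesis by (simp only:)
    qed simp
  qed
  also have "\<dots> = ennreal (c\<^sup>2 / \<alpha>\<^sup>2) * ennreal (jump_const \<alpha> e (s * \<alpha>))"
    using s \<alpha> by (subst nn_integral_cmult) (auto simp: nn_integral_jump_const)
  also have "\<dots> = ennreal (c\<^sup>2 / \<alpha>\<^sup>2 * jump_const \<alpha> e (s * \<alpha>))"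
    using s \<alpha> by (intro ennreal_mult[symmetric] nn_integral_jump_const) auto
  finally show ?thesis .
qed

section \<open>From entropy bounds to exponential moments\<close>

lemma abs_exp_diff_le: "\<bar>exp x - exp y\<bar> \<le> \<bar>x - y\<bar> * exp (max x y)" for x y :: real
proof -
  have *: "exp x - exp y \<le> (x - y) * exp x" for x y :: real
  proof -
    have "1 + (y - x) \<le> exp (y - x)" by (rule exp_ge_add_one_self)
    then have "exp x * (1 + (y - x)) \<le> exp x * exp (y - x)" by (rule mult_left_mono) simp
    also have "exp x * exp (y - x) = exp y" by (simp flip: exp_add)
    finally show ?thesis by (simp add: algebra_simps)
  qed
  show ?thesis using *[of x y] *[of y x] by (cases "x \<le> y") (auto simp: max_def abs_if)
qed

text \<open>Differentiation under the integral: a null sequence of increments is bounded by some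
  \<open>H\<close>, so the difference quotients are dominated by a constant.\<close>

lemma (in prob_space) DERIV_integral_exp:
  assumes [measurable]: "g \<in> borel_measurable M" and g: "\<And>x. 0 \<le> g x" "\<And>x. g x \<le> R"
  shows "((\<lambda>s. \<integral>x. exp (s * g x) \<partial>M) has_real_derivative (\<integral>x. g x * exp (s * g x) \<partial>M)) (at s)"
  unfolding DERIV_def tendsto_at_iff_sequentially
proof (intro allI impI)
  fix h :: "nat \<Rightarrow> real" assume h: "\<forall>i. h i \<in> UNIV - {0}" "h \<longlonglongrightarrow> 0"
  have R: "0 \<le> R" using g[of undefined] by linarith
  have "Bseq h" using h(2) by (intro convergent_imp_Bseq convergentI)
  then obtain H where H: "0 < H" "\<And>n. \<bar>h n\<bar> \<le> H" by (auto elim: BseqE)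
  have b: "\<bar>(exp ((s + h n) * g x) - exp (s * g x)) / h n\<bar> \<le> R * exp ((\<bar>s\<bar> + H) * R)" for n x
  proof -
    have hn: "h n \<noteq> 0" using h(1) by simp
    have m: "(s + h n) * g x \<le> (\<bar>s\<bar> + H) * R" "s * g x \<le> (\<bar>s\<bar> + H) * R"
      using g[of x] H(1) H(2)[of n] R by (auto intro!: mult_mono)
    have "\<bar>exp ((s + h n) * g x) - exp (s * g x)\<bar> \<le> \<bar>(s + h n) * g x - s * g x\<bar> * exp (max ((s + h n) * g x) (s * g x))"
      by (rule abs_exp_diff_le)
    also have "\<dots> \<le> (\<bar>h n\<bar> * R) * exp ((\<bar>s\<bar> + H) * R)"
      using g[of x] m by (intro mult_mono) (auto simp: distrib_right abs_mult intro!: mult_left_mono)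
    finally show ?thesis using hn by (simp add: field_simps)
  qed
  have i: "integrable M (\<lambda>x. exp (r * g x))" for r
  proof (rule integrable_bounded)
    show "\<bar>exp (r * g x)\<bar> \<le> exp (\<bar>r\<bar> * R)" for x
      using g[of x] R by (auto intro!: mult_mono)
  qed simp
  have "(\<lambda>n. \<integral>x. (exp ((s + h n) * g x) - exp (s * g x)) / h n \<partial>M) \<longlonglongrightarrow> (\<integral>x. g x * exp (s * g x) \<partial>M)"
  proof (rule integral_dominated_convergence[where w = "\<lambda>_. R * exp ((\<bar>s\<bar> + H) * R)"])
    show "AE x in M. (\<lambda>n. (exp ((s + h n) * g x) - exp (s * g x)) / h n) \<longlonglongrightarrow> g x * exp (s * g x)"
    proof (intro AE_I2)
      fix x
      have "((\<lambda>s. exp (s * g x)) has_real_derivative g x * exp (s * g x)) (at s)"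
        by (auto intro!: derivative_eq_intros)
      then show "(\<lambda>n. (exp ((s + h n) * g x) - exp (s * g x)) / h n) \<longlonglongrightarrow> g x * exp (s * g x)"
        unfolding DERIV_def tendsto_at_iff_sequentially using h by (auto simp: comp_def)
    qed
  qed (use b in auto)
  then show "((\<lambda>h. ((\<integral>x. exp ((s + h) * g x) \<partial>M) - (\<integral>x. exp (s * g x) \<partial>M)) / h) \<circ> h) \<longlonglongrightarrow> (\<integral>x. g x * exp (s * g x) \<partial>M)"
    using i by (simp add: comp_def)
qed

text \<open>Herbst's argument: the hypotheses say that \<open>ln (\<integral>x. exp (s * g x) \<partial>M) / s - \<kappa> s / s\<close> is
  nonincreasing in \<open>s\<close>.\<close>

lemma (in prob_space) Herbst:
  assumes [measurable]: "g \<in> borel_measurable M" and g: "\<And>x. 0 \<le> g x" "\<And>x. g x \<le> R"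
    and t: "0 < t"
    and ent: "\<And>s. 0 < s \<Longrightarrow> s \<le> t \<Longrightarrow> Ent M (\<lambda>x. exp (s * g x)) \<le> \<delta> s * (\<integral>x. exp (s * g x) \<partial>M)"
    and \<kappa>: "\<And>s. 0 \<le> s \<Longrightarrow> s \<le> t \<Longrightarrow> (\<kappa> has_real_derivative \<kappa>' s) (at s)" "\<kappa> 0 = 0" "\<kappa>' 0 = 0"
    and \<delta>: "\<And>s. 0 < s \<Longrightarrow> s \<le> t \<Longrightarrow> s * \<kappa>' s - \<kappa> s = \<delta> s"
  shows "(\<integral>x. exp (t * g x) \<partial>M) \<le> exp (t * (\<integral>x. g x \<partial>M) + \<kappa> t)"
proof -
  define L where "L s = (\<integral>x. exp (s * g x) \<partial>M)" for s
  define L' where "L' s = (\<integral>x. g x * exp (s * g x) \<partial>M)" for s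
  have R: "0 \<le> R" using g[of undefined] by linarith
  have bnd: "\<bar>s * g x\<bar> \<le> \<bar>s\<bar> * R" for s x using g[of x] R by (auto simp: abs_mult intro!: mult_mono)
  have pb: "positive_bounded (\<lambda>x. exp (s * g x))" for s by (rule positive_bounded_exp[OF bnd])
  have Lpos: "0 < L s" for s unfolding L_def by (rule integral_positive_bounded[OF _ pb]) simp
  have DL: "(L has_real_derivative L' s) (at s)" for s
    unfolding L_def L'_def by (rule DERIV_integral_exp[OF _ g]) simp
  define N where "N s = ln (L s) - \<kappa> s" for s
  have DN: "(N has_real_derivative L' s / L s - \<kappa>' s) (at s)" if "0 \<le> s" "s \<le> t" for s
    unfolding N_def using Lpos[of s] DL[of s] \<kappa>(1)[OF that]
    by (auto intro!: derivative_eq_intros)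
  have N0: "N 0 = 0" by (simp add: N_def L_def \<kappa> prob_space)
  have dec: "N t / t \<le> N s / s" if s: "0 < s" "s \<le> t" for s
  proof (rule DERIV_nonpos_imp_nonincreasing[OF s(2), where f = "\<lambda>s. N s / s"])
    fix r assume r: "s \<le> r" "r \<le> t"
    then have r0: "0 < r" using s by simp
    have "((\<lambda>s. N s / s) has_real_derivative (r * (L' r / L r - \<kappa>' r) - N r) / r\<^sup>2) (at r)"
      using DN[of r] r r0 by (auto intro!: derivative_eq_intros simp: power2_eq_square field_simps)
    \<comment> \<open>After division by \<open>L r\<close> the entropy hypothesis bounds
      \<open>r * L' r / L r - ln (L r)\<close> by \<open>\<delta> r\<close>, which is exactly what
      \<open>\<kappa>\<close> subtracts.\<close>
    moreover have "r * (L' r / L r - \<kappa>' r) - N r \<le> 0"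
    proof -
      have "Ent M (\<lambda>x. exp (r * g x)) = r * L' r - L r * ln (L r)"
        unfolding Ent_def L_def L'_def by (simp add: mult_ac)
      then have "r * L' r - L r * ln (L r) \<le> \<delta> r * L r" using ent[OF r0 r(2)] by (simp add: L_def)
      then have "r * (L' r / L r) - ln (L r) \<le> \<delta> r" using Lpos[of r] by (simp add: field_simps)
      then show ?thesis using \<delta>[OF r0 r(2)] by (simp add: N_def algebra_simps)
    qed
    ultimately show "\<exists>y. ((\<lambda>s. N s / s) has_real_derivative y) (at r) \<and> y \<le> 0"
      by (intro exI conjI) (auto intro: divide_nonpos_nonneg)
  qed
  \<comment> \<open>\<open>N 0 = 0\<close>, so \<open>N s / s\<close> tends to the derivative of
    \<open>N\<close> at 0, which is the mean of \<open>g\<close> because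
    \<open>\<kappa>' 0 = 0\<close>.\<close>
  have "(N has_real_derivative (\<integral>x. g x \<partial>M)) (at 0)"
    using DN[of 0] t by (simp add: \<kappa> L_def L'_def prob_space)
  then have "((\<lambda>s. N s / s) \<longlongrightarrow> (\<integral>x. g x \<partial>M)) (at 0)" by (simp add: DERIV_def N0)
  then have "((\<lambda>s. N s / s) \<longlongrightarrow> (\<integral>x. g x \<partial>M)) (at_right 0)" by (rule tendsto_within_subset) simp
  moreover have "\<forall>\<^sub>F s in at_right 0. N t / t \<le> N s / s"
    unfolding eventually_at_right_field using t dec by (intro exI[of _ t]) auto
  ultimately have "N t / t \<le> (\<integral>x. g x \<partial>M)"
    by (intro tendsto_lowerbound) auto
  then have "ln (L t) \<le> t * (\<integral>x. g x \<partial>M) + \<kappa> t" using t by (simp add: N_def field_simps)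
  then have "exp (ln (L t)) \<le> exp (t * (\<integral>x. g x \<partial>M) + \<kappa> t)" by simp
  moreover have "exp (ln (L t)) = L t" using Lpos[of t] by simp
  ultimately show ?thesis by (simp only: L_def)
qed

section \<open>Deviation of the Euclidean norm\<close>

text \<open>\<open>PiM\<close> lives on functions, whereas the Euclidean norm belongs to the vector
  type; this is the bridge.\<close>

definition vec_norm :: "('n::finite \<Rightarrow> real) \<Rightarrow> real" where
  "vec_norm z = norm (\<chi> i. z i)"

lemma vec_norm_square: "(vec_norm z)\<^sup>2 = (\<Sum>i\<in>UNIV. (z i)\<^sup>2)"
  by (simp add: vec_norm_def norm_vec_def L2_set_def sum_nonneg)

lemma vec_norm_nonneg [simp]: "0 \<le> vec_norm z"
  by (simp add: vec_norm_def)

lemma borel_measurable_vec_norm: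
  fixes f :: "'a \<Rightarrow> 'n::finite \<Rightarrow> real"
  assumes [measurable]: "\<And>i. (\<lambda>x. f x i) \<in> borel_measurable M"
  shows "(\<lambda>x. vec_norm (f x)) \<in> borel_measurable M"
  unfolding vec_norm_def norm_vec_def L2_set_def by simp

lemma abs_vec_norm_upd_diff_le: "\<bar>vec_norm (z(i := z i + v)) - vec_norm z\<bar> \<le> \<bar>v\<bar>"
proof -
  have "(\<chi> j. (z(i := z i + v)) j) - (\<chi> j. z j) = v *\<^sub>R axis i 1"
    by (auto simp: vec_eq_iff axis_def)
  then have *: "norm ((\<chi> j. (z(i := z i + v)) j) - (\<chi> j. z j)) = \<bar>v\<bar>" by (simp only: norm_scaleR norm_axis_1)
  show ?thesis
    unfolding vec_norm_def by (rule order_trans[OF norm_triangle_ineq3 eq_refl[OF *]])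
qed

text \<open>Taken in expectation, this yields \<open>sqrt n * e \<le> m\<close>, the lower bound on
  the mean norm that cancels the dimension.\<close>

lemma sum_abs_le_vec_norm: "(\<Sum>i\<in>UNIV. \<bar>z i\<bar>) \<le> sqrt CARD('n) * vec_norm (z :: 'n::finite \<Rightarrow> real)"
proof -
  have "(\<Sum>i\<in>UNIV. 1 * \<bar>z i\<bar>)\<^sup>2 \<le> (\<Sum>i\<in>(UNIV::'n set). 1\<^sup>2) * (\<Sum>i\<in>UNIV. \<bar>z i\<bar>\<^sup>2)"
    by (rule Cauchy_Schwarz_ineq_sum)
  then have "(\<Sum>i\<in>UNIV. \<bar>z i\<bar>)\<^sup>2 \<le> (sqrt CARD('n) * vec_norm z)\<^sup>2"
    by (simp add: power_mult_distrib vec_norm_square)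
  then show ?thesis by (rule power2_le_imp_le) simp
qed

lemma vec_norm_le_sum_abs: "vec_norm z \<le> (\<Sum>i\<in>UNIV. \<bar>z i\<bar>)"
  unfolding vec_norm_def using norm_le_l1_cart[of "\<chi> i. z i"] by simp

text \<open>The cut at \<open>m\<close> from below serves the dimension-free increment bound; the
  cap \<open>R\<close> makes the function bounded, as the Sobolev inequality and Herbst's argument
  require.\<close>

definition truncated_norm :: "real \<Rightarrow> real \<Rightarrow> ('n::finite \<Rightarrow> real) \<Rightarrow> real" where
  "truncated_norm m R z = min R (max 0 (vec_norm z - m))"

lemma truncated_norm_diff_le:
  "\<bar>truncated_norm m R z' - truncated_norm m R z\<bar> \<le> \<bar>vec_norm z' - vec_norm z\<bar>"
  unfolding truncated_norm_def by (auto simp: min_def max_def abs_if)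

lemma truncated_norm_upd_diff_le:
  "\<bar>truncated_norm m R (z(i := z i + v)) - truncated_norm m R z\<bar> \<le> \<bar>v\<bar>"
  using truncated_norm_diff_le abs_vec_norm_upd_diff_le by (rule order_trans)

text \<open>An increment of \<open>truncated_norm m R\<close> vanishes unless one of the two norms exceeds \<open>m\<close>; otherwise
  their sum is at least \<open>max m (vec_norm z)\<close>. With \<open>m \<ge> sqrt n * e\<close> this makes the bound free of
  the dimension \<open>n\<close>.\<close>

lemma sum_square_truncated_norm_diff_le:
  fixes z :: "'n::finite \<Rightarrow> real"
  assumes m: "0 < m" "sqrt CARD('n) * e \<le> m" and e: "0 < e" and R: "0 \<le> R"
  shows "(\<Sum>i\<in>UNIV. (truncated_norm m R (z(i := z i + v)) - truncated_norm m R z)\<^sup>2) \<le> (8 + 2 * v\<^sup>2 / e\<^sup>2) * v\<^sup>2"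
proof -
  define D where "D = max m (vec_norm z)"
  have D: "0 < D" "m \<le> D" "vec_norm z \<le> D" using m(1) by (auto simp: D_def)
  have one: "(truncated_norm m R (z(i := z i + v)) - truncated_norm m R z)\<^sup>2 \<le> (8 * v\<^sup>2 * (z i)\<^sup>2 + 2 * v ^ 4) / D\<^sup>2" for i
  proof -
    let ?z = "z(i := z i + v)"
    let ?\<Delta> = "truncated_norm m R ?z - truncated_norm m R z"
    have "\<bar>?\<Delta>\<bar> * D \<le> 2 * \<bar>v\<bar> * \<bar>z i\<bar> + v\<^sup>2"
    proof (cases "vec_norm z \<le> m \<and> vec_norm ?z \<le> m")
      case True
      then have "?\<Delta> = 0" by (simp add: truncated_norm_def max.absorb1)
      then show ?thesis by simp
    next
      case False
      then have "D \<le> vec_norm ?z + vec_norm z" unfolding D_def using vec_norm_nonneg[of z] vec_norm_nonneg[of ?z] by linarith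
      \<comment> \<open>Multiplying by the sum of the two norms produces a difference of squared
        norms, in which only coordinate \<open>i\<close> survives.\<close>
      then have "\<bar>?\<Delta>\<bar> * D \<le> \<bar>vec_norm ?z - vec_norm z\<bar> * (vec_norm ?z + vec_norm z)"
        using D(1) by (intro mult_mono truncated_norm_diff_le) auto
      also have "\<dots> = \<bar>(vec_norm ?z)\<^sup>2 - (vec_norm z)\<^sup>2\<bar>"
        by (simp add: power2_eq_square square_diff_square_factored abs_mult mult.commute)
      also have "(vec_norm ?z)\<^sup>2 - (vec_norm z)\<^sup>2 = 2 * v * z i + v\<^sup>2"
      proof -
        have "(\<Sum>j\<in>UNIV. (?z j)\<^sup>2) = (z i + v)\<^sup>2 + (\<Sum>j\<in>UNIV - {i}. (z j)\<^sup>2)"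
          by (subst sum.remove[of _ i]) (auto intro!: sum.cong)
        moreover have "(\<Sum>j\<in>UNIV. (z j)\<^sup>2) = (z i)\<^sup>2 + (\<Sum>j\<in>UNIV - {i}. (z j)\<^sup>2)"
          by (subst sum.remove[of _ i]) auto
        ultimately show ?thesis unfolding vec_norm_square by (simp add: power2_eq_square algebra_simps)
      qed
      also have "\<bar>2 * v * z i + v\<^sup>2\<bar> \<le> 2 * \<bar>v\<bar> * \<bar>z i\<bar> + v\<^sup>2"
        using abs_triangle_ineq[of "2 * v * z i" "v\<^sup>2"] by (simp add: abs_mult)
      finally show ?thesis .
    qed
    then have "(\<bar>?\<Delta>\<bar> * D)\<^sup>2 \<le> (2 * \<bar>v\<bar> * \<bar>z i\<bar> + v\<^sup>2)\<^sup>2" using D(1) by (intro power_mono) auto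
    also have "\<dots> \<le> 2 * (2 * \<bar>v\<bar> * \<bar>z i\<bar>)\<^sup>2 + 2 * (v\<^sup>2)\<^sup>2"
      using sum_squares_bound[of "2 * \<bar>v\<bar> * \<bar>z i\<bar>" "v\<^sup>2"] by (simp add: power2_sum)
    also have "\<dots> = 8 * v\<^sup>2 * (z i)\<^sup>2 + 2 * v ^ 4" by (simp add: power_mult_distrib)
    finally show ?thesis using D(1) by (simp add: power_mult_distrib field_simps)
  qed
  have "(\<Sum>i\<in>UNIV. (truncated_norm m R (z(i := z i + v)) - truncated_norm m R z)\<^sup>2) \<le> (\<Sum>i\<in>(UNIV::'n set). (8 * v\<^sup>2 * (z i)\<^sup>2 + 2 * v ^ 4) / D\<^sup>2)"
    by (intro sum_mono one)
  also have "\<dots> = (8 * v\<^sup>2 * (vec_norm z)\<^sup>2 + CARD('n) * (2 * v ^ 4)) / D\<^sup>2"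
    by (simp add: sum_divide_distrib[symmetric] sum.distrib sum_distrib_left[symmetric] vec_norm_square)
  also have "\<dots> \<le> (8 * v\<^sup>2 * D\<^sup>2 + D\<^sup>2 / e\<^sup>2 * (2 * v ^ 4)) / D\<^sup>2"
  proof (intro divide_right_mono add_mono mult_left_mono mult_right_mono)
    show "(vec_norm z)\<^sup>2 \<le> D\<^sup>2" using D by (intro power_mono) auto
    \<comment> \<open>The \<open>v ^ 4\<close> term is summed over all coordinates; here the
      resulting factor \<open>n\<close> is absorbed by \<open>D\<^sup>2 / e\<^sup>2\<close>.\<close>
    have "(sqrt CARD('n) * e)\<^sup>2 \<le> D\<^sup>2" using m(2) D(2) e by (intro power_mono) auto
    then show "real CARD('n) \<le> D\<^sup>2 / e\<^sup>2" using e by (simp add: power_mult_distrib field_simps)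
  qed auto
  also have "\<dots> = (8 + 2 * v\<^sup>2 / e\<^sup>2) * v\<^sup>2"
    using D(1) e by (simp add: field_simps power2_eq_square power4_eq_xxxx)
  finally show ?thesis .
qed

section \<open>Entropy and deviation of the truncated norm\<close>

text \<open>Replacing a coordinate by an independent copy preserves the product law. This removes
  the inner integral that the one-dimensional inequality leaves behind.\<close>

lemma nn_integral_PiM_resample:
  fixes \<mu> :: "'a measure" and \<Phi> :: "('n::finite \<Rightarrow> 'a) \<Rightarrow> ennreal"
  assumes \<mu>: "prob_space \<mu>" and [measurable]: "\<Phi> \<in> borel_measurable (PiM UNIV (\<lambda>_. \<mu>))"
  shows "(\<integral>\<^sup>+z. (\<integral>\<^sup>+x. \<Phi> (z(i := x)) \<partial>\<mu>) \<partial>PiM UNIV (\<lambda>_::'n. \<mu>)) = (\<integral>\<^sup>+z. \<Phi> z \<partial>PiM UNIV (\<lambda>_. \<mu>))"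
proof -
  interpret m: prob_space \<mu> by fact
  interpret product_prob_space "\<lambda>_::'n. \<mu>" UNIV by (intro product_prob_spaceI \<mu>)
  let ?I = "UNIV - {i}"
  have U: "UNIV = insert i ?I" by auto
  have fin: "finite ?I" "i \<notin> ?I" by auto
  have f: "\<Phi> \<in> borel_measurable (PiM (insert i ?I) (\<lambda>_. \<mu>))" using assms(2) by (simp flip: U)
  have upd: "(\<lambda>(z, x). z(i := x)) \<in> measurable (PiM (insert i ?I) (\<lambda>_. \<mu>) \<Otimes>\<^sub>M \<mu>) (PiM (insert i ?I) (\<lambda>_. \<mu>))"
    unfolding split_beta' by (rule measurable_fun_upd[where J = "insert i ?I"]) auto
  have g: "(\<lambda>z. \<integral>\<^sup>+x. \<Phi> (z(i := x)) \<partial>\<mu>) \<in> borel_measurable (PiM (insert i ?I) (\<lambda>_. \<mu>))"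
    using measurable_compose[OF upd f] by (intro m.borel_measurable_nn_integral) (simp add: split_beta')
  have "(\<integral>\<^sup>+z. (\<integral>\<^sup>+x. \<Phi> (z(i := x)) \<partial>\<mu>) \<partial>PiM (insert i ?I) (\<lambda>_. \<mu>))
     = (\<integral>\<^sup>+z. (\<integral>\<^sup>+y. (\<integral>\<^sup>+x. \<Phi> ((z(i := y))(i := x)) \<partial>\<mu>) \<partial>\<mu>) \<partial>PiM ?I (\<lambda>_. \<mu>))"
    by (rule product_nn_integral_insert[OF fin g])
  also have "\<dots> = (\<integral>\<^sup>+z. (\<integral>\<^sup>+x. \<Phi> (z(i := x)) \<partial>\<mu>) \<partial>PiM ?I (\<lambda>_. \<mu>))"
    by (simp add: m.emeasure_space_1)
  also have "\<dots> = (\<integral>\<^sup>+z. \<Phi> z \<partial>PiM (insert i ?I) (\<lambda>_. \<mu>))"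
    by (rule product_nn_integral_insert[OF fin f, symmetric])
  finally show ?thesis by (simp flip: U)
qed

lemma Ent_PiM_le_nn_integral:
  fixes \<mu> :: "'a measure" and f :: "('n::finite \<Rightarrow> 'a) \<Rightarrow> real"
  assumes \<mu>: "prob_space \<mu>" and [measurable]: "f \<in> borel_measurable (PiM UNIV (\<lambda>_. \<mu>))" and pb: "positive_bounded f"
  shows "ennreal (Ent (PiM UNIV (\<lambda>_. \<mu>)) f) \<le> (\<Sum>i\<in>UNIV. \<integral>\<^sup>+z. ennreal (Ent \<mu> (\<lambda>u. f (z(i := u)))) \<partial>PiM UNIV (\<lambda>_. \<mu>))"
proof -
  let ?P = "PiM UNIV (\<lambda>_::'n. \<mu>)"
  interpret prob_space ?P by (rule prob_space_PiM[OF \<mu>])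
  have sum_le: "ennreal (\<Sum>i\<in>I. F i) \<le> (\<Sum>i\<in>I. ennreal (F i))" if "finite I" for I and F :: "'n \<Rightarrow> real"
    using that by induction (auto intro: order_trans[OF ennreal_add_le] add_left_mono)
  have int: "integrable ?P (\<lambda>z. Ent \<mu> (\<lambda>u. f (z(i := u))))" for i
  proof (rule integrable_Ent[OF \<mu> _ pb])
    have "(\<lambda>(z, x). z(i := x)) \<in> measurable (?P \<Otimes>\<^sub>M \<mu>) ?P"
      unfolding split_beta' by (rule measurable_fun_upd[where J = UNIV]) auto
    from measurable_compose[OF this assms(2)] show "(\<lambda>(z, u). f (z(i := u))) \<in> borel_measurable (?P \<Otimes>\<^sub>M \<mu>)"
      by (simp add: split_beta')
  qed
  have "ennreal (Ent ?P f) \<le> ennreal (\<Sum>i\<in>UNIV. \<integral>z. Ent \<mu> (\<lambda>u. f (z(i := u))) \<partial>?P)"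
    by (intro ennreal_leI Ent_PiM_le \<mu> pb) auto
  also have "\<dots> \<le> (\<Sum>i\<in>UNIV. ennreal (\<integral>z. Ent \<mu> (\<lambda>u. f (z(i := u))) \<partial>?P))" by (rule sum_le) simp
  also have "\<dots> \<le> (\<Sum>i\<in>UNIV. \<integral>\<^sup>+z. ennreal (Ent \<mu> (\<lambda>u. f (z(i := u)))) \<partial>?P)"
    by (intro sum_mono ennreal_integral_le_nn_integral int)
  finally show ?thesis .
qed

lemma nn_integral_psi_jumps_le:
  assumes a: "\<And>k. \<bar>a k\<bar> \<le> \<alpha>" "\<And>n. (\<Sum>k<n. (a k)\<^sup>2) \<le> S" and s: "0 < s" "s * \<alpha> < 1" and \<alpha>: "0 < \<alpha>"
  shows "(\<integral>\<^sup>+v. ennreal ((8 + 2 * v\<^sup>2 / e\<^sup>2) * psi (s * \<bar>v\<bar>)) * (\<Sum>k. gamma_jump (a k) v) \<partial>lborel)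
    \<le> ennreal (S / \<alpha>\<^sup>2 * jump_const \<alpha> e (s * \<alpha>))"
proof -
  have J: "0 \<le> jump_const \<alpha> e (s * \<alpha>)" using s \<alpha> by (intro nn_integral_jump_const) auto
  have "(\<integral>\<^sup>+v. ennreal ((8 + 2 * v\<^sup>2 / e\<^sup>2) * psi (s * \<bar>v\<bar>)) * (\<Sum>k. gamma_jump (a k) v) \<partial>lborel)
     = (\<Sum>k. \<integral>\<^sup>+v. ennreal ((8 + 2 * v\<^sup>2 / e\<^sup>2) * psi (s * \<bar>v\<bar>)) * gamma_jump (a k) v \<partial>lborel)"
    by (subst nn_integral_suminf[symmetric]) (auto simp: ennreal_suminf_cmult)
  also have "\<dots> \<le> ennreal (S / \<alpha>\<^sup>2 * jump_const \<alpha> e (s * \<alpha>))"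
  proof (rule suminf_le_const)
    fix n
    have "(\<Sum>k<n. \<integral>\<^sup>+v. ennreal ((8 + 2 * v\<^sup>2 / e\<^sup>2) * psi (s * \<bar>v\<bar>)) * gamma_jump (a k) v \<partial>lborel)
      \<le> (\<Sum>k<n. ennreal ((a k)\<^sup>2 / \<alpha>\<^sup>2 * jump_const \<alpha> e (s * \<alpha>)))"
      by (intro sum_mono nn_integral_psi_gamma_jump_le a s \<alpha>)
    also have "\<dots> = ennreal ((\<Sum>k<n. (a k)\<^sup>2) / \<alpha>\<^sup>2 * jump_const \<alpha> e (s * \<alpha>))"
      using J by (subst sum_ennreal) (auto simp: sum_distrib_right sum_divide_distrib)
    also have "\<dots> \<le> ennreal (S / \<alpha>\<^sup>2 * jump_const \<alpha> e (s * \<alpha>))"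
      using J a(2)[of n] by (intro ennreal_leI mult_right_mono divide_right_mono) auto
    finally show "(\<Sum>k<n. \<integral>\<^sup>+v. ennreal ((8 + 2 * v\<^sup>2 / e\<^sup>2) * psi (s * \<bar>v\<bar>)) * gamma_jump (a k) v \<partial>lborel)
      \<le> ennreal (S / \<alpha>\<^sup>2 * jump_const \<alpha> e (s * \<alpha>))" .
  qed simp
  finally show ?thesis .
qed

text \<open>After tensorization each coordinate obeys the one-dimensional inequality with the same
  jump density. For a fixed jump \<open>v\<close> the coordinates can therefore be summed first,
  pointwise in \<open>z\<close>, before integrating over \<open>v\<close>; a bound on individual
  coordinates would bring back the dimension.\<close>

lemma Ent_exp_truncated_norm_le:
  fixes \<mu> :: "real measure"
  assumes \<mu>: "prob_space \<mu>" and [measurable_cong]: "sets \<mu> = sets borel"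
    and mls: "modified_log_sobolev \<mu> (\<lambda>v. \<Sum>k. gamma_jump (a k) v)"
    and a: "\<And>k. \<bar>a k\<bar> \<le> \<alpha>" "\<And>n. (\<Sum>k<n. (a k)\<^sup>2) \<le> S" and s: "0 < s" "s * \<alpha> < 1" and \<alpha>: "0 < \<alpha>"
    and m: "0 < m" "sqrt CARD('n) * e \<le> m" and e: "0 < e" and R: "0 \<le> R"
  defines "P \<equiv> PiM UNIV (\<lambda>_::'n::finite. \<mu>)"
  shows "Ent P (\<lambda>z. exp (s * truncated_norm m R z))
     \<le> S / \<alpha>\<^sup>2 * jump_const \<alpha> e (s * \<alpha>) * (\<integral>z. exp (s * truncated_norm m R z) \<partial>P)"
proof -
  interpret prob_space P unfolding P_def by (rule prob_space_PiM[OF \<mu>])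
  let ?g = "truncated_norm m R :: ('n \<Rightarrow> real) \<Rightarrow> real" and ?l = "\<lambda>v. \<Sum>k. gamma_jump (a k) v"
  have S: "0 \<le> S" using a(2)[of 0] by simp
  have J0: "0 \<le> jump_const \<alpha> e (s * \<alpha>)" using s \<alpha> by (intro nn_integral_jump_const) auto
  have g: "0 \<le> ?g z" "?g z \<le> R" for z using R by (auto simp: truncated_norm_def)
  have comp: "(\<lambda>z. z i) \<in> borel_measurable P" for i
    unfolding P_def using measurable_component_singleton[of i UNIV "\<lambda>_. \<mu>"] measurable_cong_sets[OF refl assms(2)] by simp
  have gm [measurable]: "?g \<in> borel_measurable P"
    unfolding truncated_norm_def using borel_measurable_vec_norm[OF comp] by measurable
  have upd: "(\<lambda>(z, v). z(i := z i + v)) \<in> measurable (P \<Otimes>\<^sub>M lborel) P" for i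
  proof -
    have [measurable]: "(\<lambda>p. fst p i) \<in> borel_measurable (P \<Otimes>\<^sub>M lborel)"
      by (rule measurable_compose[OF measurable_fst comp])
    show ?thesis
      unfolding split_beta' P_def
      by (rule measurable_fun_upd[where J = UNIV]) (auto simp: P_def[symmetric])
  qed
  have pb: "positive_bounded (\<lambda>z. exp (s * ?g z))"
    by (rule positive_bounded_exp[of _ "s * R"]) (use s g in \<open>auto simp: abs_mult\<close>)
  define T where "T i z = (\<integral>\<^sup>+v. ennreal (psi (s * ?g (z(i := z i + v)) - s * ?g z)) * ?l v \<partial>lborel)" for i z
  have Tm [measurable]: "T i \<in> borel_measurable P" for i
  proof -
    have [measurable]: "(\<lambda>p. ?g ((fst p)(i := fst p i + snd p))) \<in> borel_measurable (P \<Otimes>\<^sub>M lborel)"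
      using measurable_compose[OF upd gm] by (simp add: split_beta')
    have "(\<lambda>(z, v). ennreal (psi (s * ?g (z(i := z i + v)) - s * ?g z)) * ?l v) \<in> borel_measurable (P \<Otimes>\<^sub>M lborel)"
      unfolding split_beta' by measurable
    then show ?thesis unfolding T_def by (rule lborel.borel_measurable_nn_integral)
  qed
  have one: "ennreal (Ent \<mu> (\<lambda>u. exp (s * ?g (z(i := u))))) \<le> (\<integral>\<^sup>+x. ennreal (exp (s * ?g (z(i := x)))) * T i (z(i := x)) \<partial>\<mu>)" for z i
  proof -
    let ?\<phi> = "\<lambda>u. s * ?g (z(i := u))"
    have "bounded_lipschitz ?\<phi>"
      unfolding bounded_lipschitz_def
    proof (intro conjI exI allI)
      show "\<bar>?\<phi> x\<bar> \<le> s * R" for x using s g by (auto simp: abs_mult)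
      show "s-lipschitz_on UNIV ?\<phi>"
      proof (rule lipschitz_onI)
        fix x y :: real
        have "\<bar>?g (z(i := x)) - ?g (z(i := y))\<bar> \<le> \<bar>x - y\<bar>"
          using truncated_norm_upd_diff_le[of m R "z(i := y)" i "x - y"] by simp
        then have "s * \<bar>?g (z(i := x)) - ?g (z(i := y))\<bar> \<le> s * \<bar>x - y\<bar>" using s by (intro mult_left_mono) auto
        then show "dist (?\<phi> x) (?\<phi> y) \<le> s * dist x y"
          using s by (simp add: dist_real_def abs_mult flip: right_diff_distrib)
      qed (use s in simp)
    qed
    then have "ennreal (Ent \<mu> (\<lambda>u. exp (?\<phi> u))) \<le> (\<integral>\<^sup>+x. ennreal (exp (?\<phi> x)) * jump_energy ?l ?\<phi> x \<partial>\<mu>)"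
      using mls unfolding modified_log_sobolev_def by blast
    also have "(\<lambda>x. jump_energy ?l ?\<phi> x) = (\<lambda>x. T i (z(i := x)))"
      by (simp add: jump_energy_def T_def fun_eq_iff)
    finally show ?thesis .
  qed
  have sumT: "(\<Sum>i\<in>UNIV. T i z) \<le> ennreal (S / \<alpha>\<^sup>2 * jump_const \<alpha> e (s * \<alpha>))" if "z \<in> space P" for z
  proof -
    have [measurable]: "(\<lambda>v. ?g (z(i := z i + v))) \<in> borel_measurable borel" for i
      using measurable_compose[OF measurable_Pair1'[OF that] measurable_compose[OF upd[of i] gm]] by simp
    have "(\<Sum>i\<in>UNIV. T i z) = (\<integral>\<^sup>+v. (\<Sum>i\<in>UNIV. ennreal (psi (s * ?g (z(i := z i + v)) - s * ?g z)) * ?l v) \<partial>lborel)"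
      unfolding T_def by (rule nn_integral_sum[symmetric]) measurable
    also have "\<dots> \<le> (\<integral>\<^sup>+v. ennreal ((8 + 2 * v\<^sup>2 / e\<^sup>2) * psi (s * \<bar>v\<bar>)) * ?l v \<partial>lborel)"
    proof (rule nn_integral_mono)
      fix v :: real
      have "(\<Sum>i\<in>UNIV. psi (s * (?g (z(i := z i + v)) - ?g z))) \<le> (8 + 2 * v\<^sup>2 / e\<^sup>2) * psi (s * \<bar>v\<bar>)"
        by (intro sum_psi_increments_le s truncated_norm_upd_diff_le sum_square_truncated_norm_diff_le m e R)
      then have "(\<Sum>i\<in>UNIV. ennreal (psi (s * ?g (z(i := z i + v)) - s * ?g z))) \<le> ennreal ((8 + 2 * v\<^sup>2 / e\<^sup>2) * psi (s * \<bar>v\<bar>))"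
        by (subst sum_ennreal) (auto simp: psi_nonneg right_diff_distrib intro: ennreal_leI)
      then show "(\<Sum>i\<in>UNIV. ennreal (psi (s * ?g (z(i := z i + v)) - s * ?g z)) * ?l v) \<le> ennreal ((8 + 2 * v\<^sup>2 / e\<^sup>2) * psi (s * \<bar>v\<bar>)) * ?l v"
        by (subst sum_distrib_right[symmetric]) (rule mult_right_mono, auto)
    qed
    also have "\<dots> \<le> ennreal (S / \<alpha>\<^sup>2 * jump_const \<alpha> e (s * \<alpha>))"
      by (rule nn_integral_psi_jumps_le[OF a s \<alpha>])
    finally show ?thesis .
  qed
  have "ennreal (Ent P (\<lambda>z. exp (s * ?g z))) \<le> (\<Sum>i\<in>UNIV. \<integral>\<^sup>+z. ennreal (Ent \<mu> (\<lambda>u. exp (s * ?g (z(i := u))))) \<partial>P)"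
    using gm unfolding P_def by (intro Ent_PiM_le_nn_integral \<mu> pb) auto
  also have "\<dots> \<le> (\<Sum>i\<in>UNIV. \<integral>\<^sup>+z. (\<integral>\<^sup>+x. ennreal (exp (s * ?g (z(i := x)))) * T i (z(i := x)) \<partial>\<mu>) \<partial>P)"
    by (intro sum_mono nn_integral_mono one)
  also have "\<dots> = (\<Sum>i\<in>UNIV. \<integral>\<^sup>+z. ennreal (exp (s * ?g z)) * T i z \<partial>P)"
    using Tm gm unfolding P_def
    by (intro sum.cong refl nn_integral_PiM_resample[OF \<mu>, where \<Phi> = "\<lambda>z. ennreal (exp (s * ?g z)) * T i z" for i]) auto
  also have "\<dots> = (\<integral>\<^sup>+z. (\<Sum>i\<in>UNIV. ennreal (exp (s * ?g z)) * T i z) \<partial>P)"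
    by (rule nn_integral_sum[symmetric]) measurable
  also have "\<dots> \<le> (\<integral>\<^sup>+z. ennreal (exp (s * ?g z)) * ennreal (S / \<alpha>\<^sup>2 * jump_const \<alpha> e (s * \<alpha>)) \<partial>P)"
    using sumT by (intro nn_integral_mono) (simp add: sum_distrib_left[symmetric] mult_left_mono)
  also have "\<dots> = (\<integral>\<^sup>+z. ennreal (exp (s * ?g z)) \<partial>P) * ennreal (S / \<alpha>\<^sup>2 * jump_const \<alpha> e (s * \<alpha>))"
    by (rule nn_integral_multc) measurable
  also have "(\<integral>\<^sup>+z. ennreal (exp (s * ?g z)) \<partial>P) = ennreal (\<integral>z. exp (s * ?g z) \<partial>P)"
    by (intro nn_integral_eq_integral integrable_positive_bounded pb) auto
  also have "ennreal (\<integral>z. exp (s * ?g z) \<partial>P) * ennreal (S / \<alpha>\<^sup>2 * jump_const \<alpha> e (s * \<alpha>))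
      = ennreal (S / \<alpha>\<^sup>2 * jump_const \<alpha> e (s * \<alpha>) * (\<integral>z. exp (s * ?g z) \<partial>P))"
    using S J0 \<alpha> by (subst ennreal_mult[symmetric]) (auto simp: mult.commute)
  finally show ?thesis
    using S J0 \<alpha> by (subst (asm) ennreal_le_iff) (auto intro!: mult_nonneg_nonneg)
qed

lemma PiM_component_integral:
  fixes \<mu> :: "real measure" and f :: "real \<Rightarrow> real"
  assumes \<mu>: "prob_space \<mu>" and [measurable_cong]: "sets \<mu> = sets borel" and f: "integrable \<mu> f"
  shows "integrable (PiM UNIV (\<lambda>_::'n::finite. \<mu>)) (\<lambda>z. f (z i))"
    and "(\<integral>z. f (z i) \<partial>PiM UNIV (\<lambda>_::'n. \<mu>)) = (\<integral>x. f x \<partial>\<mu>)"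
proof -
  interpret product_prob_space "\<lambda>_::'n. \<mu>" UNIV by (intro product_prob_spaceI \<mu>)
  have d: "distr (PiM UNIV (\<lambda>_::'n. \<mu>)) \<mu> (\<lambda>z. z i) = \<mu>" by (rule PiM_component) simp
  have [measurable]: "f \<in> borel_measurable \<mu>" using f by simp
  have "integrable (distr (PiM UNIV (\<lambda>_::'n. \<mu>)) \<mu> (\<lambda>z. z i)) f" unfolding d by (rule f)
  then show "integrable (PiM UNIV (\<lambda>_::'n::finite. \<mu>)) (\<lambda>z. f (z i))"
    by (subst (asm) integrable_distr_eq) auto
  have "(\<integral>x. f x \<partial>\<mu>) = (\<integral>x. f x \<partial>distr (PiM UNIV (\<lambda>_::'n. \<mu>)) \<mu> (\<lambda>z. z i))" unfolding d ..
  also have "\<dots> = (\<integral>z. f (z i) \<partial>PiM UNIV (\<lambda>_::'n. \<mu>))" by (rule integral_distr) auto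
  finally show "(\<integral>z. f (z i) \<partial>PiM UNIV (\<lambda>_::'n. \<mu>)) = (\<integral>x. f x \<partial>\<mu>)" ..
qed

text \<open>Chernoff's bound for the truncated norm at level \<open>m + x\<close>, with Herbst's
  estimate of the exponential moment and \<open>E g \<le> m\<close>.\<close>

lemma vec_norm_deviation:
  fixes \<mu> :: "real measure"
  assumes \<mu>: "prob_space \<mu>" and sets [measurable_cong]: "sets \<mu> = sets borel"
    and mls: "modified_log_sobolev \<mu> (\<lambda>v. \<Sum>k. gamma_jump (a k) v)"
    and a: "\<And>k. \<bar>a k\<bar> \<le> \<alpha>" "\<And>n. (\<Sum>k<n. (a k)\<^sup>2) \<le> S" and \<alpha>: "0 < \<alpha>"
    and int: "integrable \<mu> (\<lambda>x. \<bar>x\<bar>)" and e: "e = (\<integral>x. \<bar>x\<bar> \<partial>\<mu>)" "0 < e"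
    and b: "0 < b" "b < 1"
  defines "P \<equiv> PiM UNIV (\<lambda>_::'n::finite. \<mu>)"
  defines "m \<equiv> (\<integral>z. vec_norm z \<partial>P)"
  shows "measure P {z \<in> space P. x \<le> vec_norm z - 2 * m}
    \<le> exp (- (1 - b) * (x / \<alpha>) + S / \<alpha>\<^sup>2 * (- 4 * ln b - 4 * (1 - b) + \<alpha>\<^sup>2 / e\<^sup>2 * (1 / b\<^sup>2 - 1 - 2 * (1 - b))))"
proof -
  interpret prob_space P unfolding P_def by (rule prob_space_PiM[OF \<mu>])
  have comp [measurable]: "(\<lambda>z. z i) \<in> borel_measurable P" for i
    unfolding P_def using measurable_component_singleton[of i UNIV "\<lambda>_. \<mu>"] measurable_cong_sets[OF refl sets] by simp
  have nm [measurable]: "vec_norm \<in> borel_measurable P" using borel_measurable_vec_norm[of "\<lambda>z. z" P, OF comp] by simp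
  have ci: "integrable P (\<lambda>z. \<bar>z i\<bar>)" "(\<integral>z. \<bar>z i\<bar> \<partial>P) = e" for i
    unfolding P_def e using PiM_component_integral[OF \<mu> sets int] by auto
  have nint: "integrable P vec_norm"
    by (rule Bochner_Integration.integrable_bound[where f = "\<lambda>z. \<Sum>i\<in>UNIV. \<bar>z i\<bar>"])
       (use ci vec_norm_le_sum_abs in \<open>auto simp: sum_nonneg\<close>)
  have "real CARD('n) * e = (\<integral>z. (\<Sum>i\<in>UNIV. \<bar>z i\<bar>) \<partial>P)" using ci by simp
  also have "\<dots> \<le> (\<integral>z. sqrt CARD('n) * vec_norm z \<partial>P)"
    using ci nint by (intro integral_mono sum_abs_le_vec_norm) auto
  also have "\<dots> = sqrt CARD('n) * m" by (simp add: m_def)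
  finally have "sqrt CARD('n) * (sqrt CARD('n) * e) \<le> sqrt CARD('n) * m" by (simp flip: mult.assoc)
  then have m2: "sqrt CARD('n) * e \<le> m" by simp
  moreover have "0 < sqrt CARD('n) * e" using e by simp
  ultimately have m1: "0 < m" by linarith
  define t where "t = (1 - b) / \<alpha>"
  have t: "0 < t" "t * \<alpha> = 1 - b" using b \<alpha> by (auto simp: t_def)
  \<comment> \<open>A cap of at least \<open>m + x\<close> does not affect the event; the absolute
    value keeps it nonnegative, since \<open>x\<close> is an arbitrary real.\<close>
  define R where "R = \<bar>m + x\<bar>"
  have R: "0 \<le> R" "m + x \<le> R" by (auto simp: R_def)
  let ?g = "truncated_norm m R :: ('n \<Rightarrow> real) \<Rightarrow> real"
  have g: "0 \<le> ?g z" "?g z \<le> R" for z using R by (auto simp: truncated_norm_def)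
  have gm [measurable]: "?g \<in> borel_measurable P" unfolding truncated_norm_def by measurable
  have gi: "integrable P ?g" by (rule integrable_bounded[of _ R]) (use g in auto)
  \<comment> \<open>The solution of \<open>s * \<kappa>' s - \<kappa> s = S / \<alpha>\<^sup>2 *
    jump_const \<alpha> e (s * \<alpha>)\<close>. It is unique up to a multiple of \<open>s\<close>,
    and the linear terms are fixed by \<open>\<kappa>' 0 = 0\<close>.\<close>
  define \<kappa> where "\<kappa> s = S / \<alpha>\<^sup>2 * (- 4 * ln (1 - s * \<alpha>) - 4 * (s * \<alpha>) + \<alpha>\<^sup>2 / e\<^sup>2 * (1 / (1 - s * \<alpha>)\<^sup>2 - 1 - 2 * (s * \<alpha>)))" for s
  define \<kappa>' where "\<kappa>' s = S / \<alpha>\<^sup>2 * (4 * \<alpha> / (1 - s * \<alpha>) - 4 * \<alpha> + \<alpha>\<^sup>2 / e\<^sup>2 * (2 * \<alpha> / (1 - s * \<alpha>) ^ 3 - 2 * \<alpha>))" for s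
  have small: "0 < 1 - s * \<alpha>" if "s \<le> t" for s
  proof -
    have "s * \<alpha> \<le> t * \<alpha>" using that \<alpha> by (intro mult_right_mono) auto
    then show ?thesis using t(2) b by linarith
  qed
  have "(\<integral>z. exp (t * ?g z) \<partial>P) \<le> exp (t * (\<integral>z. ?g z \<partial>P) + \<kappa> t)"
  proof (rule Herbst[OF gm g t(1), where \<kappa>' = \<kappa>' and \<delta> = "\<lambda>s. S / \<alpha>\<^sup>2 * jump_const \<alpha> e (s * \<alpha>)"])
    fix s assume s: "0 < s" "s \<le> t"
    show "Ent P (\<lambda>z. exp (s * ?g z)) \<le> S / \<alpha>\<^sup>2 * jump_const \<alpha> e (s * \<alpha>) * (\<integral>z. exp (s * ?g z) \<partial>P)"
      unfolding P_def using small[OF s(2)]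
      by (intro Ent_exp_truncated_norm_le[OF \<mu> sets mls a s(1) _ \<alpha> m1 m2 e(2) R(1)]) simp
    define q where "q = 1 - s * \<alpha>"
    have q: "0 < q" "s * \<alpha> = 1 - q" using small[OF s(2)] by (auto simp: q_def)
    have 1: "s * (4 * \<alpha> / q - 4 * \<alpha> + \<alpha>\<^sup>2 / e\<^sup>2 * (2 * \<alpha> / q ^ 3 - 2 * \<alpha>))
       = 4 * (s * \<alpha>) / q - 4 * (s * \<alpha>) + \<alpha>\<^sup>2 / e\<^sup>2 * (2 * (s * \<alpha>) / q ^ 3 - 2 * (s * \<alpha>))"
      by (simp add: algebra_simps)
    have "s * \<kappa>' s - \<kappa> s = S / \<alpha>\<^sup>2 * (s * (4 * \<alpha> / q - 4 * \<alpha> + \<alpha>\<^sup>2 / e\<^sup>2 * (2 * \<alpha> / q ^ 3 - 2 * \<alpha>))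
        - (- 4 * ln q - 4 * (s * \<alpha>) + \<alpha>\<^sup>2 / e\<^sup>2 * (1 / q\<^sup>2 - 1 - 2 * (s * \<alpha>))))"
      unfolding \<kappa>_def \<kappa>'_def q_def[symmetric] by (simp only: right_diff_distrib mult.left_commute)
    also have "\<dots> = S / \<alpha>\<^sup>2 * jump_const \<alpha> e (s * \<alpha>)"
      unfolding 1 jump_const_def q_def[symmetric]
      by (rule arg_cong[where f = "(*) (S / \<alpha>\<^sup>2)"]) (simp add: algebra_simps add_divide_distrib diff_divide_distrib)
    finally show "s * \<kappa>' s - \<kappa> s = S / \<alpha>\<^sup>2 * jump_const \<alpha> e (s * \<alpha>)" .
  next
    fix s assume "0 \<le> s" "s \<le> t"
    then have q: "0 < 1 - s * \<alpha>" by (intro small)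
    have d: "((\<lambda>s. 1 / (1 - s * \<alpha>)\<^sup>2) has_real_derivative 2 * \<alpha> / (1 - s * \<alpha>) ^ 3) (at s)"
    proof -
      have "((\<lambda>s. 1 / (1 - s * \<alpha>)\<^sup>2) has_real_derivative - (2 * (1 - s * \<alpha>) * - \<alpha>) / ((1 - s * \<alpha>)\<^sup>2 * (1 - s * \<alpha>)\<^sup>2)) (at s)"
        using q by (auto intro!: derivative_eq_intros)
      also have "- (2 * (1 - s * \<alpha>) * - \<alpha>) / ((1 - s * \<alpha>)\<^sup>2 * (1 - s * \<alpha>)\<^sup>2) = 2 * \<alpha> / (1 - s * \<alpha>) ^ 3"
      proof -
        have "- (2 * p * - \<alpha>) / (p\<^sup>2 * p\<^sup>2) = 2 * \<alpha> / p ^ 3" if "0 < p" for p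
          using that by (simp add: power2_eq_square power3_eq_cube)
        then show ?thesis using q by blast
      qed
      finally show ?thesis .
    qed
    have l: "((\<lambda>s. ln (1 - s * \<alpha>)) has_real_derivative - \<alpha> / (1 - s * \<alpha>)) (at s)"
      using q by (auto intro!: derivative_eq_intros)
    show "(\<kappa> has_real_derivative \<kappa>' s) (at s)"
    proof -
      have lin: "((\<lambda>s. c * (s * \<alpha>)) has_real_derivative c * \<alpha>) (at s)" for c
        by (auto intro!: derivative_eq_intros)
      have "(\<kappa> has_real_derivative S / \<alpha>\<^sup>2 * (- 4 * (- \<alpha> / (1 - s * \<alpha>)) - 4 * \<alpha>
          + \<alpha>\<^sup>2 / e\<^sup>2 * (2 * \<alpha> / (1 - s * \<alpha>) ^ 3 - 0 - 2 * \<alpha>))) (at s)"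
        unfolding \<kappa>_def by (intro DERIV_cmult DERIV_add DERIV_diff DERIV_const d l lin)
      then show ?thesis by (simp add: \<kappa>'_def)
    qed
  qed (simp_all add: \<kappa>_def \<kappa>'_def)
  also have "\<dots> \<le> exp (t * m + \<kappa> t)"
  proof -
    have "(\<integral>z. ?g z \<partial>P) \<le> (\<integral>z. vec_norm z \<partial>P)"
      using gi nint m1 by (intro integral_mono) (auto simp: truncated_norm_def min_le_iff_disj)
    then show ?thesis using t(1) by (simp add: m_def)
  qed
  finally have mgf: "(\<integral>z. exp (t * ?g z) \<partial>P) \<le> exp (t * m + \<kappa> t)" .
  have ei: "integrable P (\<lambda>z. exp (t * ?g z))"
    by (rule integrable_bounded[of _ "exp (t * R)"]) (use g t in auto)
  have "measure P {z \<in> space P. x \<le> vec_norm z - 2 * m} = (\<integral>z. indicator {z \<in> space P. x \<le> vec_norm z - 2 * m} z \<partial>P)"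
    by simp
  also have "\<dots> \<le> (\<integral>z. exp (t * ?g z) * exp (- t * (m + x)) \<partial>P)"
  proof (rule integral_mono)
    show "integrable P (\<lambda>z. indicator {z \<in> space P. x \<le> vec_norm z - 2 * m} z :: real)"
      by (rule integrable_bounded[of _ 1]) (auto simp: indicator_def)
    show "integrable P (\<lambda>z. exp (t * ?g z) * exp (- t * (m + x)))" using ei by simp
    fix z
    show "indicator {z \<in> space P. x \<le> vec_norm z - 2 * m} z \<le> exp (t * ?g z) * exp (- t * (m + x))"
    proof (cases "x \<le> vec_norm z - 2 * m")
      case True
      then have "m + x \<le> ?g z" using R by (auto simp: truncated_norm_def)
      then have "0 \<le> t * (?g z - (m + x))" using t(1) by simp
      then have "1 \<le> exp (t * ?g z + - t * (m + x))" by (simp add: algebra_simps)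
      then have "1 \<le> exp (t * ?g z) * exp (- t * (m + x))" by (simp only: exp_add)
      then show ?thesis by (auto simp: indicator_def)
    next
      case False
      then show ?thesis by simp
    qed
  qed
  also have "\<dots> = (\<integral>z. exp (t * ?g z) \<partial>P) * exp (- t * (m + x))" by simp
  also have "\<dots> \<le> exp (t * m + \<kappa> t) * exp (- t * (m + x))" by (rule mult_right_mono[OF mgf]) simp
  also have "\<dots> = exp (- (1 - b) * (x / \<alpha>) + \<kappa> t)"
    by (simp add: t_def algebra_simps add_divide_distrib diff_divide_distrib flip: exp_add)
  finally show ?thesis unfolding \<kappa>_def t(2) by simp
qed

section \<open>The constants and the final estimate\<close>

text \<open>The left side is \<open>\<kappa> t\<close> at \<open>1 - t * \<alpha> = b\<close> with
  \<open>S = 4 * r\<^sup>2\<close>. The two linear terms in \<open>1 - b\<close> combine to the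
  middle term of the constant.\<close>

lemma deviation_const_eq:
  assumes "0 < \<alpha>" "0 < e" "0 < b"
  shows "4 * r\<^sup>2 / \<alpha>\<^sup>2 * (- 4 * ln b - 4 * (1 - b) + \<alpha>\<^sup>2 / e\<^sup>2 * (1 / b\<^sup>2 - 1 - 2 * (1 - b))) = deviation_const r \<alpha> e b"
proof -
  have 1: "4 * r\<^sup>2 / \<alpha>\<^sup>2 * (\<alpha>\<^sup>2 / e\<^sup>2 * y) = 4 * r\<^sup>2 / e\<^sup>2 * y" for y using assms by simp
  have 2: "1 / b\<^sup>2 - 1 = (1 - b\<^sup>2) / b\<^sup>2" using assms by (simp add: diff_divide_distrib)
  show ?thesis
    unfolding deviation_const_def distrib_left[of "4 * r\<^sup>2 / \<alpha>\<^sup>2"] 1 2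
    by (simp add: algebra_simps add_divide_distrib diff_divide_distrib)
qed

text \<open>Ensures that the threshold of the second inequality is positive. The constant is a sum
  of multiples of \<open>- ln b - (1 - b)\<close> and
  \<open>(1 - b\<^sup>2) / b\<^sup>2 - 2 * (1 - b)\<close>. The case \<open>e = 0\<close> is
  included, where division by zero makes the second multiple vanish.\<close>

lemma deviation_const_pos:
  assumes "0 < r" "0 < \<alpha>" "0 < b" "b < 1"
  shows "0 < deviation_const r \<alpha> e b"
proof -
  have "ln b < b - 1" using assms ln_le_minus_one[of b] ln_eq_minus_one[of b] by fastforce
  then have 1: "0 < 16 * r\<^sup>2 / \<alpha>\<^sup>2 * (- ln b - (1 - b))" using assms by (intro mult_pos_pos) auto
  have "2 * (1 - b) \<le> (1 - b\<^sup>2) / b\<^sup>2"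
  proof -
    have "2 * b\<^sup>2 \<le> 1 + b" using assms by (simp add: power2_eq_square) (smt (verit) mult_left_le)
    then have "2 * b\<^sup>2 * (1 - b) \<le> (1 + b) * (1 - b)" using assms by (intro mult_right_mono) auto
    then show ?thesis using assms by (simp add: field_simps power2_eq_square)
  qed
  then have 2: "0 \<le> 4 * r\<^sup>2 / e\<^sup>2 * ((1 - b\<^sup>2) / b\<^sup>2 - 2 * (1 - b))" by (intro mult_nonneg_nonneg) auto
  have "deviation_const r \<alpha> e b = 16 * r\<^sup>2 / \<alpha>\<^sup>2 * (- ln b - (1 - b)) + 4 * r\<^sup>2 / e\<^sup>2 * ((1 - b\<^sup>2) / b\<^sup>2 - 2 * (1 - b))"
    unfolding deviation_const_def by (simp add: algebra_simps add_divide_distrib diff_divide_distrib)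
  then show ?thesis using 1 2 by linarith
qed

text \<open>Square-summability makes the sequence tend to zero, so all but finitely many terms lie
  below the nonzero \<open>\<bar>a j\<bar>\<close>, and the supremum is attained on an initial
  segment.\<close>

lemma greatest_abs_of_summable_square:
  fixes a :: "nat \<Rightarrow> real"
  assumes "summable (\<lambda>k. (a k)\<^sup>2)" "a j \<noteq> 0"
  shows "0 < (GREATEST r. r \<in> range (\<lambda>k. \<bar>a k\<bar>))" "\<bar>a k\<bar> \<le> (GREATEST r. r \<in> range (\<lambda>k. \<bar>a k\<bar>))"
proof -
  have "(\<lambda>k. (a k)\<^sup>2) \<longlonglongrightarrow> 0" using assms(1) by (rule summable_LIMSEQ_zero)
  then have "\<forall>\<^sub>F k in sequentially. (a k)\<^sup>2 < (a j)\<^sup>2" by (rule order_tendstoD) (use assms in simp)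
  then obtain n where n: "\<And>k. n \<le> k \<Longrightarrow> (a k)\<^sup>2 < (a j)\<^sup>2" by (auto simp: eventually_sequentially)
  then have "j < n" by (metis less_irrefl not_le)
  let ?A = "(\<lambda>k. \<bar>a k\<bar>) ` {..<n}"
  have A: "finite ?A" "?A \<noteq> {}" using \<open>j < n\<close> by auto
  have le: "\<bar>a k\<bar> \<le> Max ?A" for k
  proof (cases "k < n")
    case True
    then show ?thesis using A by (intro Max_ge) auto
  next
    case False
    then have "(a k)\<^sup>2 < (a j)\<^sup>2" by (intro n) simp
    then have "\<bar>a k\<bar> \<le> \<bar>a j\<bar>" by (simp add: abs_le_square_iff)
    also have "\<dots> \<le> Max ?A" using A \<open>j < n\<close> by (intro Max_ge) auto
    finally show ?thesis .
  qed
  have "Max ?A \<in> ?A" using A by (rule Max_in)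
  then have eq: "(GREATEST r. r \<in> range (\<lambda>k. \<bar>a k\<bar>)) = Max ?A"
    by (intro Greatest_equality) (use le in auto)
  show "\<bar>a k\<bar> \<le> (GREATEST r. r \<in> range (\<lambda>k. \<bar>a k\<bar>))" unfolding eq by (rule le)
  show "0 < (GREATEST r. r \<in> range (\<lambda>k. \<bar>a k\<bar>))"
    unfolding eq using le[of j] assms(2) by linarith
qed

theorem proposition4p7:
  fixes M :: "'w measure" and B :: "real \<Rightarrow> 'w \<Rightarrow> real"
    and f\<^sub>2 :: "real \<times> real \<Rightarrow> real" and h :: "nat \<Rightarrow> real \<Rightarrow> real" and a :: "nat \<Rightarrow> real"
    and J :: "'w \<Rightarrow> real"
    and N :: "'v measure" and X :: "'n::finite \<Rightarrow> 'v \<Rightarrow> real"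
    and a_max E_norm b :: real and K :: "real \<Rightarrow> real"
  assumes BM: "standard_brownian_motion M B"
    and f2_L2: "square_integrable quadrant f\<^sub>2"
    and f2_sym: "AE (s, t) in quadrant. f\<^sub>2 (s, t) = f\<^sub>2 (t, s)"
    and f2_nonzero: "\<not> (AE z in quadrant. f\<^sub>2 z = 0)"
    and expansion: "eigen_expansion f\<^sub>2 h a"
    and J: "is_second_wiener_integral M B h a J"
    and N: "prob_space N"
    and X_indep: "prob_space.indep_vars N (\<lambda>_. borel) X UNIV"
    and X_copies: "\<And>i. distr N borel (X i) = distr M borel J"
    and b: "0 < b" "b < 1"
  defines "a_max \<equiv> (GREATEST r. r \<in> range (\<lambda>k. \<bar>a k\<bar>))"
    and "E_norm \<equiv> (\<integral>\<omega>. norm (\<chi> i. X i \<omega>) \<partial>N)"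
    and "K \<equiv> deviation_const (L2_norm quadrant f\<^sub>2) a_max (\<integral>\<omega>. \<bar>J \<omega>\<bar> \<partial>M)"
  shows "(\<forall>x>0. \<P>(\<omega> in N. norm (\<chi> i. X i \<omega>) - 2 * E_norm \<ge> x)
             \<le> exp (- (1 - b) * (x / a_max) + K b)) \<and>
         (\<forall>x. x \<ge> 2 * a_max / b * K (b / 2) \<longrightarrow>
           \<P>(\<omega> in N. norm (\<chi> i. X i \<omega>) - 2 * E_norm \<ge> x)
             \<le> exp (- (1 - b) * (x / a_max)))"
proof -
  interpret BM: standard_brownian_motion M B by (rule BM)
  interpret N: prob_space N by (rule N)
  let ?r = "L2_norm quadrant f\<^sub>2" and ?\<mu> = "distr M borel J"
  define e where "e = (\<integral>\<omega>. \<bar>J \<omega>\<bar> \<partial>M)"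
  have sa: "summable (\<lambda>k. (a k)\<^sup>2)" and h: "\<And>j k. L2_inner half_line (h j) (h k) = (if j = k then 1 else 0)"
    using expansion by (auto simp: eigen_expansion_def L2_orthonormal_basis_def)
  have lim: "(\<lambda>n. \<Sum>k<n. (a k)\<^sup>2) \<longlonglongrightarrow> 4 * ?r\<^sup>2" by (rule eigen_expansion_norm[OF expansion])
  have S: "(\<Sum>k<n. (a k)\<^sup>2) \<le> 4 * ?r\<^sup>2" for n
    by (rule incseq_le[OF _ lim]) (auto intro!: incseq_SucI)
  have r: "0 < ?r"
  proof (rule ccontr)
    assume "\<not> 0 < ?r"
    then have "?r\<^sup>2 = 0" using L2_norm_nonneg[of quadrant f\<^sub>2] by simp
    then have "(\<integral>z. (f\<^sub>2 z)\<^sup>2 \<partial>quadrant) = 0" by (simp add: L2_norm_square)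
    then have "AE z in quadrant. (f\<^sub>2 z)\<^sup>2 = 0"
      using f2_L2 by (subst (asm) integral_nonneg_eq_0_iff_AE) (auto simp: square_integrable_def)
    then show False using f2_nonzero by simp
  qed
  have "\<exists>j. a j \<noteq> 0"
  proof (rule ccontr)
    assume "\<not> (\<exists>j. a j \<noteq> 0)"
    then have "(\<lambda>n. 0) \<longlonglongrightarrow> 4 * ?r\<^sup>2" using lim by simp
    then show False using r LIMSEQ_unique[OF tendsto_const] by fastforce
  qed
  then obtain j where j: "a j \<noteq> 0" by blast
  have am: "0 < a_max" "\<And>k. \<bar>a k\<bar> \<le> a_max"
    unfolding a_max_def by (rule greatest_abs_of_summable_square[OF sa j])+
  obtain W where W: "L2_tendsto M (\<lambda>n \<omega>. 1/2 * (\<Sum>k<n. a k * ((W k \<omega>)\<^sup>2 - 1))) J"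
    using J unfolding is_second_wiener_integral_def by blast
  have Ji: "integrable M J" by (rule BM.L2_tendsto_L1(2)[OF W])
  then have [measurable]: "J \<in> borel_measurable M" by simp
  have Xm [measurable]: "X i \<in> borel_measurable N" for i
    using X_indep by (auto simp: N.indep_vars_def)
  have norm_meas [measurable]: "(\<lambda>\<omega>. norm (\<chi> i. X i \<omega>)) \<in> borel_measurable N"
    using borel_measurable_vec_norm[of "\<lambda>\<omega> i. X i \<omega>" N] by (simp add: vec_norm_def)
  have Kpos: "0 < K c" if "0 < c" "c < 1" for c
    unfolding K_def by (rule deviation_const_pos[OF r am(1) that])
  have xpos: "0 < x" if "2 * a_max / b * K (b / 2) \<le> x" for x
    using that Kpos[of "b / 2"] am(1) b by (smt (verit) divide_pos_pos mult_pos_pos half_gt_zero field_sum_of_halves)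
  have "0 \<le> e" by (simp add: e_def)
  then consider "e = 0" | "0 < e" by linarith
  then show ?thesis
  proof cases
    \<comment> \<open>Here \<open>J\<close> vanishes almost surely, and with it all copies and the
      mean norm; the events are null for positive \<open>x\<close>.\<close>
    case 1
    have "AE \<omega> in M. \<bar>J \<omega>\<bar> = 0"
      using 1 Ji unfolding e_def by (subst (asm) integral_nonneg_eq_0_iff_AE) auto
    then have "AE x in ?\<mu>. x = 0" by (subst AE_distr_iff) auto
    then have "AE \<omega> in N. X i \<omega> = 0" for i
      unfolding X_copies[symmetric, of i] by (subst (asm) AE_distr_iff) auto
    then have "AE \<omega> in N. \<forall>i\<in>UNIV. X i \<omega> = 0" by (intro AE_finite_allI) auto
    then have zero: "AE \<omega> in N. norm (\<chi> i. X i \<omega>) = 0"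
      by eventually_elim (simp add: vec_eq_iff)
    then have "E_norm = (\<integral>\<omega>. 0 \<partial>N)" unfolding E_norm_def by (intro integral_cong_AE) auto
    then have "\<P>(\<omega> in N. norm (\<chi> i. X i \<omega>) - 2 * E_norm \<ge> x) = 0" if "0 < x" for x
    proof -
      have "AE \<omega> in N. \<not> x \<le> norm (\<chi> i. X i \<omega>) - 2 * E_norm"
        using zero by eventually_elim (use \<open>E_norm = (\<integral>\<omega>. 0 \<partial>N)\<close> that in simp)
      then show ?thesis by (subst N.prob_Collect_eq_0) auto
    qed
    then show ?thesis using xpos by auto
  next
    case 2
    let ?P = "PiM UNIV (\<lambda>_::'n. ?\<mu>)"
    let ?X = "\<lambda>\<omega> i. X i \<omega>"
    have \<mu>: "prob_space ?\<mu>" by (rule BM.prob_space_distr) simp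
    have mls: "modified_log_sobolev ?\<mu> (\<lambda>v. \<Sum>k. gamma_jump (a k) v)"
      by (rule BM.modified_log_sobolev_second_wiener_integral[OF h sa J])
    have int: "integrable ?\<mu> (\<lambda>x. \<bar>x\<bar>)" using Ji by (subst integrable_distr_eq) auto
    have e: "e = (\<integral>x. \<bar>x\<bar> \<partial>?\<mu>)" unfolding e_def by (subst integral_distr) auto
    have law: "distr N (PiM UNIV (\<lambda>_. borel)) ?X = ?P"
    proof -
      have "distr N (PiM UNIV (\<lambda>_. borel)) (\<lambda>\<omega>. \<lambda>i\<in>UNIV. X i \<omega>) = PiM UNIV (\<lambda>i. distr N borel (X i))"
        using X_indep by (subst (asm) N.indep_vars_iff_distr_eq_PiM') auto
      then show ?thesis by (simp add: X_copies restrict_def)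
    qed
    have Xmeas [measurable]: "?X \<in> measurable N (PiM UNIV (\<lambda>_. borel))"
      using measurable_restrict[of UNIV X N "\<lambda>_. borel"] by (simp add: restrict_def)
    have vm [measurable]: "vec_norm \<in> borel_measurable (PiM (UNIV :: 'n set) (\<lambda>_. borel))"
      using borel_measurable_vec_norm[of "\<lambda>z. z" "PiM (UNIV :: 'n set) (\<lambda>_. borel)"] by simp
    have En: "E_norm = (\<integral>z. vec_norm z \<partial>?P)"
      unfolding law[symmetric] E_norm_def by (subst integral_distr) (auto simp: vec_norm_def)
    have P: "\<P>(\<omega> in N. norm (\<chi> i. X i \<omega>) - 2 * E_norm \<ge> x) = measure ?P {z \<in> space ?P. x \<le> vec_norm z - 2 * (\<integral>z. vec_norm z \<partial>?P)}" for x
    proof -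
      have "measure ?P {z \<in> space ?P. x \<le> vec_norm z - 2 * E_norm}
        = measure N (?X -` {z \<in> space (PiM UNIV (\<lambda>_. borel)). x \<le> vec_norm z - 2 * E_norm} \<inter> space N)"
        unfolding law[symmetric] space_distr by (rule measure_distr) measurable
      also have "?X -` {z \<in> space (PiM UNIV (\<lambda>_. borel)). x \<le> vec_norm z - 2 * E_norm} \<inter> space N = {\<omega> \<in> space N. x \<le> norm (\<chi> i. X i \<omega>) - 2 * E_norm}"
        by (auto simp: vec_norm_def space_PiM)
      finally show ?thesis by (simp add: En)
    qed
    \<comment> \<open>Stated for a free parameter \<open>c\<close>, because the two inequalities use
      it at \<open>b\<close> and at \<open>b / 2\<close>.\<close>
    have main: "\<P>(\<omega> in N. norm (\<chi> i. X i \<omega>) - 2 * E_norm \<ge> x) \<le> exp (- (1 - c) * (x / a_max) + K c)" if c: "0 < c" "c < 1" for c x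
      using vec_norm_deviation[OF \<mu> _ mls am(2) S am(1) int e 2 c, of x, where 'n = 'n]
      unfolding P K_def e_def[symmetric] deviation_const_eq[OF am(1) 2 c(1)] by simp
    show ?thesis
    proof (intro conjI allI impI)
      \<comment> \<open>The bound with parameter \<open>b / 2\<close> decays faster by the factor
        \<open>exp (- b / 2 * (x / a_max))\<close>, and beyond the threshold this absorbs
        \<open>K (b / 2)\<close>.\<close>
      fix x assume "2 * a_max / b * K (b / 2) \<le> x"
      then have "K (b / 2) \<le> b / 2 * (x / a_max)" using am(1) b by (simp add: field_simps)
      moreover have "- (1 - b / 2) * y + k \<le> - (1 - b) * y" if "k \<le> b / 2 * y" for y k :: real
        using that by (simp add: algebra_simps)
      ultimately have "exp (- (1 - b / 2) * (x / a_max) + K (b / 2)) \<le> exp (- (1 - b) * (x / a_max))"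
        unfolding exp_le_cancel_iff by blast
      moreover have "\<P>(\<omega> in N. norm (\<chi> i. X i \<omega>) - 2 * E_norm \<ge> x) \<le> exp (- (1 - b / 2) * (x / a_max) + K (b / 2))"
        by (rule main) (use b in auto)
      ultimately show "\<P>(\<omega> in N. norm (\<chi> i. X i \<omega>) - 2 * E_norm \<ge> x) \<le> exp (- (1 - b) * (x / a_max))"
        by linarith
    qed (rule main[OF b])
  qed
qed

end
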